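(* Let $\epsilon > 0$. For some positive integers $m, d$, let $X \subset \mathbb{R}^m$ be a point set of size $n$ with doubling dimension $d_X$, and let $G : \mathbb{R}^m \to \mathbb{R}^d$ be a random projection. Let $\mathcal{M}$ be the minimum spanning tree of $X$, with $M = \mathrm{cost}_X(\mathcal{M})$, and let $\widetilde{\mathcal{M}}$ be the minimum spanning tree of $GX$, with $\widetilde{M} = \mathrm{cost}_{GX}(\widetilde{\mathcal{M}})$. Then, for some sufficiently large constant $C_6$, if $d \ge C_6 \cdot \epsilon^{-2} \cdot (\log \epsilon^{-1} \cdot d_X + \log\log n)$, the following are true: 1. The cost of the MST is preserved under projection with probability at least $\frac{9}{10}$: that is, with probability at least $\frac{9}{10}$ over $G$, $\widetilde{M} \in [1-\epsilon, 1+\epsilon] \cdot M$. 2. The optimal projected MST $\widetilde{\mathcal{M}}$ is still an approximate MST in the original dimension with probability at least $\frac{9}{10}$: that is, with probability at least $\frac{9}{10}$ over $G$, $\mathrm{cost}_X(\widetilde{\mathcal{M}}) \in [1, 1+\epsilon] \cdot M$.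
   Context: All norms are Euclidean. Spanning trees of $X$ and of $GX = \{Gx : x \in X\}$ are both regarded as spanning trees $T$ (sets of edges $(x,y)$) on the vertex set $X$, via the correspondence $x \leftrightarrow Gx$. $\mathrm{cost}_X(T) = \sum_{(x,y)\in T} \|x-y\|$ and $\mathrm{cost}_{GX}(T) = \sum_{(x,y) \in T} \|Gx - Gy\|$. A minimum spanning tree (MST) of $X$ (resp. $GX$) is a spanning tree minimizing $\mathrm{cost}_X$ (resp. $\mathrm{cost}_{GX}$). Doubling dimension: for $x \in X$, $r > 0$ let $B(x,r)$ be the ball of radius $r$ centered at $x$, intersected with $X$. The doubling constant $\lambda_X$ is the smallest $\lambda$ such that for all $x \in X$ and $r > 0$ there is $S \subseteq X$ with $|S| \le \lambda$ and $B(x,r) \subseteq \bigcup_{s \in S} B(s, r/2)$. The doubling dimension is $d_X = \log \lambda_X$. A random projection from $\mathbb{R}^m$ to $\mathbb{R}^d$ is a random linear map $G$ given by a $d \times m$ matrix with i.i.d. entries drawn from $\mathcal{N}(0, 1/d)$ (variance $1/d$).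
   Formalization: ε is restricted to 0 < ε ≤ ε₀ for an arbitrary fixed ε₀ < 1, and C_6 may depend on ε₀ (only); as stated, with one C_6 for every ε > 0, the claim fails for ε > 1 and for ε near 1, where log ε^{-1}·d_X becomes negative or vanishes. *)

theory Defs
  imports "HOL-Probability.Probability" "Jordan_Normal_Form.Matrix"
begin

definition enorm :: "real vec \<Rightarrow> real" where
  "enorm v = L2_set (vec_index v) {..<dim_vec v}"

(* Closed balls; for a finite X, open balls give the same doubling constant. *)
definition ball_in :: "real vec set \<Rightarrow> real vec \<Rightarrow> real \<Rightarrow> real vec set" where
  "ball_in X x r = {y \<in> X. enorm (y - x) \<le> r}"

definition doubling_constant :: "real vec set \<Rightarrow> nat" where
  "doubling_constant X = (LEAST l. \<forall>x\<in>X. \<forall>r>0. \<exists>S\<subseteq>X.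
     finite S \<and> card S \<le> l \<and> ball_in X x r \<subseteq> (\<Union>s\<in>S. ball_in X s (r / 2)))"

definition doubling_dim :: "real vec set \<Rightarrow> real" where
  "doubling_dim X = log 2 (real (doubling_constant X))"

(* An undirected edge is represented by exactly one of the pairs (x, y), (y, x); an
   undirected graph thus has several representations T, all of the same cost.
   The symmetric relation T \<union> T\<inverse> is its adjacency relation. (The spanning_tree of
   AFP Graph_Theory forbids only directed cycles and is therefore not used.) *)

definition undirected_cycle :: "('a \<times> 'a) set \<Rightarrow> 'a list \<Rightarrow> bool" where
  "undirected_cycle T p \<longleftrightarrow> 3 \<le> length p \<and> distinct p \<and>
     (\<forall>i<length p. (p ! i, p ! (Suc i mod length p)) \<in> T \<union> T\<inverse>)"

definition is_spanning_tree :: "'a set \<Rightarrow> ('a \<times> 'a) set \<Rightarrow> bool" where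
  "is_spanning_tree V T \<longleftrightarrow>
     T \<subseteq> V \<times> V \<and> T \<inter> T\<inverse> = {} \<and>
     (\<forall>x\<in>V. \<forall>y\<in>V. (x, y) \<in> (T \<union> T\<inverse>)\<^sup>*) \<and>
     (\<nexists>p. undirected_cycle T p)"

(* Trees on the vertex set X are measured at the images of the vertices under f:
   f is the identity for X itself and x \<mapsto> G x for GX. *)

definition tree_cost :: "(real vec \<Rightarrow> real vec) \<Rightarrow> (real vec \<times> real vec) set \<Rightarrow> real" where
  "tree_cost f T = (\<Sum>(x, y)\<in>T. enorm (f x - f y))"

definition is_mst :: "real vec set \<Rightarrow> (real vec \<Rightarrow> real vec) \<Rightarrow> (real vec \<times> real vec) set \<Rightarrow> bool" where
  "is_mst X f T \<longleftrightarrow> is_spanning_tree X T \<and>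
     (\<forall>T'. is_spanning_tree X T' \<longrightarrow> tree_cost f T \<le> tree_cost f T')"

(* normal_density takes the standard deviation, so the entries have variance 1/d. *)
definition gaussian_entries :: "nat \<Rightarrow> nat \<Rightarrow> (nat \<times> nat \<Rightarrow> real) measure" where
  "gaussian_entries d m =
     Pi\<^sub>M ({..<d} \<times> {..<m}) (\<lambda>_. density lborel (normal_density 0 (sqrt (1 / real d))))"

definition proj :: "nat \<Rightarrow> nat \<Rightarrow> (nat \<times> nat \<Rightarrow> real) \<Rightarrow> real vec \<Rightarrow> real vec" where
  "proj d m \<omega> x = mat d m \<omega> *\<^sub>v x"

end

theory Submission
  imports Defs
begin

text \<open>
  Since the original minimum spanning tree costs about as much after projection, it suffices that
  a minimum spanning tree of \<open>GX\<close> has small total length on the edges contracted by more than a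
  factor \<open>1 - \<epsilon>/4\<close>. Both claims then follow by comparing with the original tree.

  Fix a scale \<open>r\<close>, nets \<open>N\<^sub>k\<close> of radius \<open>\<rho>\<^sub>k = \<delta> r / 2\<^sup>k\<close> with \<open>\<delta> \<approx> \<epsilon>\<close>, and round the endpoints of a
  contracted edge of length about \<open>r\<close> to level \<open>k\<close>. If in the projection the two endpoints stay close
  (relative to the projected edge) to their rounded versions, the cycle property of minimum spanning
  trees shows that the edge is determined by the rounded pair. At the first such level, either a
  pair of net points is badly contracted or some step between consecutive levels is badly expanded.
  By chi-square tail bounds the probability of these events beats the number of pairs, which is
  \<open>\<lambda>\<^bsub>X\<^esub>\<^bsup>O(log 1/\<epsilon> + k)\<^esup> |N\<^sub>k|\<close>; moreover \<open>|N\<^sub>k| \<rho>\<^sub>k\<close> is at most twice the cost of the original tree. Only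
  \<open>O(log n + log 1/\<epsilon>)\<close> scales matter, which accounts for the \<open>log log n\<close> term.
\<close>

section \<open>Spanning trees and pseudometrics\<close>

text \<open>The tree of GX depends on the projection, so tail bounds cannot be applied to its edges
  directly, and a union bound over all pairs of points would put log n into the dimension.
  Contracted edges are therefore injected into families of net pairs that are fixed before the
  projection is drawn. A single net is not enough: a projected edge may be so short that rounding at
  scale \<delta> r swamps it, and a point may be thrown far from its net point. Deeper levels have
  larger families, but a failure that is first visible there is correspondingly more extreme. The
  ratio 3/4 is chosen between 1/2 and 1. Steps of original length about \<delta> r / 2^l are allowed
  projected length about \<delta> r (3/4)^l: these allowances still sum geometrically, while
  exceeding one means an expansion by a multiple of (3/2)^l, whose probability decays exponentially
  in d l. Family sizes are multiples of M / r, so each dyadic scale adds to the expected cost the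
  same small fraction of M, and the number of scales enters d only through its logarithm.\<close>

definition edge_cost :: "('a \<Rightarrow> 'a \<Rightarrow> real) \<Rightarrow> ('a \<times> 'a) set \<Rightarrow> real" where
  "edge_cost w T = (\<Sum>(x, y)\<in>T. w x y)"

text \<open>Weights between points replace point maps, so that original and projected distances
  become two pseudometrics on one set and each tree can be measured under both.\<close>

definition min_tree :: "'a set \<Rightarrow> ('a \<Rightarrow> 'a \<Rightarrow> real) \<Rightarrow> ('a \<times> 'a) set \<Rightarrow> bool" where
  "min_tree V w T \<longleftrightarrow> is_spanning_tree V T \<and>
     (\<forall>T'. is_spanning_tree V T' \<longrightarrow> edge_cost w T \<le> edge_cost w T')"

abbreviation reach :: "('a \<times> 'a) set \<Rightarrow> ('a \<times> 'a) set" where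
  "reach E \<equiv> (E \<union> E\<inverse>)\<^sup>*"

section \<open>Undirected reachability and spanning subtrees\<close>

lemma reach_sym: "(a, b) \<in> reach E \<longleftrightarrow> (b, a) \<in> reach E"
proof -
  have "sym (reach E)"
    by (rule sym_rtrancl) (auto simp: sym_def)
  then show ?thesis by (auto simp: sym_def)
qed

lemma reach_mono: "E \<subseteq> E' \<Longrightarrow> (a, b) \<in> reach E \<Longrightarrow> (a, b) \<in> reach E'"
  by (meson Un_mono converse_mono rtrancl_mono subsetD)

lemma reach_insertI: "(a, b) \<in> reach E \<Longrightarrow> (a, b) \<in> reach (insert e E)"
  by (rule reach_mono[OF subset_insertI])

lemma reach_trans: "(a, b) \<in> reach E \<Longrightarrow> (b, c) \<in> reach E \<Longrightarrow> (a, c) \<in> reach E"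
  by (rule rtrancl_trans)

text \<open>Follow the walk from \<open>z\<close> until it first meets \<open>x\<close> or
  \<open>y\<close>: up to that moment the edge has not been used.\<close>

lemma reach_remove_edge:
  assumes "(z, c) \<in> reach E" "c = x \<or> c = y"
  shows "(z, x) \<in> reach (E - {(x, y)}) \<or> (z, y) \<in> reach (E - {(x, y)})"
  using assms(1)
proof (induction rule: converse_rtrancl_induct)
  case base
  then show ?case using assms(2) by auto
next
  case (step z z')
  show ?case
  proof (cases "z = x \<or> z = y")
    case True
    then show ?thesis by auto
  next
    case False
    then have "(z, z') \<in> (E - {(x, y)}) \<union> (E - {(x, y)})\<inverse>"
      using step by auto
    then show ?thesis using step.IH
      by (meson converse_rtrancl_into_rtrancl)
  qed
qed

text \<open>A walk may repeat edges, so telescoping along it would overcount. Induction on the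
  number of edges avoids this: after the first edge between \<open>a\<close> and \<open>c\<close> is
  deleted, \<open>b\<close> is still connected to \<open>a\<close> or to \<open>c\<close>, and the
  deleted edge pays for the difference between these two.\<close>

lemma reach_potential:
  fixes \<phi> :: "'a \<Rightarrow> real"
  assumes "finite E" "(a, b) \<in> reach E"
  shows "\<bar>\<phi> a - \<phi> b\<bar> \<le> (\<Sum>(x, y)\<in>E. \<bar>\<phi> x - \<phi> y\<bar>)"
  using assms
proof (induction "card E" arbitrary: E a b rule: less_induct)
  case less
  show ?case
  proof (cases "a = b")
    case True
    then show ?thesis by (auto intro!: sum_nonneg)
  next
    case False
    then obtain c where c: "(a, c) \<in> E \<union> E\<inverse>" "(c, b) \<in> reach E"
      using less.prems(2) by (metis converse_rtranclE)
    obtain x y where g: "(x, y) \<in> E" "{x, y} = {a, c}" using c(1) by auto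
    let ?E = "E - {(x, y)}"
    have lt: "card ?E < card E" using g(1) less.prems(1) by (meson card_Diff1_less)
    have fin: "finite ?E" using less.prems by auto
    have split: "(\<Sum>(x, y)\<in>E. \<bar>\<phi> x - \<phi> y\<bar>) = \<bar>\<phi> x - \<phi> y\<bar> + (\<Sum>(x, y)\<in>?E. \<bar>\<phi> x - \<phi> y\<bar>)"
      using sum.remove[OF less.prems(1) g(1), of "\<lambda>(x,y). \<bar>\<phi> x - \<phi> y\<bar>"] by simp
    have e: "\<bar>\<phi> x - \<phi> y\<bar> = \<bar>\<phi> a - \<phi> c\<bar>" using g(2)
      by (auto simp: doubleton_eq_iff)
    have "(b, c) \<in> reach E" using c(2) reach_sym by metis
    moreover have "c = x \<or> c = y" using g(2) by auto
    ultimately have "(b, x) \<in> reach ?E \<or> (b, y) \<in> reach ?E"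
      by (rule reach_remove_edge)
    then have "(a, b) \<in> reach ?E \<or> (c, b) \<in> reach ?E"
      using g(2) reach_sym by (metis doubleton_eq_iff)
    then show ?thesis
    proof
      assume "(a, b) \<in> reach ?E"
      from less.hyps[OF lt fin this] show ?thesis unfolding split by linarith
    next
      assume "(c, b) \<in> reach ?E"
      from less.hyps[OF lt fin this] show ?thesis unfolding split e by linarith
    qed
  qed
qed

lemma cycle_edge_redundant:
  assumes "undirected_cycle E p"
  obtains e where "e \<in> E" "reach (E - {e}) = reach E"
proof -
  let ?n = "length p"
  from assms have n: "3 \<le> ?n" and d: "distinct p"
    and ed: "\<And>i. i < ?n \<Longrightarrow> (p ! i, p ! (Suc i mod ?n)) \<in> E \<union> E\<inverse>"
    by (auto simp: undirected_cycle_def)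
  have "0 < ?n" "Suc 0 mod ?n = 1" using n by auto
  then have "(p ! 0, p ! 1) \<in> E \<union> E\<inverse>" using ed[of 0] by metis
  then obtain x y where xy: "(x, y) \<in> E" "{x, y} = {p ! 0, p ! 1}"
    by (metis UnE converseD insert_commute)
  let ?E = "E - {(x, y)}"
  have stp: "(p ! i, p ! (Suc i mod ?n)) \<in> ?E \<union> ?E\<inverse>" if "1 \<le> i" "i < ?n" for i
  proof -
    define j where "j = Suc i mod ?n"
    \<comment> \<open>The excluded case would traverse the deleted edge backwards; it is impossible
      because a cycle has at least three vertices.\<close>
    have j: "j < ?n" "\<not> (i = 1 \<and> j = 0)"
      using n by (auto simp: j_def intro!: mod_less_divisor)
    have "{p ! i, p ! j} \<noteq> {p ! 0, p ! 1}"
    proof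
      assume "{p ! i, p ! j} = {p ! 0, p ! 1}"
      then consider "p ! i = p ! 0" | "p ! i = p ! 1" "p ! j = p ! 0"
        by (auto simp: doubleton_eq_iff)
      moreover have "0 < ?n" "1 < ?n" using n by auto
      ultimately show False
        using j that nth_eq_iff_index_eq[OF d] by cases auto
    qed
    then have "{p ! i, p ! j} \<noteq> {x, y}" using xy(2) by simp
    moreover have "(p ! i, p ! j) \<in> E \<union> E\<inverse>" using ed[OF that(2)] by (simp add: j_def)
    ultimately show ?thesis unfolding j_def[symmetric] by auto
  qed
  have path: "i < ?n \<Longrightarrow> 1 \<le> i \<Longrightarrow> (p ! 1, p ! i) \<in> reach ?E" for i
  proof (induction i)
    case (Suc i)
    show ?case
    proof (cases "i = 0")
      case False
      then have "(p ! 1, p ! i) \<in> reach ?E" using Suc by auto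
      moreover have "(p ! i, p ! Suc i) \<in> ?E \<union> ?E\<inverse>"
        using stp[of i] False Suc.prems by auto
      ultimately show ?thesis by (rule rtrancl_into_rtrancl)
    qed auto
  qed auto
  have "?n - 1 < ?n" "1 \<le> ?n - 1" "Suc (?n - 1) = ?n" using n by auto
  then have "(p ! 1, p ! (?n - 1)) \<in> reach ?E" "(p ! (?n - 1), p ! 0) \<in> ?E \<union> ?E\<inverse>"
    using path[of "?n - 1"] stp[of "?n - 1"] by simp_all
  then have "(p ! 1, p ! 0) \<in> reach ?E"
    by (rule rtrancl_into_rtrancl)
  then have xyr: "(x, y) \<in> reach ?E" using xy(2) reach_sym by (metis doubleton_eq_iff)
  have "E \<union> E\<inverse> \<subseteq> reach ?E"
    using xyr reach_sym[of x y ?E] by auto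
  then have "reach E \<subseteq> reach ?E" by (metis rtrancl_idemp rtrancl_mono)
  moreover have "reach ?E \<subseteq> reach E" by (intro rtrancl_mono) auto
  ultimately show ?thesis using that xy(1) by blast
qed

text \<open>A connecting subset of least cardinality has no redundant edge. A loop, a pair present
  in both orientations and a cycle would each supply one.\<close>

lemma spanning_subtree:
  assumes "finite E" "E \<subseteq> V \<times> V" and conn: "\<And>x y. x \<in> V \<Longrightarrow> y \<in> V \<Longrightarrow> (x, y) \<in> reach E"
  obtains T where "T \<subseteq> E" "is_spanning_tree V T"
proof -
  let ?P = "\<lambda>T. T \<subseteq> E \<and> V \<times> V \<subseteq> reach T"
  have PE: "?P E" using conn by auto
  obtain T where T: "?P T" and min: "\<And>T'. ?P T' \<Longrightarrow> card T \<le> card T'"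
    using ex_has_least_nat[of ?P E card, OF PE] by blast
  have red: False if e: "e \<in> T" and r: "reach (T - {e}) = reach T" for e
  proof -
    have "?P (T - {e})" using T r by auto
    with min have "card T \<le> card (T - {e})" by blast
    moreover have "finite T" using T assms(1) finite_subset by blast
    ultimately show False using e by (meson card_Diff1_less leD)
  qed
  have "T \<inter> T\<inverse> = {}"
  proof (rule ccontr)
    assume "T \<inter> T\<inverse> \<noteq> {}"
    then obtain x y where xy: "(x, y) \<in> T" "(y, x) \<in> T" by auto
    have "reach (T - {(x, y)}) = reach T"
    proof (cases "x = y")
      case True
      have "(T \<union> T\<inverse>) \<subseteq> (T - {(x, y)} \<union> (T - {(x, y)})\<inverse>) \<union> Id" using True by auto
      then show ?thesis by (intro rtrancl_subset[symmetric]) (use True in auto)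
    next
      case False
      then have "T - {(x, y)} \<union> (T - {(x, y)})\<inverse> = T \<union> T\<inverse>" using xy by auto
      then show ?thesis by simp
    qed
    with red xy show False by blast
  qed
  moreover have "\<not> undirected_cycle T p" for p
    using red cycle_edge_redundant by metis
  ultimately have "is_spanning_tree V T"
    using T assms(2) by (auto simp: is_spanning_tree_def)
  with T that show ?thesis by blast
qed

text \<open>With arbitrary connected edge sets as competitors, an exchange argument has to check
  connectivity only, never acyclicity.\<close>

lemma min_tree_le_connected:
  assumes T: "min_tree V w T" and "finite V" and w: "\<And>x y. x \<in> V \<Longrightarrow> y \<in> V \<Longrightarrow> 0 \<le> w x y"
    and E: "E \<subseteq> V \<times> V" "\<And>x y. x \<in> V \<Longrightarrow> y \<in> V \<Longrightarrow> (x, y) \<in> reach E"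
  shows "edge_cost w T \<le> edge_cost w E"
proof -
  have fE: "finite E" using E(1) assms(2) by (meson finite_SigmaI finite_subset)
  obtain T' where T': "T' \<subseteq> E" "is_spanning_tree V T'"
    using spanning_subtree[OF fE E] by blast
  have "edge_cost w T \<le> edge_cost w T'" using T T'(2) by (auto simp: min_tree_def)
  also have "\<dots> \<le> edge_cost w E"
    unfolding edge_cost_def using fE T' E(1) w by (intro sum_mono2) auto
  finally show ?thesis .
qed

text \<open>Distance zero between distinct points is allowed, since a projection may identify
  them.\<close>

locale pseudometric_on =
  fixes X :: "'a set" and w :: "'a \<Rightarrow> 'a \<Rightarrow> real"
  assumes nonneg: "x \<in> X \<Longrightarrow> y \<in> X \<Longrightarrow> 0 \<le> w x y"
    and commute: "x \<in> X \<Longrightarrow> y \<in> X \<Longrightarrow> w x y = w y x"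
    and refl: "x \<in> X \<Longrightarrow> w x x = 0"
    and triangle: "x \<in> X \<Longrightarrow> y \<in> X \<Longrightarrow> z \<in> X \<Longrightarrow> w x z \<le> w x y + w y z"

text \<open>The cycle property for the closed walk \<open>x, x', y', y, x\<close>.\<close>
lemma (in pseudometric_on) min_tree_exchange:
  assumes T: "min_tree X w T" and fin: "finite X"
    and e: "(x, y) \<in> T" "(x', y') \<in> T" "(x, y) \<noteq> (x', y')"
  shows "w x y \<le> max (w x x') (w y y')"
proof -
  let ?E = "T - {(x, y)}"
  have st: "is_spanning_tree X T" using T by (auto simp: min_tree_def)
  then have TX: "T \<subseteq> X \<times> X" and conn: "\<And>a b. a \<in> X \<Longrightarrow> b \<in> X \<Longrightarrow> (a, b) \<in> reach T"
    by (auto simp: is_spanning_tree_def)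
  have finT: "finite T" using TX fin by (meson finite_SigmaI finite_subset)
  have X: "x \<in> X" "y \<in> X" "x' \<in> X" "y' \<in> X" using TX e by auto
  have half: "(a, x) \<in> reach ?E \<or> (a, y) \<in> reach ?E" if "a \<in> X" for a
    using reach_remove_edge[OF conn[OF that X(1)]] by blast
  \<comment> \<open>Any pair that reconnects the two sides of the deleted edge is at least as heavy
    as that edge.\<close>
  have swap: "w x y \<le> w a b" if ab: "a \<in> X" "b \<in> X" and "(x, y) \<in> reach (insert (a, b) ?E)" for a b
  proof -
    let ?F = "insert (a, b) ?E"
    have yx: "(y, x) \<in> reach ?F" using that(3) reach_sym by metis
    have toX: "(c, x) \<in> reach ?F" if "c \<in> X" for c
    proof -
      have "(c, x) \<in> reach ?F \<or> (c, y) \<in> reach ?F"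
        by (rule disj_forward[OF half[OF that]]) (rule reach_insertI, assumption)+
      then show ?thesis using reach_trans[OF _ yx] by (elim disjE)
    qed
    have "(c, c') \<in> reach ?F" if "c \<in> X" "c' \<in> X" for c c'
    proof -
      have "(x, c') \<in> reach ?F" using toX[OF that(2)] by (subst reach_sym)
      with toX[OF that(1)] show ?thesis by (rule reach_trans)
    qed
    then have "edge_cost w T \<le> edge_cost w ?F"
      using TX ab by (intro min_tree_le_connected[OF T fin nonneg]) auto
    also have "\<dots> \<le> w a b + edge_cost w ?E"
      using finT nonneg[OF ab] by (cases "(a, b) \<in> ?E") (auto simp: edge_cost_def insert_absorb)
    also have "edge_cost w T = w x y + edge_cost w ?E"
      unfolding edge_cost_def using sum.remove[OF finT e(1), of "\<lambda>(x,y). w x y"] by simp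
    finally show ?thesis by simp
  qed
  have e': "(x', y') \<in> reach ?E" using e by blast
  show ?thesis
  \<comment> \<open>The second edge survives the deletion, so \<open>x'\<close> and
    \<open>y'\<close> lie on the same side. On the side of \<open>x\<close>, the pair
    \<open>(y, y')\<close> reconnects; on the side of \<open>y\<close>, the pair
    \<open>(x, x')\<close> does.\<close>
  proof (cases "(x', x) \<in> reach ?E")
    case True
    let ?F = "insert (y, y') ?E"
    have "(x, x') \<in> reach ?F" using reach_insertI[OF True] by (subst reach_sym)
    moreover have "(x', y') \<in> reach ?F" using e' by (rule reach_insertI)
    moreover have "(y', y) \<in> reach ?F" by blast
    ultimately have "(x, y) \<in> reach ?F" using reach_trans by metis
    from swap[OF X(2,4) this] show ?thesis by simp
  next
    case False
    let ?F = "insert (x, x') ?E"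
    have "(x', y) \<in> reach ?F" using False half[OF X(3)] by (intro reach_insertI) auto
    moreover have "(x, x') \<in> reach ?F" by blast
    ultimately have "(x, y) \<in> reach ?F" by (rule reach_trans[rotated])
    from swap[OF X(1,3) this] show ?thesis by simp
  qed
qed

text \<open>The distance to \<open>y\<close> is a 1-Lipschitz potential. Consequently the cost of a
  spanning tree bounds the diameter and can serve as the largest scale.\<close>

lemma (in pseudometric_on) connected_cost_ge_dist:
  assumes E: "finite E" "E \<subseteq> X \<times> X" "(x, y) \<in> reach E" and X: "x \<in> X" "y \<in> X"
  shows "w x y \<le> edge_cost w E"
proof -
  have "w x y = \<bar>w x y - w y y\<bar>" using nonneg[OF X] refl[OF X(2)] by simp
  also have "\<dots> \<le> (\<Sum>(a, b)\<in>E. \<bar>w a y - w b y\<bar>)" by (rule reach_potential[OF E(1,3)])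
  also have "\<dots> \<le> edge_cost w E"
    unfolding edge_cost_def
  proof (rule sum_mono, clarify)
    fix a b assume "(a, b) \<in> E"
    then have "a \<in> X" "b \<in> X" using E(2) by auto
    then show "\<bar>w a y - w b y\<bar> \<le> w a b"
      using triangle[of a b y] triangle[of b a y] commute[of a b] X by linarith
  qed
  finally show ?thesis .
qed

text \<open>The bumps \<open>max 0 (\<rho>/2 - w c \<cdot>)\<close> around the separated points have disjoint supports, and
  each of them forces variation at least \<open>\<rho>/2\<close> along a connected edge set.\<close>
lemma (in pseudometric_on) connected_cost_ge_separated:
  assumes E: "finite E" "E \<subseteq> X \<times> X" "\<And>x y. x \<in> X \<Longrightarrow> y \<in> X \<Longrightarrow> (x, y) \<in> reach E"
    and N: "finite N" "N \<subseteq> X" "\<And>p q. p \<in> N \<Longrightarrow> q \<in> N \<Longrightarrow> p \<noteq> q \<Longrightarrow> \<rho> < w p q" "2 \<le> card N"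
    and \<rho>: "0 < \<rho>"
  shows "real (card N) * \<rho> \<le> 2 * edge_cost w E"
proof -
  define \<phi> where "\<phi> p x = max 0 (\<rho> / 2 - w p x)" for p x
  have var: "\<rho> / 2 \<le> (\<Sum>(a, b)\<in>E. \<bar>\<phi> p a - \<phi> p b\<bar>)" if p: "p \<in> N" for p
  proof -
    \<comment> \<open>The second point is where the bump around \<open>p\<close> vanishes; without
      one, the bump need not vary at all.\<close>
    obtain q where q: "q \<in> N" "q \<noteq> p"
      using N(4) p by (metis card_le_Suc0_iff_eq N(1) not_less_eq_eq numeral_2_eq_2)
    have "\<rho> / 2 = \<bar>\<phi> p p - \<phi> p q\<bar>"
      using N(3)[OF p q(1)] q(2) refl[of p] p N(2) \<rho> by (auto simp: \<phi>_def)
    also have "\<dots> \<le> (\<Sum>(a, b)\<in>E. \<bar>\<phi> p a - \<phi> p b\<bar>)"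
      using E p q N(2) by (intro reach_potential) auto
    finally show ?thesis .
  qed
  have edge: "(\<Sum>p\<in>N. \<bar>\<phi> p a - \<phi> p b\<bar>) \<le> w a b" if ab: "a \<in> X" "b \<in> X" for a b
  proof -
    \<comment> \<open>Separation makes the supports disjoint, so each endpoint of an edge lies in at
      most one bump.\<close>
    have uniq: "p = q" if "p \<in> N" "q \<in> N" "\<phi> p z \<noteq> 0" "\<phi> q z \<noteq> 0" "z \<in> X" for p q z
    proof (rule ccontr)
      assume "p \<noteq> q"
      then have "\<rho> < w p q" using N(3) that by auto
      moreover have "w p q \<le> w p z + w z q" using triangle that N(2) by blast
      moreover have "w z q = w q z" using commute that N(2) by blast
      ultimately show False using that(3,4) by (auto simp: \<phi>_def max_def split: if_splits)
    qed
    have lip: "\<bar>\<phi> p a - \<phi> p b\<bar> \<le> w a b" if "p \<in> N" for p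
      using triangle[of p a b] triangle[of p b a] commute[OF ab] that N(2) ab
      by (auto simp: \<phi>_def max_def)
    define A where "A = {p \<in> N. \<phi> p a \<noteq> 0}"
    define B where "B = {p \<in> N. \<phi> p b \<noteq> 0}"
    have sub: "(\<Sum>p\<in>N. \<bar>\<phi> p a - \<phi> p b\<bar>) = (\<Sum>p\<in>A \<union> B. \<bar>\<phi> p a - \<phi> p b\<bar>)"
      using N(1) by (intro sum.mono_neutral_right) (auto simp: A_def B_def)
    have A: "A = {} \<or> (\<exists>p. A = {p})" using uniq ab unfolding A_def by blast
    have B: "B = {} \<or> (\<exists>p. B = {p})" using uniq ab unfolding B_def by blast
    show ?thesis
    \<comment> \<open>The only case beyond a single Lipschitz bump: the edge leaves one support and
      enters another. The two heights add up to \<rho> minus the distances to the centres, which the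
      triangle inequality bounds by the edge length.\<close>
    proof (cases "\<exists>p q. A = {p} \<and> B = {q} \<and> p \<noteq> q")
      case True
      then obtain p q where pq: "A = {p}" "B = {q}" "p \<noteq> q" by blast
      then have "p \<in> A" "q \<notin> A" "q \<in> B" "p \<notin> B" by simp_all
      then have m: "p \<in> N" "q \<in> N" "\<phi> p a \<noteq> 0" "\<phi> q b \<noteq> 0" "\<phi> p b = 0" "\<phi> q a = 0"
        by (simp_all add: A_def B_def)
      have "(\<Sum>p\<in>A \<union> B. \<bar>\<phi> p a - \<phi> p b\<bar>) = \<phi> p a + \<phi> q b"
        using pq m(5,6) by (simp add: \<phi>_def)
      also have "\<dots> = \<rho> - w p a - w q b" using m by (auto simp: \<phi>_def max_def split: if_splits)
      also have "\<dots> \<le> w a b"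
        using N(3)[OF m(1,2) pq(3)] triangle[of p a q] triangle[of a b q] commute[of b q] ab
          subsetD[OF N(2) m(1)] subsetD[OF N(2) m(2)]
        by linarith
      finally show ?thesis using sub by simp
    next
      case False
      then have "A \<union> B = {} \<or> (\<exists>p. A \<union> B = {p})" using A B by auto
      moreover have "A \<union> B \<subseteq> N" by (auto simp: A_def B_def)
      ultimately consider "A \<union> B = {}" | p where "A \<union> B = {p}" "p \<in> N" by auto
      then show ?thesis using lip nonneg[OF ab] sub by cases simp_all
    qed
  qed
  have "real (card N) * (\<rho> / 2) \<le> (\<Sum>p\<in>N. \<Sum>(a, b)\<in>E. \<bar>\<phi> p a - \<phi> p b\<bar>)"
    using sum_mono[of N "\<lambda>_. \<rho> / 2", OF var] by simp
  also have "\<dots> = (\<Sum>(a, b)\<in>E. \<Sum>p\<in>N. \<bar>\<phi> p a - \<phi> p b\<bar>)"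
    by (subst sum.swap) (simp add: case_prod_unfold)
  also have "\<dots> \<le> edge_cost w E"
    unfolding edge_cost_def using E(2) edge by (intro sum_mono) auto
  finally show ?thesis by simp
qed

section \<open>Doubling and nets\<close>

text \<open>The property whose least witness is \<open>doubling_constant\<close>, stated for a
  general distance. The argument order of \<open>w\<close> agrees with
  \<open>ball_in\<close>.\<close>

definition doubling_bound :: "'a set \<Rightarrow> ('a \<Rightarrow> 'a \<Rightarrow> real) \<Rightarrow> nat \<Rightarrow> bool" where
  "doubling_bound X w l \<longleftrightarrow> (\<forall>x\<in>X. \<forall>r>0. \<exists>S\<subseteq>X. finite S \<and> card S \<le> l \<and>
     {y \<in> X. w y x \<le> r} \<subseteq> (\<Union>s\<in>S. {y \<in> X. w y s \<le> r / 2}))"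

text \<open>The inequality is strict so that a largest separated set covers within distance at most
  \<rho>.\<close>

definition separated :: "('a \<Rightarrow> 'a \<Rightarrow> real) \<Rightarrow> real \<Rightarrow> 'a set \<Rightarrow> bool" where
  "separated w \<rho> N \<longleftrightarrow> (\<forall>p\<in>N. \<forall>q\<in>N. p \<noteq> q \<longrightarrow> \<rho> < w p q)"

lemma doubling_bound_iterate:
  assumes db: "doubling_bound X w l" and x: "x \<in> X" and R: "0 < R"
  shows "\<exists>S\<subseteq>X. finite S \<and> card S \<le> l ^ i \<and> {y \<in> X. w y x \<le> R} \<subseteq> (\<Union>s\<in>S. {y \<in> X. w y s \<le> R / 2 ^ i})"
proof (induction i)
  case 0
  show ?case using x by (intro exI[of _ "{x}"]) auto
next
  case (Suc i)
  then obtain S where S: "S \<subseteq> X" "finite S" "card S \<le> l ^ i"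
    "{y \<in> X. w y x \<le> R} \<subseteq> (\<Union>s\<in>S. {y \<in> X. w y s \<le> R / 2 ^ i})" by (elim exE conjE) (rule that)
  have "\<forall>s\<in>S. \<exists>U\<subseteq>X. finite U \<and> card U \<le> l \<and>
     {y \<in> X. w y s \<le> R / 2 ^ i} \<subseteq> (\<Union>u\<in>U. {y \<in> X. w y u \<le> R / 2 ^ i / 2})"
  proof
    fix s assume "s \<in> S"
    then have "s \<in> X" "0 < R / 2 ^ i" using S(1) R by auto
    with db show "\<exists>U\<subseteq>X. finite U \<and> card U \<le> l \<and>
     {y \<in> X. w y s \<le> R / 2 ^ i} \<subseteq> (\<Union>u\<in>U. {y \<in> X. w y u \<le> R / 2 ^ i / 2})"
      unfolding doubling_bound_def by (elim ballE[of _ _ s] allE[of _ "R / 2 ^ i"]) simp_all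
  qed
  from bchoice[OF this] obtain U where U: "\<forall>s\<in>S. U s \<subseteq> X \<and> finite (U s) \<and> card (U s) \<le> l \<and>
     {y \<in> X. w y s \<le> R / 2 ^ i} \<subseteq> (\<Union>u\<in>U s. {y \<in> X. w y u \<le> R / 2 ^ i / 2})" ..
  let ?S = "\<Union>s\<in>S. U s"
  have "card ?S \<le> (\<Sum>s\<in>S. card (U s))" by (rule card_UN_le[OF S(2)])
  also have "\<dots> \<le> (\<Sum>s\<in>S. l)" using U by (intro sum_mono) auto
  also have "\<dots> \<le> l ^ Suc i" using S(3) by simp
  finally have "card ?S \<le> l ^ Suc i" .
  moreover have "{y \<in> X. w y x \<le> R} \<subseteq> (\<Union>s\<in>?S. {y \<in> X. w y s \<le> R / 2 ^ Suc i})"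
  proof
    fix y assume "y \<in> {y \<in> X. w y x \<le> R}"
    then obtain s where s: "s \<in> S" "y \<in> {y \<in> X. w y s \<le> R / 2 ^ i}" using S(4) by blast
    moreover have "{y \<in> X. w y s \<le> R / 2 ^ i} \<subseteq> (\<Union>u\<in>U s. {y \<in> X. w y u \<le> R / 2 ^ i / 2})"
      using U s(1) by simp
    ultimately obtain u where "u \<in> U s" "y \<in> {y \<in> X. w y u \<le> R / 2 ^ i / 2}" by blast
    then show "y \<in> (\<Union>s\<in>?S. {y \<in> X. w y s \<le> R / 2 ^ Suc i})"
      using s(1) by (auto simp: mult.commute)
  qed
  moreover have "?S \<subseteq> X" "finite ?S" using U S(2) by auto
  ultimately show ?case by (intro exI[of _ ?S] conjI)
qed

context pseudometric_on
begin

text \<open>After \<open>i\<close> halvings each covering ball has radius at most \<rho> / 2 and so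
  contains at most one separated point; sending a point to the centre of a ball around it is
  injective.\<close>

lemma packing:
  assumes db: "doubling_bound X w l" and x: "x \<in> X" and fin: "finite X"
    and N: "N \<subseteq> X" "separated w \<rho> N" and R: "0 < R" "R / 2 ^ i \<le> \<rho> / 2"
  shows "card {p \<in> N. w p x \<le> R} \<le> l ^ i"
proof -
  obtain S where S: "S \<subseteq> X" "finite S" "card S \<le> l ^ i"
    "{y \<in> X. w y x \<le> R} \<subseteq> (\<Union>s\<in>S. {y \<in> X. w y s \<le> R / 2 ^ i})"
    using doubling_bound_iterate[OF db x R(1), of i] by (elim exE conjE) (rule that)
  have "\<forall>p\<in>{p \<in> N. w p x \<le> R}. \<exists>s\<in>S. w p s \<le> R / 2 ^ i"
    using S(4) N(1) by blast
  then obtain g where g: "\<And>p. p \<in> N \<Longrightarrow> w p x \<le> R \<Longrightarrow> g p \<in> S \<and> w p (g p) \<le> R / 2 ^ i"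
    by (metis (mono_tags, lifting) mem_Collect_eq)
  have "inj_on g {p \<in> N. w p x \<le> R}"
  proof (rule inj_onI, rule ccontr)
    fix p q assume p: "p \<in> {p \<in> N. w p x \<le> R}" and q: "q \<in> {p \<in> N. w p x \<le> R}"
      and "g p = g q" "p \<noteq> q"
    have "w p q \<le> w p (g p) + w q (g p)"
      using triangle[of p "g p" q] commute[of "g p" q] p q g S(1) N(1) by fastforce
    also have "\<dots> \<le> R / 2 ^ i + R / 2 ^ i"
      using g[of p] g[of q] p q \<open>g p = g q\<close> by (intro add_mono) auto
    also have "\<dots> \<le> \<rho>" using R(2) by linarith
    finally have "w p q \<le> \<rho>" .
    moreover have "\<rho> < w p q" using N(2) p q \<open>p \<noteq> q\<close> by (auto simp: separated_def)
    ultimately show False by simp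
  qed
  then have "card {p \<in> N. w p x \<le> R} \<le> card S"
    using g S(2) by (intro card_inj_on_le[of g]) auto
  with S(3) show ?thesis by linarith
qed

text \<open>In a separated set of greatest cardinality every point is covered, as an uncovered point
  could be added.\<close>

lemma net_exists:
  assumes "finite X" "0 < \<rho>"
  shows "\<exists>N \<pi>. N \<subseteq> X \<and> separated w \<rho> N \<and> (\<forall>x\<in>X. \<pi> x \<in> N \<and> w x (\<pi> x) \<le> \<rho>)"
proof -
  let ?P = "\<lambda>N. N \<subseteq> X \<and> separated w \<rho> N"
  have 1: "?P {}" by (auto simp: separated_def)
  have 2: "\<forall>N. ?P N \<longrightarrow> card N < Suc (card X)"
    using assms(1) by (simp add: card_mono less_Suc_eq_le)
  from ex_has_greatest_nat[of ?P, OF 1 2] obtain N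
    where N: "?P N" and max: "\<forall>N'. ?P N' \<longrightarrow> card N' \<le> card N" by (elim exE conjE) (rule that, rule conjI)
  have "\<exists>p\<in>N. w x p \<le> \<rho>" if x: "x \<in> X" for x
  proof (rule ccontr)
    assume no: "\<not> ?thesis"
    have "x \<notin> N" using no refl[OF x] assms(2) by force
    have "w p x = w x p" if "p \<in> N" for p using commute N x that by blast
    then have "?P (insert x N)"
      using N no x unfolding separated_def by (auto simp: not_le)
    with max have "card (insert x N) \<le> card N" by blast
    then show False using \<open>x \<notin> N\<close> finite_subset[of N X] N assms(1) by simp
  qed
  from bchoice[OF ballI, OF this[unfolded Bex_def]] obtain \<pi>
    where "\<forall>x\<in>X. \<pi> x \<in> N \<and> w x (\<pi> x) \<le> \<rho>" ..
  then show ?thesis using N by (intro exI[of _ N] exI[of _ \<pi>]) simp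
qed

text \<open>Two points are separated at half their distance, and two halvings of their common ball
  isolate them, so \<open>2 \<le> l ^ 2\<close>. This makes the doubling dimension at least 1 and
  lets powers of 2 be absorbed into powers of \<open>l\<close>.\<close>

lemma doubling_bound_ge_2:
  assumes db: "doubling_bound X w l" and fin: "finite X"
    and xy: "x \<in> X" "y \<in> X" "0 < w x y"
  shows "2 \<le> l"
proof -
  have "x \<noteq> y" using xy refl by force
  have "card {p \<in> {x, y}. w p x \<le> w x y} \<le> l ^ 2"
    using xy commute
    by (intro packing[OF db xy(1) fin, of _ "w x y / 2"]) (auto simp: separated_def)
  moreover have "{p \<in> {x, y}. w p x \<le> w x y} = {x, y}"
    using xy refl commute by auto
  ultimately have "2 \<le> l ^ 2" using \<open>x \<noteq> y\<close> by simp
  then show ?thesis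
    using power_mono[of l 1 2] by (cases "l \<le> 1") auto
qed

end

section \<open>Contracted edges at one scale\<close>

lemma sum_three_quarters_le: "(\<Sum>l\<in>{m..<K}. (3 / 4 :: real) ^ l) \<le> 4 * (3 / 4) ^ m"
proof (cases "m \<le> K")
  case True
  then have "(\<Sum>l\<in>{m..<K}. (3 / 4 :: real) ^ l) = 4 * (3 / 4) ^ m - 4 * (3 / 4) ^ K"
    by (induction K rule: dec_induct) simp_all
  then show ?thesis by simp
qed simp

text \<open>The deterministic part, for one outcome of the projection: \<open>w\<close> is the
  original and \<open>v\<close> the projected distance. At level \<open>K\<close> rounding is the
  identity, which ends the chain of roundings of each point.\<close>

locale net_hierarchy =
  orig: pseudometric_on X w + img: pseudometric_on X v
  for X :: "'a set" and w v :: "'a \<Rightarrow> 'a \<Rightarrow> real" +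
  fixes N :: "nat \<Rightarrow> 'a set" and \<pi> :: "nat \<Rightarrow> 'a \<Rightarrow> 'a" and K :: nat and r \<delta> \<epsilon> :: real
  assumes fin: "finite X"
    and NX: "N k \<subseteq> X"
    and \<pi>N: "x \<in> X \<Longrightarrow> \<pi> k x \<in> N k"
    and \<pi>_close: "x \<in> X \<Longrightarrow> w x (\<pi> k x) \<le> \<delta> * r / 2 ^ k"
    and \<pi>_last: "x \<in> X \<Longrightarrow> \<pi> K x = x"
    and r: "0 < r" and \<epsilon>: "0 < \<epsilon>" "\<epsilon> \<le> 1" and \<delta>: "0 < \<delta>" "\<delta> \<le> \<epsilon> / 8192"
begin

abbreviation \<pi>_step :: "nat \<Rightarrow> 'a \<Rightarrow> real" where
  "\<pi>_step l x \<equiv> v (\<pi> l x) (\<pi> (Suc l) x)"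

text \<open>A chaining bound for the projected distance of both endpoints to their roundings at
  level \<open>m\<close>. Unlike that distance itself, the sum decreases as \<open>m\<close> grows,
  so a detour that is short at one level stays short at all deeper ones.\<close>

definition detour :: "nat \<Rightarrow> 'a \<times> 'a \<Rightarrow> real" where
  "detour m = (\<lambda>(x, y). \<Sum>l\<in>{m..<K}. \<pi>_step l x + \<pi>_step l y)"

definition bad :: "('a \<times> 'a) set \<Rightarrow> ('a \<times> 'a) set" where
  "bad T = {(x, y) \<in> T. r < w x y \<and> w x y \<le> 2 * r \<and> v x y < (1 - \<epsilon>) * w x y}"

text \<open>Such pairs have probability zero, but must be split off because the comparison with the
  cycle property needs positive projected lengths.\<close>

definition collapsed_pairs :: "('a \<times> 'a) set" where
  "collapsed_pairs = {(x, y) \<in> X \<times> X. 0 < w x y \<and> v x y \<le> 0}"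

definition contracted_pairs :: "nat \<Rightarrow> real \<Rightarrow> ('a \<times> 'a) set" where
  "contracted_pairs k \<tau> = {(p, q) \<in> N k \<times> N k. 0 < w p q \<and> w p q \<le> 3 * r \<and> v p q \<le> \<tau> * w p q}"

text \<open>The expansion concerns \<open>u\<close> and \<open>p\<close> only. The rounding
  \<open>q\<close> of the other endpoint is carried along because a tree edge is determined by the
  pair \<open>(p, q)\<close>, not by \<open>p\<close> alone.\<close>

definition expanded_triples :: "nat \<Rightarrow> ('a \<times> 'a \<times> 'a) set" where
  "expanded_triples l = {(u, p, q) \<in> N l \<times> N (Suc l) \<times> N (Suc l).
     w u p \<le> 2 * (\<delta> * r / 2 ^ l) \<and> w p q \<le> 3 * r \<and> 4 * \<delta> * r * (3 / 4) ^ l \<le> v u p}"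

lemma \<pi>X: "x \<in> X \<Longrightarrow> \<pi> k x \<in> X"
  using \<pi>N NX by blast

lemma finN: "finite (N k)"
  using NX fin finite_subset by blast

lemma \<rho>_le: "\<delta> * r / 2 ^ k \<le> r / 8192"
proof -
  have "\<delta> * r / 2 ^ k \<le> \<delta> * r" using r \<delta> by (simp add: field_simps)
  also have "\<dots> \<le> 1 / 8192 * r" using r \<delta> \<epsilon> by (intro mult_right_mono) auto
  finally show ?thesis by simp
qed

lemma chain:
  assumes "m \<le> K" "x \<in> X"
  shows "v x (\<pi> m x) \<le> (\<Sum>l\<in>{m..<K}. \<pi>_step l x)"
  using assms(1)
proof (induction m rule: inc_induct)
  case base
  then show ?case using \<pi>_last assms(2) img.refl by simp
next
  case (step n)
  have "v x (\<pi> n x) \<le> v x (\<pi> (Suc n) x) + v (\<pi> (Suc n) x) (\<pi> n x)"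
    using assms(2) \<pi>X by (intro img.triangle)
  also have "v (\<pi> (Suc n) x) (\<pi> n x) = \<pi>_step n x"
    using assms(2) \<pi>X by (intro img.commute)
  finally show ?case using step by (simp add: sum.atLeast_Suc_lessThan)
qed

lemma detour_bound:
  assumes "m \<le> K" "x \<in> X" "y \<in> X"
  shows "v x (\<pi> m x) + v y (\<pi> m y) \<le> detour m (x, y)"
  using chain[OF assms(1,2)] chain[OF assms(1,3)] by (simp add: detour_def sum.distrib)

lemma \<pi>_step_nonneg: "x \<in> X \<Longrightarrow> 0 \<le> \<pi>_step l x"
  using img.nonneg \<pi>X by blast

lemma detour_antimono:
  assumes "m \<le> m'" "x \<in> X" "y \<in> X"
  shows "detour m' (x, y) \<le> detour m (x, y)"
  unfolding detour_def prod.case using assms \<pi>_step_nonneg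
  by (intro sum_mono2) auto

text \<open>The detour is measured against the projected length, since the cycle property in the
  projection compares projected lengths.\<close>

definition short_detour :: "('a \<times> 'a) set \<Rightarrow> nat \<Rightarrow> ('a \<times> 'a) set" where
  "short_detour T m = {e \<in> bad T. 0 < v (fst e) (snd e) \<and> detour m e \<le> \<epsilon> / 8 * v (fst e) (snd e)}"

context
  fixes T assumes T: "min_tree X v T"
begin

lemma TX: "T \<subseteq> X \<times> X"
  using T by (auto simp: min_tree_def is_spanning_tree_def)

lemma finT: "finite T"
  using TX fin by (meson finite_SigmaI finite_subset)

lemma bad_finite: "finite (bad T)"
  by (rule finite_subset[OF _ finT]) (auto simp: bad_def)

lemma short_detour_edge:
  assumes "e \<in> short_detour T m"
  obtains x y where "e = (x, y)" "(x, y) \<in> T" "x \<in> X" "y \<in> X" "r < w x y" "w x y \<le> 2 * r"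
    "v x y < (1 - \<epsilon>) * w x y" "0 < v x y" "detour m (x, y) \<le> \<epsilon> / 8 * v x y"
  using assms TX by (cases e) (auto simp: short_detour_def bad_def)

text \<open>Two edges of the tree with the same rounded endpoints would contradict the cycle property.\<close>
lemma short_detour_inj:
  assumes m: "m \<le> K"
  shows "inj_on (\<lambda>(x, y). (\<pi> m x, \<pi> m y)) (short_detour T m)"
proof (rule inj_onI, rule ccontr)
  fix e e' assume e: "e \<in> short_detour T m" and e': "e' \<in> short_detour T m"
    and eq: "(case e of (x, y) \<Rightarrow> (\<pi> m x, \<pi> m y)) = (case e' of (x, y) \<Rightarrow> (\<pi> m x, \<pi> m y))"
    and ne: "e \<noteq> e'"
  obtain x y where xy: "e = (x, y)" "(x, y) \<in> T" "x \<in> X" "y \<in> X" "0 < v x y" "detour m (x, y) \<le> \<epsilon> / 8 * v x y"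
    using short_detour_edge[OF e] by metis
  obtain x' y' where xy': "e' = (x', y')" "(x', y') \<in> T" "x' \<in> X" "y' \<in> X" "0 < v x' y'"
     "detour m (x', y') \<le> \<epsilon> / 8 * v x' y'"
    using short_detour_edge[OF e'] by metis
  have p: "\<pi> m x = \<pi> m x'" "\<pi> m y = \<pi> m y'" using eq xy(1) xy'(1) by auto
  \<comment> \<open>Each edge is bounded by the connecting pairs, which cost at most both detours,
    that is an eighth of the two projected lengths together. Adding the two exchange inequalities
    bounds a positive sum by a quarter of itself.\<close>
  have "v x y \<le> max (v x x') (v y y')"
    using ne xy xy' by (intro img.min_tree_exchange[OF T fin]) auto
  moreover have "v x' y' \<le> max (v x x') (v y y')"
    using img.min_tree_exchange[OF T fin xy'(2) xy(2)] ne xy(1,3,4) xy'(1,3,4) img.commute by auto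
  moreover have "v x x' \<le> v x (\<pi> m x) + v x' (\<pi> m x')"
    using img.triangle[of x "\<pi> m x" x'] img.commute[of x' "\<pi> m x'"] p xy(3) xy'(3) \<pi>X by simp
  moreover have "v y y' \<le> v y (\<pi> m y) + v y' (\<pi> m y')"
    using img.triangle[of y "\<pi> m y" y'] img.commute[of y' "\<pi> m y'"] p xy(4) xy'(4) \<pi>X by simp
  moreover note detour_bound[OF m xy(3,4)] detour_bound[OF m xy'(3,4)]
  moreover have "0 \<le> v x (\<pi> m x)" "0 \<le> v x' (\<pi> m x')" "0 \<le> v y (\<pi> m y)" "0 \<le> v y' (\<pi> m y')"
    using img.nonneg xy(3,4) xy'(3,4) \<pi>X by auto
  moreover have "\<epsilon> / 8 * v x y \<le> 1 / 8 * v x y" "\<epsilon> / 8 * v x' y' \<le> 1 / 8 * v x' y'"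
    using \<epsilon> xy(5) xy'(5) by (intro mult_right_mono; simp)+
  moreover have "max (v x x') (v y y') \<le> v x x' + v y y'"
    using img.nonneg xy(3,4) xy'(3,4) by simp
  ultimately show False using xy(5,6) xy'(5,6) by linarith
qed

lemma rounded_pair:
  assumes "x \<in> X" "y \<in> X" "r < w x y" "w x y \<le> 2 * r"
  shows "w (\<pi> m x) (\<pi> m y) \<le> 3 * r" "r / 2 \<le> w (\<pi> m x) (\<pi> m y)"
    "w x y \<le> w (\<pi> m x) (\<pi> m y) + 2 * (\<delta> * r / 2 ^ m)"
proof -
  have a: "w x (\<pi> m x) \<le> \<delta> * r / 2 ^ m" "w y (\<pi> m y) \<le> \<delta> * r / 2 ^ m" using \<pi>_close assms by auto
  have b: "w (\<pi> m x) x = w x (\<pi> m x)" "w (\<pi> m y) y = w y (\<pi> m y)"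
    using orig.commute \<pi>X assms by auto
  have X: "\<pi> m x \<in> X" "\<pi> m y \<in> X" using \<pi>X assms by auto
  note t = orig.triangle[OF X(1) assms(1) X(2)] orig.triangle[OF assms(1,2) X(2)]
    orig.triangle[OF assms(1) X(1) assms(2)] orig.triangle[OF X(1,2) assms(2)]
  note \<rho> = \<rho>_le[of m]
  show "w (\<pi> m x) (\<pi> m y) \<le> 3 * r" using a b t \<rho> assms r by linarith
  show "r / 2 \<le> w (\<pi> m x) (\<pi> m y)" using a b t \<rho> assms r by linarith
  show "w x y \<le> w (\<pi> m x) (\<pi> m y) + 2 * (\<delta> * r / 2 ^ m)" using a b t by linarith
qed

lemma rounded_image:
  assumes "x \<in> X" "y \<in> X" "m \<le> K" "detour m (x, y) \<le> \<epsilon> / 8 * v x y"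
  shows "v (\<pi> m x) (\<pi> m y) \<le> (1 + \<epsilon> / 8) * v x y"
proof -
  have X: "\<pi> m x \<in> X" "\<pi> m y \<in> X" using \<pi>X assms by auto
  have "v (\<pi> m x) (\<pi> m y) \<le> v x (\<pi> m x) + v x y + v y (\<pi> m y)"
    using img.triangle[OF X(1) assms(1) X(2)] img.triangle[OF assms(1,2) X(2)]
      img.commute[OF X(1) assms(1)] by linarith
  also have "\<dots> \<le> v x y + \<epsilon> / 8 * v x y" using detour_bound[OF assms(3,1,2)] assms(4) by linarith
  finally show ?thesis by (simp add: algebra_simps)
qed

text \<open>At level 0 rounding perturbs both lengths by small relative errors of order \<epsilon>,
  and half of the original contraction survives them.\<close>

lemma card_short_detour_0: "card (short_detour T 0) \<le> card (contracted_pairs 0 (1 - \<epsilon> / 2))"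
proof (rule card_inj_on_le[OF short_detour_inj])
  show "finite (contracted_pairs 0 (1 - \<epsilon> / 2))"
    by (rule finite_subset[of _ "N 0 \<times> N 0"]) (use finN in \<open>auto simp: contracted_pairs_def\<close>)
  show "(\<lambda>(x, y). (\<pi> 0 x, \<pi> 0 y)) ` short_detour T 0 \<subseteq> contracted_pairs 0 (1 - \<epsilon> / 2)"
  proof clarify
    fix x y assume "(x, y) \<in> short_detour T 0"
    then have xy: "x \<in> X" "y \<in> X" "r < w x y" "w x y \<le> 2 * r"
      "v x y < (1 - \<epsilon>) * w x y" "0 < v x y" "detour 0 (x, y) \<le> \<epsilon> / 8 * v x y"
      by (auto elim!: short_detour_edge)
    note R = rounded_pair[OF xy(1-4), of 0]
    let ?w = "w (\<pi> 0 x) (\<pi> 0 y)"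
    have wle: "w x y \<le> (1 + \<epsilon> / 2048) * ?w"
    proof -
      have "\<delta> * r \<le> \<epsilon> / 8192 * (2 * ?w)" using R(2) \<delta> \<epsilon> r by (intro mult_mono) auto
      with R(3) show ?thesis by (simp add: algebra_simps)
    qed
    have "v (\<pi> 0 x) (\<pi> 0 y) \<le> (1 + \<epsilon> / 8) * v x y" using rounded_image xy by auto
    also have "\<dots> \<le> (1 + \<epsilon> / 8) * ((1 - \<epsilon>) * w x y)" using xy(5) \<epsilon> by (intro mult_left_mono) auto
    also have "\<dots> \<le> (1 + \<epsilon> / 8) * ((1 - \<epsilon>) * ((1 + \<epsilon> / 2048) * ?w))"
      using wle \<epsilon> by (intro mult_left_mono) auto
    also have "\<dots> = ((1 + \<epsilon> / 8) * (1 - \<epsilon>) * (1 + \<epsilon> / 2048)) * ?w" by simp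
    also have "\<dots> \<le> (1 - \<epsilon> / 2) * ?w"
    proof (rule mult_right_mono)
      have e2: "0 \<le> \<epsilon> * \<epsilon>" by simp
      have e3: "0 \<le> \<epsilon> * (\<epsilon> * \<epsilon>)" using \<epsilon> by simp
      have "(1 + \<epsilon> / 8) * (1 - \<epsilon>) * (1 + \<epsilon> / 2048) =
        1 - 7 * \<epsilon> / 8 + \<epsilon> / 2048 - \<epsilon> * \<epsilon> / 8 - 7 * (\<epsilon> * \<epsilon>) / 16384 - \<epsilon> * (\<epsilon> * \<epsilon>) / 16384"
        by (simp add: field_simps)
      then show "(1 + \<epsilon> / 8) * (1 - \<epsilon>) * (1 + \<epsilon> / 2048) \<le> 1 - \<epsilon> / 2"
        using e2 e3 \<epsilon> by linarith
      show "0 \<le> ?w" using R(2) r by linarith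
    qed
    finally have "v (\<pi> 0 x) (\<pi> 0 y) \<le> (1 - \<epsilon> / 2) * ?w" .
    then show "(\<pi> 0 x, \<pi> 0 y) \<in> contracted_pairs 0 (1 - \<epsilon> / 2)"
      using R r xy \<pi>N by (auto simp: contracted_pairs_def)
  qed
qed simp

text \<open>The smallness condition and \<open>\<delta> \<le> \<epsilon> / 8192\<close> give
  projected length at most \<open>r / 32 * (3 / 4) ^ k\<close>. Rounding at most doubles it, while
  the rounded pair keeps original distance at least \<open>r / 2\<close>; the quotient is the factor
  1/8.\<close>

lemma card_short_detour_contracted:
  assumes m: "Suc k \<le> K"
  shows "card {e \<in> short_detour T (Suc k). \<epsilon> / 8 * v (fst e) (snd e) \<le> 32 * \<delta> * r * (3 / 4) ^ k}
    \<le> card (contracted_pairs (Suc k) (1 / 8 * (3 / 4) ^ k))" (is "card ?A \<le> card ?B")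
proof (rule card_inj_on_le)
  show "inj_on (\<lambda>(x, y). (\<pi> (Suc k) x, \<pi> (Suc k) y)) ?A"
    by (rule inj_on_subset[OF short_detour_inj[OF m]]) auto
  show "finite ?B"
    by (rule finite_subset[of _ "N (Suc k) \<times> N (Suc k)"]) (use finN in \<open>auto simp: contracted_pairs_def\<close>)
  show "(\<lambda>(x, y). (\<pi> (Suc k) x, \<pi> (Suc k) y)) ` ?A \<subseteq> ?B"
  proof clarify
    fix x y assume "(x, y) \<in> short_detour T (Suc k)"
      and small: "\<epsilon> / 8 * v (fst (x, y)) (snd (x, y)) \<le> 32 * \<delta> * r * (3 / 4) ^ k"
    then have xy: "x \<in> X" "y \<in> X" "r < w x y" "w x y \<le> 2 * r"
      "v x y < (1 - \<epsilon>) * w x y" "0 < v x y" "detour (Suc k) (x, y) \<le> \<epsilon> / 8 * v x y"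
      by (auto elim!: short_detour_edge)
    note R = rounded_pair[OF xy(1-4), of "Suc k"]
    have "32 * \<delta> * r * (3 / 4) ^ k \<le> 32 * (\<epsilon> / 8192) * r * (3 / 4) ^ k"
      using \<delta> r by (intro mult_right_mono mult_left_mono) auto
    with small have "\<epsilon> * v x y \<le> \<epsilon> * (1 / 32 * r * (3 / 4) ^ k)" by (simp add: algebra_simps)
    then have small': "v x y \<le> 1 / 32 * r * (3 / 4) ^ k" using \<epsilon>(1) by (rule mult_left_le_imp_le)
    have "v (\<pi> (Suc k) x) (\<pi> (Suc k) y) \<le> (1 + \<epsilon> / 8) * v x y" using rounded_image xy m by blast
    also have "\<dots> \<le> 2 * v x y" using \<epsilon> xy(6) by (intro mult_right_mono) auto
    also have "\<dots> \<le> 1 / 8 * (3 / 4) ^ k * (r / 2)" using small' by (simp add: mult.commute)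
    also have "\<dots> \<le> 1 / 8 * (3 / 4) ^ k * w (\<pi> (Suc k) x) (\<pi> (Suc k) y)"
      using R(2) by (intro mult_left_mono) auto
    finally show "(\<pi> (Suc k) x, \<pi> (Suc k) y) \<in> ?B"
      using R r xy \<pi>N by (auto simp: contracted_pairs_def)
  qed
qed

lemma step_close:
  assumes "x \<in> X"
  shows "w (\<pi> l x) (\<pi> (Suc l) x) \<le> 2 * (\<delta> * r / 2 ^ l)"
proof -
  have "w (\<pi> l x) (\<pi> (Suc l) x) \<le> w x (\<pi> l x) + w x (\<pi> (Suc l) x)"
    using orig.triangle[of "\<pi> l x" x "\<pi> (Suc l) x"] orig.commute[of "\<pi> l x" x] assms \<pi>X by simp
  also have "\<dots> \<le> \<delta> * r / 2 ^ l + \<delta> * r / 2 ^ Suc l" using \<pi>_close assms by (intro add_mono)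
  also have "\<dots> \<le> 2 * (\<delta> * r / 2 ^ l)" using \<delta> r by (simp add: field_simps)
  finally show ?thesis .
qed

lemma finite_expanded: "finite (expanded_triples l)"
  by (rule finite_subset[of _ "N l \<times> N (Suc l) \<times> N (Suc l)"]) (use finN in \<open>auto simp: expanded_triples_def\<close>)

lemma card_short_detour_expanded:
  assumes l: "Suc l \<le> K"
  shows "card {e \<in> short_detour T (Suc l). 4 * \<delta> * r * (3 / 4) ^ l \<le> \<pi>_step l (fst e)} \<le> card (expanded_triples l)"
    (is "card ?A \<le> _")
    and "card {e \<in> short_detour T (Suc l). 4 * \<delta> * r * (3 / 4) ^ l \<le> \<pi>_step l (snd e)} \<le> card (expanded_triples l)"
    (is "card ?B \<le> _")
proof -
  note inj = short_detour_inj[OF l, unfolded inj_on_def]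
  have "inj_on (\<lambda>(x, y). (\<pi> l x, \<pi> (Suc l) x, \<pi> (Suc l) y)) ?A"
    unfolding inj_on_def using inj by fastforce
  moreover have "(\<lambda>(x, y). (\<pi> l x, \<pi> (Suc l) x, \<pi> (Suc l) y)) ` ?A \<subseteq> expanded_triples l"
    using step_close rounded_pair(1) \<pi>N by (auto simp: expanded_triples_def elim!: short_detour_edge)
  ultimately show "card ?A \<le> card (expanded_triples l)"
    using card_inj_on_le finite_expanded by blast
  have "inj_on (\<lambda>(x, y). (\<pi> l y, \<pi> (Suc l) y, \<pi> (Suc l) x)) ?B"
    unfolding inj_on_def using inj by fastforce
  moreover have "(\<lambda>(x, y). (\<pi> l y, \<pi> (Suc l) y, \<pi> (Suc l) x)) ` ?B \<subseteq> expanded_triples l"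
  proof clarify
    fix x y assume "(x, y) \<in> short_detour T (Suc l)" and s: "4 * \<delta> * r * (3 / 4) ^ l \<le> \<pi>_step l (snd (x, y))"
    then have xy: "x \<in> X" "y \<in> X" "r < w x y" "w x y \<le> 2 * r"
      by (auto elim!: short_detour_edge)
    then have "w (\<pi> (Suc l) y) (\<pi> (Suc l) x) \<le> 3 * r"
      using rounded_pair(1)[OF xy, of "Suc l"] orig.commute \<pi>X by metis
    then show "(\<pi> l y, \<pi> (Suc l) y, \<pi> (Suc l) x) \<in> expanded_triples l"
      using s xy step_close[OF xy(2)] \<pi>N by (auto simp: expanded_triples_def)
  qed
  ultimately show "card ?B \<le> card (expanded_triples l)"
    using card_inj_on_le finite_expanded by blast
qed

text \<open>Let \<open>j\<close> be the level just before the detour becomes short. A large step at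
  some \<open>l \<ge> j\<close> is charged to level \<open>Suc l\<close>, where the detour is still
  short and the rounded pair still determines the edge. If no step is large, the too long detour at
  \<open>j\<close> is nevertheless geometrically small, and forces the projected edge to be even
  shorter.\<close>

lemma bad_cover:
  "bad T \<subseteq> collapsed_pairs \<union> short_detour T 0 \<union>
    (\<Union>k<K. {e \<in> short_detour T (Suc k). \<epsilon> / 8 * v (fst e) (snd e) \<le> 32 * \<delta> * r * (3 / 4) ^ k}) \<union>
    (\<Union>l<K. {e \<in> short_detour T (Suc l). 4 * \<delta> * r * (3 / 4) ^ l \<le> \<pi>_step l (fst e)}) \<union>
    (\<Union>l<K. {e \<in> short_detour T (Suc l). 4 * \<delta> * r * (3 / 4) ^ l \<le> \<pi>_step l (snd e)})"
    (is "_ \<subseteq> ?Z \<union> ?A \<union> ?B \<union> ?C \<union> ?D")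
proof
  fix e assume e: "e \<in> bad T"
  obtain x y where xy: "e = (x, y)" "(x, y) \<in> T" "r < w x y" using e by (auto simp: bad_def)
  have X: "x \<in> X" "y \<in> X" using xy(2) TX by auto
  show "e \<in> ?Z \<union> ?A \<union> ?B \<union> ?C \<union> ?D"
  proof (cases "0 < v x y")
    case False
    then show ?thesis using xy X r by (auto simp: collapsed_pairs_def)
  next
    case True
    let ?Q = "\<lambda>m. detour m e \<le> \<epsilon> / 8 * v x y"
    \<comment> \<open>At level \<open>K\<close> the detour is an empty sum, so a first level with a
      short detour exists.\<close>
    have QK: "?Q K" using True \<epsilon> xy(1) by (simp add: detour_def)
    define k where "k = (LEAST m. ?Q m)"
    have Qk: "?Q k" and kK: "k \<le> K" unfolding k_def using QK by (rule LeastI, rule Least_le)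
    have sd: "e \<in> short_detour T m" if "k \<le> m" for m
      using e True Qk detour_antimono[OF that X] xy(1) by (auto simp: short_detour_def)
    show ?thesis
    proof (cases k)
      case 0
      then show ?thesis using sd[of 0] by simp
    next
      case (Suc j)
      then have nQ: "\<not> ?Q j" using not_less_Least[of j ?Q] by (simp add: k_def)
      show ?thesis
      proof (cases "\<exists>l\<in>{j..<K}. 4 * \<delta> * r * (3 / 4) ^ l \<le> \<pi>_step l x \<or> 4 * \<delta> * r * (3 / 4) ^ l \<le> \<pi>_step l y")
        case True
        then obtain l where l: "j \<le> l" "l < K"
          "4 * \<delta> * r * (3 / 4) ^ l \<le> \<pi>_step l x \<or> 4 * \<delta> * r * (3 / 4) ^ l \<le> \<pi>_step l y" by auto
        then show ?thesis using sd[of "Suc l"] Suc xy(1) by auto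
      next
        case False
        \<comment> \<open>Two endpoints with allowance \<open>4 * \<delta> * r\<close> each, times 4
          for the geometric series, give the constant 32.\<close>
        have "detour j e \<le> (\<Sum>l\<in>{j..<K}. 8 * \<delta> * r * (3 / 4) ^ l)"
          unfolding xy(1) detour_def prod.case
        proof (rule sum_mono)
          fix l assume "l \<in> {j..<K}"
          with False have "\<pi>_step l x < 4 * \<delta> * r * (3 / 4) ^ l" "\<pi>_step l y < 4 * \<delta> * r * (3 / 4) ^ l"
            by (meson not_le)+
          then show "\<pi>_step l x + \<pi>_step l y \<le> 8 * \<delta> * r * (3 / 4) ^ l" by linarith
        qed
        also have "\<dots> \<le> 8 * \<delta> * r * (4 * (3 / 4) ^ j)"
          unfolding sum_distrib_left[symmetric] using \<delta> r
          by (intro mult_left_mono sum_three_quarters_le) auto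
        finally have "\<epsilon> / 8 * v x y \<le> 32 * \<delta> * r * (3 / 4) ^ j" using nQ by simp
        then show ?thesis using sd[of "Suc j"] Suc xy(1) kK by auto
      qed
    qed
  qed
qed

text \<open>The right side does not mention \<open>T\<close>: it counts over fixed nets, so its
  expectation can be computed although the tree depends on the projection. The factor 2 accounts for
  the two endpoints.\<close>

theorem card_bad_le:
  "card (bad T) \<le> card collapsed_pairs + card (contracted_pairs 0 (1 - \<epsilon> / 2)) +
     (\<Sum>k<K. card (contracted_pairs (Suc k) (1 / 8 * (3 / 4) ^ k))) +
     2 * (\<Sum>l<K. card (expanded_triples l))"
proof -
  let ?A = "short_detour T 0"
  let ?B = "\<lambda>k. {e \<in> short_detour T (Suc k). \<epsilon> / 8 * v (fst e) (snd e) \<le> 32 * \<delta> * r * (3 / 4) ^ k}"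
  let ?C = "\<lambda>l. {e \<in> short_detour T (Suc l). 4 * \<delta> * r * (3 / 4) ^ l \<le> \<pi>_step l (fst e)}"
  let ?D = "\<lambda>l. {e \<in> short_detour T (Suc l). 4 * \<delta> * r * (3 / 4) ^ l \<le> \<pi>_step l (snd e)}"
  have fs: "finite (short_detour T m)" for m
    by (rule finite_subset[OF _ bad_finite]) (auto simp: short_detour_def)
  have fc: "finite collapsed_pairs"
    by (rule finite_subset[of _ "X \<times> X"]) (use fin in \<open>auto simp: collapsed_pairs_def\<close>)
  have "card (bad T) \<le> card (collapsed_pairs \<union> ?A \<union> (\<Union>k<K. ?B k) \<union> (\<Union>l<K. ?C l) \<union> (\<Union>l<K. ?D l))"
    using fs fc by (intro card_mono bad_cover) auto
  also have "\<dots> \<le> card collapsed_pairs + card ?A + card (\<Union>k<K. ?B k) + card (\<Union>l<K. ?C l) + card (\<Union>l<K. ?D l)"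
    by (intro order_trans[OF card_Un_le] add_mono order_refl)
  also have "\<dots> \<le> card collapsed_pairs + card (contracted_pairs 0 (1 - \<epsilon> / 2)) +
     (\<Sum>k<K. card (contracted_pairs (Suc k) (1 / 8 * (3 / 4) ^ k))) +
     (\<Sum>l<K. card (expanded_triples l)) + (\<Sum>l<K. card (expanded_triples l))"
    by (intro add_mono order_refl card_short_detour_0 order_trans[OF card_UN_le] sum_mono
        card_short_detour_contracted card_short_detour_expanded) auto
  finally show ?thesis by simp
qed

end

end

section \<open>Gaussian projections\<close>

text \<open>Multiplying the density by the exponential gives, up to a constant, the density of
  another centred normal law, with variance divided by
  \<open>1 - 2 * t * \<sigma>\<^sup>2\<close>.\<close>

lemma normal_square_mgf:
  fixes \<sigma> t :: real
  assumes \<sigma>: "0 < \<sigma>" and t: "2 * t * \<sigma>\<^sup>2 < 1"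
  shows "(\<integral>\<^sup>+y. ennreal (normal_density 0 \<sigma> y) * ennreal (exp (t * y\<^sup>2)) \<partial>lborel) = ennreal ((1 - 2 * t * \<sigma>\<^sup>2) powr (- 1 / 2))"
proof -
  define c where "c = 1 - 2 * t * \<sigma>\<^sup>2"
  have c: "0 < c" using t by (simp add: c_def)
  define \<tau> where "\<tau> = \<sigma> / sqrt c"
  have \<tau>: "0 < \<tau>" "\<tau>\<^sup>2 = \<sigma>\<^sup>2 / c" using \<sigma> c by (simp_all add: \<tau>_def power_divide)
  have eq: "normal_density 0 \<sigma> y * exp (t * y\<^sup>2) = c powr (- 1 / 2) * normal_density 0 \<tau> y" for y
  proof -
    have "- y\<^sup>2 / (2 * \<sigma>\<^sup>2) + t * y\<^sup>2 = - y\<^sup>2 / (2 * \<tau>\<^sup>2)"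
      using \<sigma> c by (simp add: \<tau>(2) field_simps) (simp add: c_def algebra_simps)
    then have "exp (- y\<^sup>2 / (2 * \<sigma>\<^sup>2)) * exp (t * y\<^sup>2) = exp (- y\<^sup>2 / (2 * \<tau>\<^sup>2))"
      by (metis exp_add)
    moreover have "1 / sqrt (2 * pi * \<sigma>\<^sup>2) = c powr (- 1 / 2) * (1 / sqrt (2 * pi * \<tau>\<^sup>2))"
      using \<sigma> c by (simp add: \<tau>(2) powr_minus_divide powr_half_sqrt real_sqrt_mult real_sqrt_divide)
    ultimately show ?thesis by (simp add: normal_density_def)
  qed
  have "(\<integral>\<^sup>+y. ennreal (normal_density 0 \<sigma> y) * ennreal (exp (t * y\<^sup>2)) \<partial>lborel)
    = (\<integral>\<^sup>+y. ennreal (c powr (- 1 / 2)) * ennreal (normal_density 0 \<tau> y) \<partial>lborel)"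
    by (simp add: ennreal_mult''[symmetric] eq)
  also have "\<dots> = ennreal (c powr (- 1 / 2)) * (\<integral>\<^sup>+y. ennreal (normal_density 0 \<tau> y) \<partial>lborel)"
    by (rule nn_integral_cmult) simp
  also have "(\<integral>\<^sup>+y. ennreal (normal_density 0 \<tau> y) \<partial>lborel) = 1"
    using prob_space.emeasure_space_1[OF prob_space_normal_density[OF \<tau>(1), of 0]]
    by (simp add: emeasure_density)
  finally show ?thesis by (simp add: c_def)
qed

section \<open>Images of a vector under a Gaussian matrix\<close>

lemma prob_space_gaussian_entries: "0 < d \<Longrightarrow> prob_space (gaussian_entries d m)"
  unfolding gaussian_entries_def by (intro prob_space_PiM prob_space_normal_density) simp

lemma measurable_entry[measurable]:
  "i < d \<Longrightarrow> j < m \<Longrightarrow> (\<lambda>\<omega>. \<omega> (i, j)) \<in> borel_measurable (gaussian_entries d m)"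
  unfolding gaussian_entries_def
  by (subst measurable_cong_sets[OF sets_PiM_cong[OF HOL.refl] HOL.refl, of _ _ "\<lambda>_. borel"])
    (auto intro!: measurable_component_singleton)

text \<open>The joint law of the coordinates is the product measure itself, and its marginals are
  the factors.\<close>

lemma indep_vars_PiM_component:
  assumes "I \<noteq> {}" and M: "\<And>i. i \<in> I \<Longrightarrow> prob_space (M i)"
  shows "prob_space.indep_vars (Pi\<^sub>M I M) M (\<lambda>i \<omega>. \<omega> i) I"
proof -
  interpret P: prob_space "Pi\<^sub>M I M" by (rule prob_space_PiM[OF M])
  have "distr (Pi\<^sub>M I M) (Pi\<^sub>M I M) (\<lambda>\<omega>. \<lambda>i\<in>I. \<omega> i) = distr (Pi\<^sub>M I M) (Pi\<^sub>M I M) (\<lambda>\<omega>. \<omega>)"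
    by (rule distr_cong) (auto simp: space_PiM PiE_def extensional_restrict)
  also have "\<dots> = Pi\<^sub>M I M" by (rule distr_id2) simp
  also have "\<dots> = Pi\<^sub>M I (\<lambda>i. distr (Pi\<^sub>M I M) (M i) (\<lambda>\<omega>. \<omega> i))"
    by (rule PiM_cong) (simp_all add: distr_PiM_component M)
  finally show ?thesis
    by (subst P.indep_vars_iff_distr_eq_PiM'[OF assms(1)]) auto
qed

text \<open>The squared norm of G u, as a function of the matrix entries.\<close>

definition gaussian_form :: "nat \<Rightarrow> nat \<Rightarrow> (nat \<Rightarrow> real) \<Rightarrow> (nat \<times> nat \<Rightarrow> real) \<Rightarrow> real" where
  "gaussian_form d m u \<omega> = (\<Sum>i<d. (\<Sum>j<m. \<omega> (i, j) * u j)\<^sup>2)"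

lemma gaussian_form_measurable[measurable]:
  "gaussian_form d m u \<in> borel_measurable (gaussian_entries d m)"
  unfolding gaussian_form_def by measurable

lemma gaussian_row_distributed:
  assumes d: "0 < d" "i < d" and u: "0 < (\<Sum>j<m. (u j)\<^sup>2)"
  shows "distributed (gaussian_entries d m) lborel (\<lambda>\<omega>. \<Sum>j<m. \<omega> (i, j) * u j)
    (normal_density 0 (sqrt ((\<Sum>j<m. (u j)\<^sup>2) / d)))"
proof -
  let ?M = "gaussian_entries d m"
  let ?N = "density lborel (normal_density 0 (sqrt (1 / real d)))"
  interpret prob_space ?M by (rule prob_space_gaussian_entries[OF d(1)])
  \<comment> \<open>The rule for sums of independent normals wants positive standard deviations and
    a nonempty index set, so zero coefficients are dropped.\<close>
  define J where "J = {j \<in> {..<m}. u j \<noteq> 0}"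
  have J: "finite J" "J \<noteq> {}"
    using u by (auto simp: J_def) (metis (mono_tags, lifting) less_irrefl lessThan_iff power_zero_numeral sum.neutral)
  have m: "0 < m" using J(2) by (auto simp: J_def)
  have pN: "prob_space ?N" using d by (intro prob_space_normal_density) simp
  have ind: "indep_vars (\<lambda>_. borel) (\<lambda>k \<omega>. \<omega> k) ({..<d} \<times> {..<m})"
  proof -
    have "indep_vars (\<lambda>_. ?N) (\<lambda>k \<omega>. \<omega> k) ({..<d} \<times> {..<m})"
      unfolding gaussian_entries_def using d m pN by (intro indep_vars_PiM_component) auto
    from indep_vars_compose2[OF this, of "\<lambda>_ x. x" "\<lambda>_. borel"] show ?thesis by simp
  qed
  have dist: "distributed ?M lborel (\<lambda>\<omega>. \<omega> (i, j)) (normal_density 0 (sqrt (1 / real d)))" if "j < m" for j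
  proof -
    have "distr ?M lborel (\<lambda>\<omega>. \<omega> (i, j)) = distr ?M ?N (\<lambda>\<omega>. \<omega> (i, j))"
      by (rule distr_cong) auto
    also have "\<dots> = ?N" unfolding gaussian_entries_def
      using d that pN by (subst distr_PiM_component) auto
    finally show ?thesis using d that by (auto simp: distributed_def)
  qed
  have "distributed ?M lborel (\<lambda>\<omega>. \<Sum>j\<in>J. \<omega> (i, j) * u j)
    (normal_density (\<Sum>j\<in>J. 0) (sqrt (\<Sum>j\<in>J. (\<bar>u j\<bar> * sqrt (1 / real d))\<^sup>2)))"
  proof (rule sum_indep_normal[OF J])
    have "indep_vars (\<lambda>_. borel) (\<lambda>j \<omega>. \<omega> (i, j)) J"
    proof -
      have "indep_vars (\<lambda>j. Pi\<^sub>M {(i, j)} (\<lambda>_. borel)) (\<lambda>j \<omega>. restrict (\<lambda>k. \<omega> k) {(i, j)}) J"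
        using d by (intro indep_vars_restrict[OF ind]) (auto simp: disjoint_family_on_def J_def)
      from indep_vars_compose2[OF this, of "\<lambda>j f. f (i, j)" "\<lambda>_. borel"] show ?thesis by simp
    qed
    from indep_vars_compose2[OF this, of "\<lambda>j x. x * u j" "\<lambda>_. borel"]
    show "indep_vars (\<lambda>_. borel) (\<lambda>j \<omega>. \<omega> (i, j) * u j) J" by simp
    show "0 < \<bar>u j\<bar> * sqrt (1 / real d)" if "j \<in> J" for j using that d by (simp add: J_def)
    show "distributed ?M lborel (\<lambda>\<omega>. \<omega> (i, j) * u j) (normal_density 0 (\<bar>u j\<bar> * sqrt (1 / real d)))"
      if "j \<in> J" for j
      using normal_density_affine[OF dist[of j], of "u j" 0] that d by (simp add: J_def mult.commute)
  qed
  moreover have "(\<Sum>j\<in>J. \<omega> (i, j) * u j) = (\<Sum>j<m. \<omega> (i, j) * u j)" for \<omega> :: "nat \<times> nat \<Rightarrow> real"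
    unfolding J_def by (rule sum.mono_neutral_left) auto
  moreover have "(\<Sum>j\<in>J. (\<bar>u j\<bar> * sqrt (1 / real d))\<^sup>2) = (\<Sum>j<m. (u j)\<^sup>2) / d"
  proof -
    have "(\<Sum>j\<in>J. (\<bar>u j\<bar> * sqrt (1 / real d))\<^sup>2) = (\<Sum>j\<in>J. (u j)\<^sup>2) / d"
      by (simp add: power_mult_distrib sum_divide_distrib power_divide)
    also have "(\<Sum>j\<in>J. (u j)\<^sup>2) = (\<Sum>j<m. (u j)\<^sup>2)"
      unfolding J_def by (rule sum.mono_neutral_left) auto
    finally show ?thesis .
  qed
  ultimately show ?thesis by simp
qed

text \<open>Rows use disjoint blocks of entries and are therefore independent, and each row sum is a
  centred normal variable.\<close>

lemma gaussian_form_mgf: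
  assumes d: "0 < d" and u: "0 < (\<Sum>j<m. (u j)\<^sup>2)" and t: "2 * t * (\<Sum>j<m. (u j)\<^sup>2) / d < 1"
  shows "(\<integral>\<^sup>+\<omega>. ennreal (exp (t * gaussian_form d m u \<omega>)) \<partial>gaussian_entries d m)
    = ennreal ((1 - 2 * t * (\<Sum>j<m. (u j)\<^sup>2) / d) powr (- real d / 2))"
proof -
  let ?M = "gaussian_entries d m"
  let ?N = "density lborel (normal_density 0 (sqrt (1 / real d)))"
  let ?s = "\<Sum>j<m. (u j)\<^sup>2"
  let ?Y = "\<lambda>i \<omega>. \<Sum>j<m. \<omega> (i, j) * u j"
  interpret prob_space ?M by (rule prob_space_gaussian_entries[OF d])
  have m: "0 < m" using u by (cases m) auto
  have pN: "prob_space ?N" using d by (intro prob_space_normal_density) simp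
  have "indep_vars (\<lambda>_. ?N) (\<lambda>k \<omega>. \<omega> k) ({..<d} \<times> {..<m})"
    unfolding gaussian_entries_def using d m pN by (intro indep_vars_PiM_component) auto
  then have "indep_vars (\<lambda>i. Pi\<^sub>M ({i} \<times> {..<m}) (\<lambda>_. ?N)) (\<lambda>i \<omega>. restrict (\<lambda>k. \<omega> k) ({i} \<times> {..<m})) {..<d}"
    by (rule indep_vars_restrict) (auto simp: disjoint_family_on_def)
  then have "indep_vars (\<lambda>_. borel) (\<lambda>i \<omega>. ennreal (exp (t * (\<Sum>j<m. restrict (\<lambda>k. \<omega> k) ({i} \<times> {..<m}) (i, j) * u j)\<^sup>2))) {..<d}"
  proof (rule indep_vars_compose2)
    fix i
    have [measurable]: "(\<lambda>f. f (i, j)) \<in> borel_measurable (Pi\<^sub>M ({i} \<times> {..<m}) (\<lambda>_. ?N))" if "j < m" for j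
      by (subst measurable_cong_sets[OF sets_PiM_cong[OF HOL.refl] HOL.refl, of _ _ "\<lambda>_. borel"])
        (use that in \<open>auto intro!: measurable_component_singleton\<close>)
    show "(\<lambda>f. ennreal (exp (t * (\<Sum>j<m. f (i, j) * u j)\<^sup>2))) \<in> borel_measurable (Pi\<^sub>M ({i} \<times> {..<m}) (\<lambda>_. ?N))"
      by measurable
  qed
  then have ind: "indep_vars (\<lambda>_. borel) (\<lambda>i \<omega>. ennreal (exp (t * (?Y i \<omega>)\<^sup>2))) {..<d}"
    by (simp cong: sum.cong_simp)
  have "(\<integral>\<^sup>+\<omega>. ennreal (exp (t * gaussian_form d m u \<omega>)) \<partial>?M)
    = (\<integral>\<^sup>+\<omega>. (\<Prod>i<d. ennreal (exp (t * (?Y i \<omega>)\<^sup>2))) \<partial>?M)"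
    by (simp add: gaussian_form_def sum_distrib_left exp_sum prod_ennreal)
  also have "\<dots> = (\<Prod>i<d. \<integral>\<^sup>+\<omega>. ennreal (exp (t * (?Y i \<omega>)\<^sup>2)) \<partial>?M)"
    by (rule indep_vars_nn_integral[OF _ ind]) auto
  also have "\<dots> = (\<Prod>i<d. ennreal ((1 - 2 * t * ?s / d) powr (- 1 / 2)))"
  proof (rule prod.cong)
    fix i assume i: "i \<in> {..<d}"
    have "(\<integral>\<^sup>+\<omega>. ennreal (exp (t * (?Y i \<omega>)\<^sup>2)) \<partial>?M)
      = (\<integral>\<^sup>+y. ennreal (normal_density 0 (sqrt (?s / d)) y) * ennreal (exp (t * y\<^sup>2)) \<partial>lborel)"
      using i by (intro distributed_nn_integral[OF gaussian_row_distributed[OF d _ u], symmetric]) auto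
    also have "\<dots> = ennreal ((1 - 2 * t * (sqrt (?s / d))\<^sup>2) powr (- 1 / 2))"
      using u d t by (intro normal_square_mgf) auto
    finally show "(\<integral>\<^sup>+\<omega>. ennreal (exp (t * (?Y i \<omega>)\<^sup>2)) \<partial>?M) = ennreal ((1 - 2 * t * ?s / d) powr (- 1 / 2))"
      using u by simp
  qed simp
  also have "\<dots> = ennreal ((1 - 2 * t * ?s / d) powr (- real d / 2))"
    using t d by (simp add: ennreal_power powr_power)
  finally show ?thesis .
qed

text \<open>\<open>Q\<close> stands for a chi-square variable with \<open>d\<close> degrees of
  freedom divided by \<open>d\<close>; only its moment generating function is used.\<close>

locale normalized_chi_square = prob_space +
  fixes Q :: "'a \<Rightarrow> real" and d :: nat
  assumes Q_measurable[measurable]: "Q \<in> borel_measurable M" and d: "0 < d"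
    and mgf: "t < d / 2 \<Longrightarrow> (\<integral>\<^sup>+\<omega>. ennreal (exp (t * Q \<omega>)) \<partial>M) = ennreal ((1 - 2 * t / d) powr (- real d / 2))"
begin

text \<open>Chernoff's bound at the optimal parameter, for either sign of \<open>1 - 1 / a\<close>.\<close>
lemma chernoff:
  assumes a: "0 < a"
  shows "prob {\<omega> \<in> space M. (1 - 1 / a) * a \<le> (1 - 1 / a) * Q \<omega>} \<le> (a * exp (1 - a)) powr (d / 2)"
proof -
  define t where "t = (1 - 1 / a) * d / 2"
  let ?A = "{\<omega> \<in> space M. (1 - 1 / a) * a \<le> (1 - 1 / a) * Q \<omega>}"
  have t: "t < d / 2" "1 - 2 * t / d = 1 / a" using a d by (simp_all add: t_def field_simps)
  have "emeasure M ?A \<le> emeasure M ({\<omega> \<in> space M. 1 \<le> ennreal (exp (- t * a)) * ennreal (exp (t * Q \<omega>))})"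
  proof (rule emeasure_mono)
    show "?A \<subseteq> {\<omega> \<in> space M. 1 \<le> ennreal (exp (- t * a)) * ennreal (exp (t * Q \<omega>))}"
    proof safe
      fix \<omega> assume "(1 - 1 / a) * a \<le> (1 - 1 / a) * Q \<omega>"
      then have "(1 - 1 / a) * a * (d / 2) \<le> (1 - 1 / a) * Q \<omega> * (d / 2)" by (rule mult_right_mono) simp
      then have "t * a \<le> t * Q \<omega>" by (simp add: t_def mult_ac)
      then have "1 \<le> exp (- t * a + t * Q \<omega>)" by simp
      then show "1 \<le> ennreal (exp (- t * a)) * ennreal (exp (t * Q \<omega>))"
        by (simp only: exp_add ennreal_mult''[symmetric] exp_ge_zero) simp
    qed
  qed measurable
  also have "\<dots> \<le> ennreal (exp (- t * a)) * (\<integral>\<^sup>+\<omega>. ennreal (exp (t * Q \<omega>)) * indicator (space M) \<omega> \<partial>M)"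
    using nn_integral_Markov_inequality[where u = "\<lambda>\<omega>. ennreal (exp (t * Q \<omega>))" and M = M
        and A = "space M" and c = "ennreal (exp (- t * a))"]
    by (simp add: conj_commute)
  also have "(\<integral>\<^sup>+\<omega>. ennreal (exp (t * Q \<omega>)) * indicator (space M) \<omega> \<partial>M) = (\<integral>\<^sup>+\<omega>. ennreal (exp (t * Q \<omega>)) \<partial>M)"
    by (rule nn_integral_cong) simp
  also have "\<dots> = ennreal ((1 / a) powr (- real d / 2))" using mgf[OF t(1)] t(2) by simp
  also have "ennreal (exp (- t * a)) * \<dots> = ennreal ((a * exp (1 - a)) powr (d / 2))"
  proof -
    have "- t * a = (1 - a) * (d / 2)" using a by (simp add: t_def field_simps)
    then have "exp (- t * a) = exp (1 - a) powr (d / 2)" by (simp add: powr_def)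
    moreover have "(1 / a) powr (- real d / 2) = a powr (d / 2)" using a by (simp add: powr_divide powr_minus_divide)
    ultimately show ?thesis using a by (simp add: ennreal_mult''[symmetric] powr_mult mult.commute)
  qed
  finally show ?thesis by (simp add: emeasure_eq_measure)
qed

lemma lower_tail:
  assumes "0 < a" "a \<le> 1"
  shows "prob {\<omega> \<in> space M. Q \<omega> \<le> a} \<le> (a * exp (1 - a)) powr (d / 2)"
proof -
  have "prob {\<omega> \<in> space M. Q \<omega> \<le> a} \<le> prob {\<omega> \<in> space M. (1 - 1 / a) * a \<le> (1 - 1 / a) * Q \<omega>}"
    using assms by (intro finite_measure_mono) (auto intro!: mult_left_mono_neg)
  with chernoff[OF assms(1)] show ?thesis by simp
qed

lemma upper_tail:
  assumes "1 \<le> a"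
  shows "prob {\<omega> \<in> space M. a \<le> Q \<omega>} \<le> (a * exp (1 - a)) powr (d / 2)"
proof -
  have "prob {\<omega> \<in> space M. a \<le> Q \<omega>} \<le> prob {\<omega> \<in> space M. (1 - 1 / a) * a \<le> (1 - 1 / a) * Q \<omega>}"
    using assms by (intro finite_measure_mono) (auto intro!: mult_left_mono)
  with chernoff[of a] assms show ?thesis by simp
qed

text \<open>Bounding the exponential factor by 4 turns the Chernoff bound at
  \<open>\<tau>\<^sup>2\<close> into \<open>(2 * \<tau>) ^ d\<close>. The case of zero follows by
  letting the threshold shrink; it is what makes collapsed pairs negligible.\<close>

lemma prob_le_small:
  assumes "0 \<le> \<tau>"
  shows "prob {\<omega> \<in> space M. Q \<omega> \<le> \<tau>\<^sup>2} \<le> (2 * \<tau>) ^ d"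
proof -
  have pos: "prob {\<omega> \<in> space M. Q \<omega> \<le> \<tau>\<^sup>2} \<le> (2 * \<tau>) ^ d" if "0 < \<tau>" for \<tau>
  proof (cases "\<tau> \<le> 1")
    case True
    have "prob {\<omega> \<in> space M. Q \<omega> \<le> \<tau>\<^sup>2} \<le> (\<tau>\<^sup>2 * exp (1 - \<tau>\<^sup>2)) powr (d / 2)"
      using that True by (intro lower_tail) (auto simp: power_le_one)
    also have "\<dots> \<le> (\<tau>\<^sup>2 * 4) powr (d / 2)"
    proof (intro powr_mono2 mult_left_mono)
      have "exp (1 - \<tau>\<^sup>2) \<le> exp 1" by simp
      also have "\<dots> \<le> (4 :: real)" using exp_le by simp
      finally show "exp (1 - \<tau>\<^sup>2) \<le> 4" .
    qed auto
    also have "(\<tau>\<^sup>2 * 4) powr (d / 2) = (2 * \<tau>) ^ d"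
    proof -
      have "\<tau>\<^sup>2 * 4 = (2 * \<tau>) powr 2" using that by (simp add: power_mult_distrib)
      also have "\<dots> powr (d / 2) = (2 * \<tau>) powr d" by (simp only: powr_powr) simp
      also have "\<dots> = (2 * \<tau>) ^ d" using that by (simp only: powr_realpow)
      finally show ?thesis .
    qed
    finally show ?thesis .
  next
    case False
    then have "1 \<le> (2 * \<tau>) ^ d" by (intro one_le_power) simp
    then show ?thesis by (rule order_trans[OF prob_le_1])
  qed
  show ?thesis
  proof (cases "\<tau> = 0")
    case True
    have "prob {\<omega> \<in> space M. Q \<omega> \<le> 0} \<le> 0 + e" if e: "0 < e" for e
    proof -
      define s where "s = min 1 e / 2"
      have s: "0 < s" "2 * s \<le> 1" "2 * s \<le> e" using e by (auto simp: s_def)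
      have "prob {\<omega> \<in> space M. Q \<omega> \<le> 0} \<le> prob {\<omega> \<in> space M. Q \<omega> \<le> s\<^sup>2}"
        by (intro finite_measure_mono) (auto intro: order_trans)
      also have "\<dots> \<le> (2 * s) ^ d" using pos s by blast
      also have "\<dots> \<le> (2 * s) ^ 1" using s d by (intro power_decreasing) auto
      finally show ?thesis using s by simp
    qed
    then have "prob {\<omega> \<in> space M. Q \<omega> \<le> 0} \<le> 0" by (rule field_le_epsilon)
    then show ?thesis using True d by (simp add: zero_power)
  qed (use pos assms in auto)
qed

text \<open>Writing the threshold as 1 - x with x at least e, the Chernoff base is (1 - x) exp x,
  and two terms of the logarithmic series bound it by exp(-x^2/2).\<close>

lemma prob_le_contracted:
  assumes e: "0 < e" "e < 1"
  shows "prob {\<omega> \<in> space M. Q \<omega> \<le> (1 - e)\<^sup>2} \<le> exp (- (e\<^sup>2 * d / 4))"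
proof -
  define x where "x = 1 - (1 - e)\<^sup>2"
  have x: "e \<le> x" "x < 1"
  proof -
    have "e * e \<le> e * 1" using e by (intro mult_left_mono) auto
    then show "e \<le> x" by (simp add: x_def power2_eq_square algebra_simps)
    show "x < 1" using e by (simp add: x_def)
  qed
  have "ln (1 - x) \<le> - x - x\<^sup>2 / 2"
  proof -
    have "ln (1 - x) + x + x\<^sup>2 / 2 \<le> ln (1 - 0) + 0 + 0\<^sup>2 / 2"
    proof (rule DERIV_nonpos_imp_nonincreasing[where f = "\<lambda>x. ln (1 - x) + x + x\<^sup>2 / 2"])
      show "0 \<le> x" using x e by simp
      fix y assume y: "0 \<le> y" "y \<le> x"
      have "((\<lambda>x. ln (1 - x) + x + x\<^sup>2 / 2) has_real_derivative (- 1 / (1 - y) + 1 + y)) (at y)"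
        using x y by (auto intro!: derivative_eq_intros simp: field_simps)
      moreover have "- 1 / (1 - y) + 1 + y \<le> 0" using x y by (simp add: field_simps)
      ultimately show "\<exists>z. ((\<lambda>x. ln (1 - x) + x + x\<^sup>2 / 2) has_real_derivative z) (at y) \<and> z \<le> 0" by blast
    qed
    then show ?thesis by simp
  qed
  then have "exp (ln (1 - x)) \<le> exp (- x - x\<^sup>2 / 2)" by simp
  then have "1 - x \<le> exp (- x - x\<^sup>2 / 2)" using x by simp
  moreover have "(1 - e)\<^sup>2 = 1 - x" "1 - (1 - e)\<^sup>2 = x" by (simp_all add: x_def)
  ultimately have "(1 - e)\<^sup>2 * exp (1 - (1 - e)\<^sup>2) \<le> exp (- x - x\<^sup>2 / 2) * exp x"
    by simp
  also have "\<dots> = exp (- (x\<^sup>2 / 2))" by (simp add: exp_add[symmetric])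
  also have "\<dots> \<le> exp (- (e\<^sup>2 / 2))" using x e by (simp add: power_mono)
  finally have "((1 - e)\<^sup>2 * exp (1 - (1 - e)\<^sup>2)) powr (d / 2) \<le> exp (- (e\<^sup>2 / 2)) powr (d / 2)"
    by (intro powr_mono2) auto
  also have "\<dots> = exp (- (e\<^sup>2 * d / 4))" by (simp add: powr_def field_simps)
  finally show ?thesis using lower_tail[of "(1 - e)\<^sup>2"] e by (simp add: power_le_one)
qed

lemma prob_ge_large:
  assumes s: "2 \<le> s"
  shows "prob {\<omega> \<in> space M. s\<^sup>2 \<le> Q \<omega>} \<le> (1 / s) ^ d"
proof -
  have s2: "4 \<le> s\<^sup>2" using power_mono[OF s, of 2] by simp
  have "s ^ 4 * exp (1 - s\<^sup>2) \<le> 1"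
  proof -
    \<comment> \<open>The claim reduces to 2 ln(s^2) + 1 <= s^2. Expanding the logarithm around 4,
      this value of ln 4 gives it exactly from s^2 = 4 on.\<close>
    have l4: "ln (4 :: real) \<le> 3 / 2"
    proof -
      have "(4 :: real) \<le> (1 + 3 / 2 / real 12) ^ 12" by (simp add: power_numeral_reduce)
      also have "\<dots> \<le> exp (3 / 2)" by (rule exp_ge_one_plus_x_over_n_power_n) auto
      finally have "ln 4 \<le> ln (exp (3 / 2 :: real))" by (intro ln_mono) auto
      then show ?thesis by simp
    qed
    have "2 * ln (s\<^sup>2) + 1 \<le> s\<^sup>2"
      using ln_le_minus_one[of "s\<^sup>2 / 4"] s s2 l4 by (simp add: ln_div)
    then have "exp (2 * ln (s\<^sup>2) + 1) \<le> exp (s\<^sup>2)" by simp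
    then have "exp (2 * ln (s\<^sup>2)) * exp (1 - s\<^sup>2) \<le> 1"
      by (simp add: exp_add[symmetric])
    moreover have "exp (2 * ln (s\<^sup>2)) = s ^ 4"
    proof -
      have "exp (2 * ln (s\<^sup>2)) = (exp (ln (s\<^sup>2)))\<^sup>2" by (simp add: exp_double[symmetric])
      also have "\<dots> = s ^ 4" using s by (simp add: power_mult[symmetric])
      finally show ?thesis .
    qed
    ultimately show ?thesis by simp
  qed
  then have "s\<^sup>2 * exp (1 - s\<^sup>2) \<le> (1 / s) powr 2"
    using s by (simp add: field_simps power_numeral_reduce)
  then have "(s\<^sup>2 * exp (1 - s\<^sup>2)) powr (d / 2) \<le> ((1 / s) powr 2) powr (d / 2)"
    by (intro powr_mono2) auto
  also have "((1 / s) powr 2) powr (d / 2) = (1 / s) ^ d"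
  proof -
    have "((1 / s) powr 2) powr (d / 2) = (1 / s) powr d" by (simp only: powr_powr) simp
    also have "\<dots> = (1 / s) ^ d" using s by (intro powr_realpow) simp
    finally show ?thesis .
  qed
  finally show ?thesis using upper_tail[of "s\<^sup>2"] s2 by linarith
qed

text \<open>\<open>Q\<close> fluctuates around 1 by order 1 / sqrt d. The bound |y| <= exp y +
  exp(-y) is applied to s (Q - 1) with s of order sqrt d, where both exponential moments remain
  bounded.\<close>

lemma mean_abs_deviation: "(\<integral>\<^sup>+\<omega>. ennreal \<bar>Q \<omega> - 1\<bar> \<partial>M) \<le> ennreal (16 / sqrt d)"
proof -
  define s where "s = sqrt d / 4"
  have d1: "1 \<le> sqrt d" using d by simp
  have s: "0 < s" "s < d / 2" "- s < d / 2" and v: "2 * s / d = 1 / (2 * sqrt d)"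
  proof -
    have "sqrt d * 1 \<le> sqrt d * sqrt d" using d1 by (intro mult_left_mono) auto
    then have "sqrt d \<le> d" by simp
    with d1 show "0 < s" "s < d / 2" "- s < d / 2" unfolding s_def by linarith+
    show "2 * s / d = 1 / (2 * sqrt d)" using d by (simp add: s_def field_simps)
  qed
  define x where "x = 1 / (2 * sqrt (real d))"
  have x: "0 < x" "x \<le> 1 / 2" "d / 2 * (x + x\<^sup>2) = s + 1 / 8" "d / 2 * (x - x\<^sup>2) = s - 1 / 8"
  proof -
    define q where "q = sqrt (real d)"
    have q: "0 < q" "1 \<le> q" "real d = q\<^sup>2" using d d1 by (simp_all add: q_def)
    have xq: "x = 1 / (2 * q)" "s = q / 4" by (simp_all add: x_def s_def q_def)
    show "0 < x" "x \<le> 1 / 2" "d / 2 * (x + x\<^sup>2) = s + 1 / 8" "d / 2 * (x - x\<^sup>2) = s - 1 / 8"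
      unfolding xq q(3) using q(1,2) by (simp_all add: field_simps power2_eq_square)
  qed
  have pt: "\<bar>y\<bar> \<le> exp y + exp (- y)" for y :: real
    using exp_ge_add_one_self[of y] exp_ge_add_one_self[of "- y"] exp_gt_zero[of y] exp_gt_zero[of "- y"] by linarith
  have bound: "\<bar>y - 1\<bar> \<le> 1 / s * (exp (- s) * exp (s * y) + exp s * exp (- s * y))" for y
  proof -
    have "s * \<bar>y - 1\<bar> = \<bar>s * (y - 1)\<bar>" using s by (simp add: abs_mult)
    also have "\<dots> \<le> exp (s * (y - 1)) + exp (- (s * (y - 1)))" by (rule pt)
    also have "\<dots> = exp (- s) * exp (s * y) + exp s * exp (- s * y)"
      by (simp add: exp_add[symmetric] algebra_simps)
    finally show ?thesis using s(1) by (simp add: field_simps)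
  qed
  have split: "ennreal (a * (b * c + e * f)) = ennreal a * (ennreal b * ennreal c + ennreal e * ennreal f)"
    if "0 \<le> a" "0 \<le> b" "0 \<le> c" "0 \<le> e" "0 \<le> f" for a b c e f
    using that by (simp only: ennreal_mult ennreal_plus mult_nonneg_nonneg add_nonneg_nonneg)
  have "(\<integral>\<^sup>+\<omega>. ennreal \<bar>Q \<omega> - 1\<bar> \<partial>M) \<le>
    (\<integral>\<^sup>+\<omega>. ennreal (1 / s) * (ennreal (exp (- s)) * ennreal (exp (s * Q \<omega>)) + ennreal (exp s) * ennreal (exp (- s * Q \<omega>))) \<partial>M)"
  proof (rule nn_integral_mono)
    fix \<omega>
    have "ennreal \<bar>Q \<omega> - 1\<bar> \<le> ennreal (1 / s * (exp (- s) * exp (s * Q \<omega>) + exp s * exp (- s * Q \<omega>)))"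
      using bound by (rule ennreal_leI)
    also have "\<dots> = ennreal (1 / s) * (ennreal (exp (- s)) * ennreal (exp (s * Q \<omega>)) + ennreal (exp s) * ennreal (exp (- s * Q \<omega>)))"
      using s(1) by (intro split) auto
    finally show "ennreal \<bar>Q \<omega> - 1\<bar> \<le> \<dots>" .
  qed
  also have "\<dots> = ennreal (1 / s) * (ennreal (exp (- s)) * (\<integral>\<^sup>+\<omega>. ennreal (exp (s * Q \<omega>)) \<partial>M)
      + ennreal (exp s) * (\<integral>\<^sup>+\<omega>. ennreal (exp (- s * Q \<omega>)) \<partial>M))"
    by (simp add: nn_integral_cmult nn_integral_add)
  also have "\<dots> = ennreal (1 / s * (exp (- s) * (1 - x) powr (- real d / 2) + exp s * (1 + x) powr (- real d / 2)))"
    using s mgf[of s] mgf[of "- s"] v by (subst split) (simp_all add: x_def)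
  also have "\<dots> \<le> ennreal (1 / s * (2 + 2))"
  proof (intro ennreal_leI mult_left_mono add_mono)
    have "- x - 2 * x\<^sup>2 \<le> ln (1 - x)" by (rule ln_one_minus_pos_lower_bound) (use x in auto)
    then have "d / 2 * (- x - 2 * x\<^sup>2) \<le> d / 2 * ln (1 - x)" by (intro mult_left_mono) auto
    moreover have "d / 2 * (- x - 2 * x\<^sup>2) = - s - 1 / 4"
      using x(3,4) by (simp add: algebra_simps)
    ultimately have "- s + - (d / 2) * ln (1 - x) \<le> 1 / 4" by simp
    then have "exp (- s + - (d / 2) * ln (1 - x)) \<le> exp (1 / 4)" by simp
    moreover have "exp (1 / 4 :: real) \<le> 2" using exp_bound[of "1 / 4 :: real"] by (simp add: power2_eq_square)
    moreover have "exp (- s) * (1 - x) powr (- real d / 2) = exp (- s + - (d / 2) * ln (1 - x))"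
      using x by (simp add: powr_def exp_add[symmetric])
    ultimately show "exp (- s) * (1 - x) powr (- real d / 2) \<le> 2" by linarith
    have "x - x\<^sup>2 \<le> ln (1 + x)" using ln_one_plus_pos_lower_bound[of x] x by simp
    then have "d / 2 * (x - x\<^sup>2) \<le> d / 2 * ln (1 + x)" by (intro mult_left_mono) auto
    then have "s + - (d / 2) * ln (1 + x) \<le> 1 / 8" using x(4) by (simp add: algebra_simps)
    then have "exp (s + - (d / 2) * ln (1 + x)) \<le> exp (1 / 8)" by simp
    moreover have "exp (1 / 8 :: real) \<le> 2" using exp_bound[of "1 / 8 :: real"] by (simp add: power2_eq_square)
    moreover have "exp s * (1 + x) powr (- real d / 2) = exp (s + - (d / 2) * ln (1 + x))"
      using x by (simp add: powr_def exp_add[symmetric])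
    ultimately show "exp s * (1 + x) powr (- real d / 2) \<le> 2" by linarith
  qed (use s in auto)
  also have "1 / s * (2 + 2) = 16 / sqrt d" by (simp add: s_def)
  finally show ?thesis .
qed

end

lemma gaussian_form_normalized:
  assumes d: "0 < d" and u: "0 < (\<Sum>j<m. (u j)\<^sup>2)"
  shows "normalized_chi_square (gaussian_entries d m) (\<lambda>\<omega>. gaussian_form d m u \<omega> / (\<Sum>j<m. (u j)\<^sup>2)) d"
proof -
  let ?s = "\<Sum>j<m. (u j)\<^sup>2"
  interpret prob_space "gaussian_entries d m" by (rule prob_space_gaussian_entries[OF d])
  show ?thesis
  proof
    show "(\<integral>\<^sup>+\<omega>. ennreal (exp (t * (gaussian_form d m u \<omega> / ?s))) \<partial>gaussian_entries d m)
      = ennreal ((1 - 2 * t / d) powr (- real d / 2))" if "t < d / 2" for t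
      using gaussian_form_mgf[OF d u, of "t / ?s"] that u d by (simp add: field_simps)
  qed (use d in measurable)
qed

section \<open>Random pseudometrics with chi-square tails\<close>

text \<open>Linearity of expectation: estimates for single pairs suffice, whatever their
  dependence.\<close>

lemma (in prob_space) expected_count_le:
  assumes P: "finite P"
    and ev: "\<And>i. i \<in> P \<Longrightarrow> {\<omega> \<in> space M. E \<omega> i} \<in> events"
    and p: "\<And>i. i \<in> P \<Longrightarrow> prob {\<omega> \<in> space M. E \<omega> i} \<le> p"
  shows "integrable M (\<lambda>\<omega>. real (card {i \<in> P. E \<omega> i}))"
    and "expectation (\<lambda>\<omega>. real (card {i \<in> P. E \<omega> i})) \<le> real (card P) * p"
proof -
  have eq: "real (card {i \<in> P. E \<omega> i}) = (\<Sum>i\<in>P. indicator {\<omega> \<in> space M. E \<omega> i} \<omega>)"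
    if "\<omega> \<in> space M" for \<omega>
    using that P by (simp add: indicator_def sum.If_cases Int_def)
  have int: "integrable M (\<lambda>\<omega>. \<Sum>i\<in>P. indicator {\<omega> \<in> space M. E \<omega> i} \<omega> :: real)"
    using ev by (intro Bochner_Integration.integrable_sum integrable_real_indicator) (auto simp: emeasure_eq_measure)
  then show "integrable M (\<lambda>\<omega>. real (card {i \<in> P. E \<omega> i}))"
    using eq by (subst Bochner_Integration.integrable_cong[OF HOL.refl]) auto
  have "expectation (\<lambda>\<omega>. real (card {i \<in> P. E \<omega> i}))
    = expectation (\<lambda>\<omega>. \<Sum>i\<in>P. indicator {\<omega> \<in> space M. E \<omega> i} \<omega>)"
    using eq by (intro Bochner_Integration.integral_cong) auto
  also have "\<dots> = (\<Sum>i\<in>P. prob {\<omega> \<in> space M. E \<omega> i})"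
    using ev by (subst Bochner_Integration.integral_sum)
      (auto simp: emeasure_eq_measure intro!: integrable_real_indicator sum.cong)
  also have "\<dots> \<le> (\<Sum>i\<in>P. p)" using p by (rule sum_mono)
  finally show "expectation (\<lambda>\<omega>. real (card {i \<in> P. E \<omega> i})) \<le> real (card P) * p" by simp
qed

text \<open>The interface to the Gaussian part: estimates for one pair of points at a time, with
  nothing about joint laws.\<close>

locale random_pseudometric = prob_space M + orig: pseudometric_on X w
  for M :: "'o measure" and X :: "'a set" and w +
  fixes v :: "'o \<Rightarrow> 'a \<Rightarrow> 'a \<Rightarrow> real" and d l :: nat
  assumes finX: "finite X"
    and w_pos: "x \<in> X \<Longrightarrow> y \<in> X \<Longrightarrow> x \<noteq> y \<Longrightarrow> 0 < w x y"
    and v_pseudometric: "pseudometric_on X (v \<omega>)"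
    and v_measurable: "x \<in> X \<Longrightarrow> y \<in> X \<Longrightarrow> (\<lambda>\<omega>. v \<omega> x y) \<in> borel_measurable M"
    and small: "x \<in> X \<Longrightarrow> y \<in> X \<Longrightarrow> x \<noteq> y \<Longrightarrow> 0 \<le> \<tau> \<Longrightarrow>
      prob {\<omega> \<in> space M. v \<omega> x y \<le> \<tau> * w x y} \<le> (2 * \<tau>) ^ d"
    and contracted: "x \<in> X \<Longrightarrow> y \<in> X \<Longrightarrow> x \<noteq> y \<Longrightarrow> 0 < e \<Longrightarrow> e < 1 \<Longrightarrow>
      prob {\<omega> \<in> space M. v \<omega> x y \<le> (1 - e) * w x y} \<le> exp (- (e\<^sup>2 * d / 4))"
    and expanded: "x \<in> X \<Longrightarrow> y \<in> X \<Longrightarrow> x \<noteq> y \<Longrightarrow> 2 \<le> s \<Longrightarrow>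
      prob {\<omega> \<in> space M. s * w x y \<le> v \<omega> x y} \<le> (1 / s) ^ d"
    and deviation: "x \<in> X \<Longrightarrow> y \<in> X \<Longrightarrow>
      (\<integral>\<^sup>+\<omega>. ennreal \<bar>v \<omega> x y - w x y\<bar> \<partial>M) \<le> ennreal (16 / sqrt d * w x y)"
    and d_pos: "0 < d"
    and doubling: "doubling_bound X w l"
begin

lemma sublevel_event: "x \<in> X \<Longrightarrow> y \<in> X \<Longrightarrow> {\<omega> \<in> space M. v \<omega> x y \<le> c} \<in> events"
  using v_measurable by measurable

lemma superlevel_event: "x \<in> X \<Longrightarrow> y \<in> X \<Longrightarrow> {\<omega> \<in> space M. c \<le> v \<omega> x y} \<in> events"
  using v_measurable by measurable

lemma net_family_exists:
  assumes r: "0 < r" and \<delta>: "0 < \<delta>"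
  obtains N \<pi> K where "\<And>k. N k \<subseteq> X" "\<And>k. separated w (\<delta> * r / 2 ^ k) (N k)"
    "\<And>k x. x \<in> X \<Longrightarrow> \<pi> k x \<in> N k" "\<And>k x. x \<in> X \<Longrightarrow> w x (\<pi> k x) \<le> \<delta> * r / 2 ^ k"
    "\<And>x. x \<in> X \<Longrightarrow> \<pi> K x = x"
proof -
  have "\<forall>k. \<exists>P. fst P \<subseteq> X \<and> separated w (\<delta> * r / 2 ^ k) (fst P) \<and>
      (\<forall>x\<in>X. snd P x \<in> fst P \<and> w x (snd P x) \<le> \<delta> * r / 2 ^ k)"
    using orig.net_exists[OF finX] r \<delta> by simp
  from choice[OF this] obtain P where P: "\<forall>k. fst (P k) \<subseteq> X \<and> separated w (\<delta> * r / 2 ^ k) (fst (P k)) \<and>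
      (\<forall>x\<in>X. snd (P k) x \<in> fst (P k) \<and> w x (snd (P k) x) \<le> \<delta> * r / 2 ^ k)" ..
  \<comment> \<open>The inserted 1 keeps the minimum meaningful when there are no two distinct
    points. Once the net radius is below this minimum, rounding is the identity.\<close>
  define S where "S = insert 1 ((\<lambda>(x, y). w x y) ` {(x, y) \<in> X \<times> X. x \<noteq> y})"
  have "finite {(x, y) \<in> X \<times> X. x \<noteq> y}"
    by (rule finite_subset[of _ "X \<times> X"]) (use finX in auto)
  then have S: "finite S" "S \<noteq> {}" by (auto simp: S_def)
  have "Min S \<in> S" using S by simp
  then have pos: "0 < Min S" using w_pos by (auto simp: S_def)
  obtain K where K: "\<delta> * r / Min S < 2 ^ K" using real_arch_pow[of 2 "\<delta> * r / Min S"] by auto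
  then have K': "\<delta> * r / 2 ^ K < Min S" using pos by (simp add: field_simps)
  have "snd (P K) x = x" if x: "x \<in> X" for x
  proof (rule ccontr)
    assume ne: "snd (P K) x \<noteq> x"
    have "snd (P K) x \<in> X" using P x by blast
    then have "w x (snd (P K) x) \<in> S" using x ne by (force simp: S_def)
    then have "Min S \<le> w x (snd (P K) x)" using S by simp
    moreover have "w x (snd (P K) x) \<le> \<delta> * r / 2 ^ K" using P x by blast
    ultimately show False using K' by simp
  qed
  then show ?thesis using that[of "\<lambda>k. fst (P k)" "\<lambda>k. snd (P k)" K] P by blast
qed

text \<open>The factor \<open>l ^ (3 * h + 3)\<close> pays for the size of a net at scale \<open>\<delta> r\<close> and for two
  neighbours of each net point, the exponential for the cheapest rare event.\<close>
lemma scale_bound: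
  fixes r \<epsilon> :: real
  assumes E: "is_spanning_tree X T\<^sub>0" and r: "0 < r" "r \<le> edge_cost w T\<^sub>0"
    and \<epsilon>: "0 < \<epsilon>" "\<epsilon> \<le> 1" and h: "8 / 2 ^ h \<le> \<epsilon> / 8192"
    and l2: "2 \<le> l" and ld: "real l ^ 3 * (3 / 4) ^ d \<le> 1 / 2"
  shows "\<exists>Y. integrable M Y \<and> (\<forall>\<omega>. 0 \<le> Y \<omega>) \<and>
     expectation Y \<le> edge_cost w T\<^sub>0 / r * (7 * real l ^ (3 * h + 3) * exp (- (\<epsilon>\<^sup>2 * d / 16))) \<and>
     (\<forall>\<omega> T. min_tree X (v \<omega>) T \<longrightarrow>
        real (card {(x, y) \<in> T. r < w x y \<and> w x y \<le> 2 * r \<and> v \<omega> x y < (1 - \<epsilon>) * w x y}) \<le> Y \<omega>)"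
proof -
  \<comment> \<open>A power of 2 makes radii comparable by halvings: from radius
    \<open>3 * r\<close> down to half the separation at level \<open>k\<close> takes
    \<open>h + k\<close> of them, because 3 <= 8 / 2.\<close>
  define \<delta> :: real where "\<delta> = 8 / 2 ^ h"
  have \<delta>: "0 < \<delta>" "\<delta> \<le> \<epsilon> / 8192" using h by (simp_all add: \<delta>_def)
  define A where "A = edge_cost w T\<^sub>0 / r"
  have A: "0 \<le> A" using r by (simp add: A_def)
  let ?l = "real l"
  have l: "1 \<le> ?l" "2 \<le> ?l" using l2 by auto
  obtain N \<pi> K where N: "\<And>k. N k \<subseteq> X" "\<And>k. separated w (\<delta> * r / 2 ^ k) (N k)"
    "\<And>k x. x \<in> X \<Longrightarrow> \<pi> k x \<in> N k" "\<And>k x. x \<in> X \<Longrightarrow> w x (\<pi> k x) \<le> \<delta> * r / 2 ^ k"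
    "\<And>x. x \<in> X \<Longrightarrow> \<pi> K x = x"
    using net_family_exists[OF r(1) \<delta>(1)] by metis
  interpret H: net_hierarchy X w "v \<omega>" N \<pi> K r \<delta> \<epsilon> for \<omega>
    by (intro net_hierarchy.intro net_hierarchy_axioms.intro orig.pseudometric_on_axioms v_pseudometric)
      (use finX N r \<epsilon> \<delta> in auto)
  have T\<^sub>0: "T\<^sub>0 \<subseteq> X \<times> X" "\<And>x y. x \<in> X \<Longrightarrow> y \<in> X \<Longrightarrow> (x, y) \<in> reach T\<^sub>0"
    using E by (auto simp: is_spanning_tree_def)
  then have finT: "finite T\<^sub>0" using finX by (meson finite_SigmaI finite_subset)
  have finN: "finite (N k)" for k using H.finN .
  have NX: "p \<in> N k \<Longrightarrow> p \<in> X" for p k using N(1) by blast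
  have cardN: "real (card (N k)) \<le> A * ?l ^ (h + k)" for k
  proof -
    let ?\<rho> = "\<delta> * r / 2 ^ k"
    have "0 < ?\<rho>" using \<delta> r by simp
    moreover have "?\<rho> \<le> r" using H.\<rho>_le[of k] r by linarith
    ultimately have \<rho>: "0 < ?\<rho>" "?\<rho> \<le> r" by auto
    have "real (card (N k)) * ?\<rho> \<le> 2 * edge_cost w T\<^sub>0"
    \<comment> \<open>The separation bound needs two points. For at most one, the assumption that
      \<open>r\<close> does not exceed the tree cost is enough.\<close>
    proof (cases "2 \<le> card (N k)")
      case True
      then show ?thesis
        using N(1,2)[of k] finN[of k] \<rho>(1) finT T\<^sub>0
        by (intro orig.connected_cost_ge_separated) (auto simp: separated_def)
    next
      case False
      then have "real (card (N k)) * ?\<rho> \<le> 1 * ?\<rho>" using \<rho>(1) by (intro mult_right_mono) auto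
      then show ?thesis using \<rho> r by linarith
    qed
    then have "real (card (N k)) \<le> 2 * edge_cost w T\<^sub>0 / ?\<rho>" using \<rho>(1) by (subst pos_le_divide_eq)
    also have "\<dots> = A * (2 ^ (h + k) / 4)" by (simp add: A_def \<delta>_def power_add field_simps)
    also have "\<dots> \<le> A * ?l ^ (h + k)"
    proof (rule mult_left_mono[OF _ A])
      have "(2 :: real) ^ (h + k) \<le> ?l ^ (h + k)" using l by (intro power_mono) auto
      moreover have "(2 :: real) ^ (h + k) / 4 \<le> 2 ^ (h + k)" by simp
      ultimately show "2 ^ (h + k) / 4 \<le> ?l ^ (h + k)" by linarith
    qed
    finally show ?thesis .
  qed
  have degree: "card {p \<in> N k. w p x \<le> 3 * r} \<le> l ^ (h + k)" if "x \<in> X" for k x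
  proof (rule orig.packing[OF doubling that finX N(1,2)])
    show "3 * r / 2 ^ (h + k) \<le> \<delta> * r / 2 ^ k / 2" using r by (simp add: \<delta>_def power_add field_simps)
  qed (use r in auto)

  define PZ where "PZ = {(x, y) \<in> X \<times> X. 0 < w x y}"
  define PC where "PC k = {(p, q) \<in> N k \<times> N k. 0 < w p q \<and> w p q \<le> 3 * r}" for k
  define PE where "PE k = {(u, p, q) \<in> N k \<times> N (Suc k) \<times> N (Suc k).
     w u p \<le> 2 * (\<delta> * r / 2 ^ k) \<and> w p q \<le> 3 * r}" for k
  have finP: "finite PZ" "finite (PC k)" "finite (PE k)" for k
  proof -
    show "finite PZ" by (rule finite_subset[of _ "X \<times> X"]) (use finX in \<open>auto simp: PZ_def\<close>)
    show "finite (PC k)" by (rule finite_subset[of _ "N k \<times> N k"]) (use finN in \<open>auto simp: PC_def\<close>)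
    show "finite (PE k)" by (rule finite_subset[of _ "N k \<times> N (Suc k) \<times> N (Suc k)"])
      (use finN in \<open>auto simp: PE_def\<close>)
  qed
  have cardPC: "real (card (PC k)) \<le> A * ?l ^ (2 * (h + k))" for k
  proof -
    have "card (PC k) \<le> card (prod.swap ` (SIGMA q:N k. {p \<in> N k. w p q \<le> 3 * r}))"
      using finN by (intro card_mono) (auto simp: PC_def image_iff)
    also have "\<dots> \<le> card (SIGMA q:N k. {p \<in> N k. w p q \<le> 3 * r})"
      using finN by (intro card_image_le) auto
    also have "\<dots> = (\<Sum>q\<in>N k. card {p \<in> N k. w p q \<le> 3 * r})" using finN by simp
    also have "\<dots> \<le> (\<Sum>q\<in>N k. l ^ (h + k))" using degree NX by (intro sum_mono) blast
    also have "\<dots> = card (N k) * l ^ (h + k)" by simp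
    finally have "real (card (PC k)) \<le> real (card (N k)) * ?l ^ (h + k)"
      by (metis of_nat_le_iff of_nat_mult of_nat_power)
    also have "\<dots> \<le> A * ?l ^ (h + k) * ?l ^ (h + k)" using cardN by (intro mult_right_mono) auto
    also have "\<dots> = A * ?l ^ (2 * (h + k))" by (simp add: power_add mult_2)
    finally show ?thesis .
  qed
  have cardPE: "real (card (PE k)) \<le> A * ?l ^ (3 * (h + k) + 2)" for k
  proof -
    have small: "2 * (\<delta> * r / 2 ^ k) \<le> 3 * r" using H.\<rho>_le[of k] r by linarith
    \<comment> \<open>Triples are counted from \<open>p\<close>, which is close to both other
      members.\<close>
    let ?S = "SIGMA p:N (Suc k). {u \<in> N k. w u p \<le> 3 * r} \<times> {q \<in> N (Suc k). w q p \<le> 3 * r}"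
    have "PE k \<subseteq> (\<lambda>(p, u, q). (u, p, q)) ` ?S"
    proof
      fix z assume "z \<in> PE k"
      then obtain u p q where z: "z = (u, p, q)" "u \<in> N k" "p \<in> N (Suc k)" "q \<in> N (Suc k)"
        "w u p \<le> 2 * (\<delta> * r / 2 ^ k)" "w p q \<le> 3 * r" by (auto simp: PE_def)
      have "w q p = w p q" using z NX by (intro orig.commute) blast+
      then have "(p, u, q) \<in> ?S" using z small by auto
      then show "z \<in> (\<lambda>(p, u, q). (u, p, q)) ` ?S" using z(1) by (intro image_eqI[of _ _ "(p, u, q)"]) auto
    qed
    then have "card (PE k) \<le> card ((\<lambda>(p, u, q). (u, p, q)) ` ?S)" using finN by (intro card_mono) auto
    also have "\<dots> \<le> card ?S" using finN by (intro card_image_le) auto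
    also have "\<dots> = (\<Sum>p\<in>N (Suc k). card {u \<in> N k. w u p \<le> 3 * r} * card {q \<in> N (Suc k). w q p \<le> 3 * r})"
      using finN by (simp add: card_cartesian_product)
    also have "\<dots> \<le> (\<Sum>p\<in>N (Suc k). l ^ (h + k) * l ^ (h + Suc k))"
      using degree NX by (intro sum_mono mult_mono) (simp_all del: power_Suc add_Suc_right)
    also have "\<dots> = card (N (Suc k)) * (l ^ (h + k) * l ^ (h + Suc k))" by simp
    finally have "real (card (PE k)) \<le> real (card (N (Suc k))) * (?l ^ (h + k) * ?l ^ (h + Suc k))"
      by (metis of_nat_le_iff of_nat_mult of_nat_power)
    also have "\<dots> \<le> A * ?l ^ (h + Suc k) * (?l ^ (h + k) * ?l ^ (h + Suc k))"
      using cardN[of "Suc k"] by (rule mult_right_mono) simp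
    also have "\<dots> = A * ?l ^ ((h + Suc k) + ((h + k) + (h + Suc k)))" by (simp only: power_add mult.assoc)
    also have "(h + Suc k) + ((h + k) + (h + Suc k)) = 3 * (h + k) + 2" by simp
    finally show ?thesis .
  qed

  let ?e = "exp (- (\<epsilon>\<^sup>2 * d / 16))"
  let ?B = "A * ?l ^ (3 * h + 3)"
  have B: "0 \<le> ?B" using A by simp
  let ?Z = "\<lambda>\<omega>. real (card {i \<in> PZ. case i of (x, y) \<Rightarrow> v \<omega> x y \<le> 0})"
  let ?D = "\<lambda>\<omega>. real (card {i \<in> PC 0. case i of (p, q) \<Rightarrow> v \<omega> p q \<le> (1 - \<epsilon> / 2) * w p q})"
  let ?C = "\<lambda>k \<omega>. real (card {i \<in> PC (Suc k). case i of (p, q) \<Rightarrow> v \<omega> p q \<le> 1 / 8 * (3 / 4) ^ k * w p q})"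
  let ?X = "\<lambda>k \<omega>. real (card {i \<in> PE k. case i of (u, p, q) \<Rightarrow> 4 * \<delta> * r * (3 / 4) ^ k \<le> v \<omega> u p})"
  define Y where "Y \<omega> = ?Z \<omega> + ?D \<omega> + (\<Sum>k<K. ?C k \<omega>) + 2 * (\<Sum>k<K. ?X k \<omega>)" for \<omega>

  have Z: "integrable M ?Z" "expectation ?Z \<le> real (card PZ) * 0"
  proof -
    have 1: "{\<omega> \<in> space M. case i of (x, y) \<Rightarrow> v \<omega> x y \<le> 0} \<in> events" if "i \<in> PZ" for i
      using that sublevel_event by (auto simp: PZ_def)
    have 2: "prob {\<omega> \<in> space M. case i of (x, y) \<Rightarrow> v \<omega> x y \<le> 0} \<le> 0" if iP: "i \<in> PZ" for i
    proof -
      obtain x y where i: "i = (x, y)" "x \<in> X" "y \<in> X" "0 < w x y" using iP by (auto simp: PZ_def)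
      then have "x \<noteq> y" using orig.refl by auto
      with small[of x y 0] i d_pos show ?thesis by (simp add: zero_power)
    qed
    show "integrable M ?Z" by (rule expected_count_le(1)[OF finP(1) 1 2])
    show "expectation ?Z \<le> real (card PZ) * 0" by (rule expected_count_le(2)[OF finP(1) 1 2])
  qed
  have C0: "integrable M ?D" "expectation ?D \<le> real (card (PC 0)) * ?e"
  proof -
    have 1: "{\<omega> \<in> space M. case i of (p, q) \<Rightarrow> v \<omega> p q \<le> (1 - \<epsilon> / 2) * w p q} \<in> events" if "i \<in> PC 0" for i
      using that sublevel_event NX by (auto simp: PC_def)
    have 2: "prob {\<omega> \<in> space M. case i of (p, q) \<Rightarrow> v \<omega> p q \<le> (1 - \<epsilon> / 2) * w p q} \<le> ?e" if iP: "i \<in> PC 0" for i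
    proof -
      obtain x y where i: "i = (x, y)" "x \<in> X" "y \<in> X" "0 < w x y" using iP NX by (auto simp: PC_def)
      then have "x \<noteq> y" using orig.refl by auto
      with contracted[of x y "\<epsilon> / 2"] i \<epsilon> show ?thesis by (simp add: power_divide)
    qed
    show "integrable M ?D" by (rule expected_count_le(1)[OF finP(2) 1 2])
    show "expectation ?D \<le> real (card (PC 0)) * ?e" by (rule expected_count_le(2)[OF finP(2) 1 2])
  qed
  have C: "integrable M (?C k)" "expectation (?C k) \<le> real (card (PC (Suc k))) * (1 / 4 * (3 / 4) ^ k) ^ d" for k
  proof -
    have 1: "{\<omega> \<in> space M. case i of (p, q) \<Rightarrow> v \<omega> p q \<le> 1 / 8 * (3 / 4) ^ k * w p q} \<in> events"
      if iP: "i \<in> PC (Suc k)" for i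
    proof -
      obtain x y where i: "i = (x, y)" "x \<in> X" "y \<in> X" using iP NX by (auto simp: PC_def)
      show ?thesis unfolding i(1) prod.case by (rule sublevel_event[OF i(2,3)])
    qed
    have 2: "prob {\<omega> \<in> space M. case i of (p, q) \<Rightarrow> v \<omega> p q \<le> 1 / 8 * (3 / 4) ^ k * w p q} \<le> (1 / 4 * (3 / 4) ^ k) ^ d"
      if iP: "i \<in> PC (Suc k)" for i
    proof -
      obtain x y where i: "i = (x, y)" "x \<in> X" "y \<in> X" "0 < w x y" using iP NX by (auto simp: PC_def)
      then have "x \<noteq> y" using orig.refl by auto
      with small[of x y "1 / 8 * (3 / 4) ^ k"] i show ?thesis by simp
    qed
    show "integrable M (?C k)" by (rule expected_count_le(1)[OF finP(2) 1 2])
    show "expectation (?C k) \<le> real (card (PC (Suc k))) * (1 / 4 * (3 / 4) ^ k) ^ d"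
      by (rule expected_count_le(2)[OF finP(2) 1 2])
  qed
  have Xk: "integrable M (?X k)" "expectation (?X k) \<le> real (card (PE k)) * (1 / (2 * (3 / 2) ^ k)) ^ d" for k
  proof -
    \<comment> \<open>The expansion factor: allowance \<open>4 * \<delta> * r * (3 / 4) ^ k\<close>
      over original length at most \<open>2 * (\<delta> * r / 2 ^ k)\<close>.\<close>
    let ?s = "2 * (3 / 2 :: real) ^ k"
    have 1: "{\<omega> \<in> space M. case i of (u, p, q) \<Rightarrow> 4 * \<delta> * r * (3 / 4) ^ k \<le> v \<omega> u p} \<in> events"
      if "i \<in> PE k" for i
      using that superlevel_event NX by (auto simp: PE_def)
    have 2: "prob {\<omega> \<in> space M. case i of (u, p, q) \<Rightarrow> 4 * \<delta> * r * (3 / 4) ^ k \<le> v \<omega> u p} \<le> (1 / ?s) ^ d"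
      if iP: "i \<in> PE k" for i
    proof -
      obtain u p q where i: "i = (u, p, q)" "u \<in> X" "p \<in> X" "w u p \<le> 2 * (\<delta> * r / 2 ^ k)"
        using iP NX by (auto simp: PE_def)
      have pos: "0 < 4 * \<delta> * r * (3 / 4) ^ k" using \<delta> r by simp
      show ?thesis
      proof (cases "u = p")
        case True
        then have none: "{\<omega> \<in> space M. case i of (u, p, q) \<Rightarrow> 4 * \<delta> * r * (3 / 4) ^ k \<le> v \<omega> u p} = {}"
          using pos i H.img.refl by auto
        show ?thesis unfolding none by simp
      next
        case False
        have "?s * w u p \<le> ?s * (2 * (\<delta> * r / 2 ^ k))" using i(4) by (intro mult_left_mono) auto
        also have "\<dots> = 4 * \<delta> * r * (3 / 4) ^ k"
          by (simp add: power_divide field_simps power_mult_distrib[symmetric])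
        finally have le: "?s * w u p \<le> 4 * \<delta> * r * (3 / 4) ^ k" .
        have "prob {\<omega> \<in> space M. 4 * \<delta> * r * (3 / 4) ^ k \<le> v \<omega> u p}
            \<le> prob {\<omega> \<in> space M. ?s * w u p \<le> v \<omega> u p}"
          using order_trans[OF le] superlevel_event[OF i(2,3)] by (intro finite_measure_mono subsetI) blast+
        also have "\<dots> \<le> (1 / ?s) ^ d" using i False by (intro expanded) auto
        finally show ?thesis using i(1) by simp
      qed
    qed
    show "integrable M (?X k)" by (rule expected_count_le(1)[OF finP(3) 1 2])
    show "expectation (?X k) \<le> real (card (PE k)) * (1 / ?s) ^ d"
      by (rule expected_count_le(2)[OF finP(3) 1 2])
  qed

  \<comment> \<open>All families are to be paid with one exponential; the extreme events cost at
    most \<open>(1 / 2) ^ d\<close>, which is smaller because \<epsilon> is at most 1.\<close>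
  have half: "(1 / 2 :: real) ^ d \<le> ?e"
  proof -
    have "\<epsilon>\<^sup>2 \<le> 1" using \<epsilon> by (simp add: power_le_one)
    then have "\<epsilon>\<^sup>2 * d \<le> 1 * real d" by (intro mult_right_mono) auto
    then have "- (real d / 16) \<le> - (\<epsilon>\<^sup>2 * d / 16)" by simp
    then have "exp (- (1 / 16 :: real)) ^ d \<le> ?e" by (simp add: exp_of_nat_mult[symmetric])
    moreover have "(1 / 2 :: real) ^ d \<le> exp (- (1 / 16)) ^ d"
      using exp_ge_add_one_self[of "- (1 / 16) :: real"] by (intro power_mono) auto
    ultimately show ?thesis by linarith
  qed
  \<comment> \<open>The growth of the net families from level to level is beaten by the growing
    rarity of the events, leaving a geometric series in \<open>k\<close>.\<close>
  have decay: "?l ^ (3 * k) * ((3 / 4) ^ k) ^ d \<le> (1 / 2) ^ k" for k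
  proof -
    have "((3 / 4 :: real) ^ k) ^ d = ((3 / 4) ^ d) ^ k" by (metis mult.commute power_mult)
    then have "?l ^ (3 * k) * ((3 / 4) ^ k) ^ d = (?l ^ 3 * (3 / 4) ^ d) ^ k"
      by (simp only: power_mult power_mult_distrib)
    also have "\<dots> \<le> (1 / 2) ^ k" using ld by (intro power_mono) auto
    finally show ?thesis .
  qed
  have b0: "expectation ?D \<le> ?B * ?e"
  proof -
    have "expectation ?D \<le> A * ?l ^ (2 * (h + 0)) * ?e"
      by (rule order_trans[OF C0(2) mult_right_mono[OF cardPC]]) auto
    also have "\<dots> \<le> ?B * ?e"
      using A l by (intro mult_right_mono mult_left_mono power_increasing) auto
    finally show ?thesis .
  qed
  have b1: "expectation (?C k) \<le> ?B * ?e * (1 / 2) ^ k" for k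
  proof -
    have "expectation (?C k) \<le> A * ?l ^ (2 * (h + Suc k)) * (1 / 4 * (3 / 4) ^ k) ^ d"
      by (rule order_trans[OF C(2) mult_right_mono[OF cardPC]]) auto
    also have "\<dots> \<le> A * ?l ^ (3 * h + 3 + 3 * k) * (1 / 4 * (3 / 4) ^ k) ^ d"
      using A l by (intro mult_right_mono mult_left_mono power_increasing) auto
    also have "\<dots> = ?B * (1 / 4) ^ d * (?l ^ (3 * k) * ((3 / 4) ^ k) ^ d)"
      by (simp only: power_add power_mult_distrib) (simp only: mult_ac)
    also have "\<dots> \<le> ?B * ?e * (1 / 2) ^ k"
    proof (intro mult_mono decay mult_left_mono)
      have "(1 / 4 :: real) ^ d \<le> (1 / 2) ^ d" by (intro power_mono) auto
      with half show "(1 / 4 :: real) ^ d \<le> ?e" by linarith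
    qed (use A B in auto)
    finally show ?thesis .
  qed
  have b2: "expectation (?X k) \<le> ?B * ?e * (1 / 2) ^ k" for k
  proof -
    have "expectation (?X k) \<le> A * ?l ^ (3 * (h + k) + 2) * (1 / (2 * (3 / 2) ^ k)) ^ d"
      by (rule order_trans[OF Xk(2) mult_right_mono[OF cardPE]]) auto
    also have "\<dots> \<le> A * ?l ^ (3 * h + 3 + 3 * k) * (1 / 2 * (3 / 4) ^ k) ^ d"
    proof (intro mult_mono mult_left_mono power_increasing power_mono A)
      have "1 / (2 * (3 / 2 :: real) ^ k) = 1 / 2 * (2 / 3) ^ k" by (simp add: power_divide)
      also have "\<dots> \<le> 1 / 2 * (3 / 4) ^ k" by (intro mult_left_mono power_mono) auto
      finally show "1 / (2 * (3 / 2 :: real) ^ k) \<le> 1 / 2 * (3 / 4) ^ k" .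
    qed (use A l in auto)
    also have "\<dots> = ?B * (1 / 2) ^ d * (?l ^ (3 * k) * ((3 / 4) ^ k) ^ d)"
      by (simp only: power_add power_mult_distrib) (simp only: mult_ac)
    also have "\<dots> \<le> ?B * ?e * (1 / 2) ^ k"
      using A B half by (intro mult_mono decay mult_left_mono) auto
    finally show ?thesis .
  qed
  have geo: "(\<Sum>k<K. ?B * ?e * (1 / 2) ^ k) \<le> 2 * (?B * ?e)"
  proof -
    have "(\<Sum>k<K. (1 / 2 :: real) ^ k) \<le> 2" by (simp add: geometric_sum)
    then have "?B * ?e * (\<Sum>k<K. (1 / 2 :: real) ^ k) \<le> ?B * ?e * 2" using B by (intro mult_left_mono) auto
    then show ?thesis unfolding sum_distrib_left[symmetric] by (simp only: mult.commute[of _ 2])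
  qed
  have "integrable M Y"
    unfolding Y_def using Z(1) C0(1) C(1) Xk(1) by (intro Bochner_Integration.integrable_add Bochner_Integration.integrable_sum
      integrable_mult_right)
  \<comment> \<open>The 7 is 1 for level 0, 2 for the contracted pairs and 2 times 2 for the
    expanded triples.\<close>
  moreover have "expectation Y \<le> A * (7 * ?l ^ (3 * h + 3) * ?e)"
  proof -
    have "expectation Y = expectation ?Z + expectation ?D + (\<Sum>k<K. expectation (?C k)) + 2 * (\<Sum>k<K. expectation (?X k))"
      unfolding Y_def using Z(1) C0(1) C(1) Xk(1)
      by (simp only: Bochner_Integration.integral_add Bochner_Integration.integral_sum integral_mult_right_zero
        Bochner_Integration.integrable_add Bochner_Integration.integrable_sum integrable_mult_right)
    also have "\<dots> \<le> 0 + ?B * ?e + (\<Sum>k<K. ?B * ?e * (1 / 2) ^ k) + 2 * (\<Sum>k<K. ?B * ?e * (1 / 2) ^ k)"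
      using Z(2) b0 b1 b2 by (intro add_mono mult_left_mono sum_mono) auto
    also have "\<dots> \<le> 7 * (?B * ?e)" using geo by linarith
    finally show ?thesis by (simp add: mult_ac)
  qed
  moreover have "0 \<le> Y \<omega>" for \<omega> unfolding Y_def by (intro add_nonneg_nonneg mult_nonneg_nonneg sum_nonneg) auto
  moreover have "real (card {(x, y) \<in> T. r < w x y \<and> w x y \<le> 2 * r \<and> v \<omega> x y < (1 - \<epsilon>) * w x y}) \<le> Y \<omega>"
    if T: "min_tree X (v \<omega>) T" for \<omega> T
  proof -
    have "H.collapsed_pairs \<omega> = {i \<in> PZ. case i of (x, y) \<Rightarrow> v \<omega> x y \<le> 0}"
      by (auto simp: H.collapsed_pairs_def PZ_def)
    moreover have "H.contracted_pairs \<omega> k \<tau> = {i \<in> PC k. case i of (p, q) \<Rightarrow> v \<omega> p q \<le> \<tau> * w p q}" for k \<tau>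
      by (auto simp: H.contracted_pairs_def PC_def)
    moreover have "H.expanded_triples \<omega> k = {i \<in> PE k. case i of (u, p, q) \<Rightarrow> 4 * \<delta> * r * (3 / 4) ^ k \<le> v \<omega> u p}" for k
      by (auto simp: H.expanded_triples_def PE_def)
    moreover have "H.bad \<omega> T = {(x, y) \<in> T. r < w x y \<and> w x y \<le> 2 * r \<and> v \<omega> x y < (1 - \<epsilon>) * w x y}"
      by (simp add: H.bad_def)
    ultimately show ?thesis
      using of_nat_mono[OF H.card_bad_le[OF T], where 'a = real] unfolding Y_def by simp
  qed
  ultimately show ?thesis unfolding A_def by blast
qed

text \<open>Dyadic decomposition by original length, from the diameter bound downwards. Edges below
  the last scale are simply counted by the number of all pairs, which is affordable since
  \<open>L\<close> is only logarithmic in that number.\<close>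

lemma bad_cost_le:
  assumes T: "T \<subseteq> X \<times> X" and M\<^sub>0: "0 < M\<^sub>0" "\<And>x y. x \<in> X \<Longrightarrow> y \<in> X \<Longrightarrow> w x y \<le> M\<^sub>0"
  shows "(\<Sum>(x, y)\<in>{(x, y) \<in> T. u x y < (1 - \<epsilon>) * w x y}. w x y) \<le>
    (real (card X))\<^sup>2 * (M\<^sub>0 / 2 ^ L) +
    (\<Sum>t\<in>{1..L}. 2 * (M\<^sub>0 / 2 ^ t) *
      card {(x, y) \<in> T. M\<^sub>0 / 2 ^ t < w x y \<and> w x y \<le> 2 * (M\<^sub>0 / 2 ^ t) \<and> u x y < (1 - \<epsilon>) * w x y})"
proof -
  define r where "r t = M\<^sub>0 / 2 ^ t" for t
  define S where "S t = {(x, y) \<in> T. r t < w x y \<and> w x y \<le> 2 * r t \<and> u x y < (1 - \<epsilon>) * w x y}" for t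
  let ?B = "{(x, y) \<in> T. u x y < (1 - \<epsilon>) * w x y}"
  have finT: "finite T" using T finX by (meson finite_SigmaI finite_subset)
  then have fin: "finite ?B" by (rule rev_finite_subset) auto
  have r: "0 < r t" for t using M\<^sub>0(1) by (simp add: r_def)
  have edge: "w x y \<le> r L + (\<Sum>t\<in>{1..L}. if (x, y) \<in> S t then 2 * r t else 0)" if e: "(x, y) \<in> ?B" for x y
  proof (cases "w x y \<le> r L")
    case True
    have "0 \<le> (\<Sum>t\<in>{1..L}. if (x, y) \<in> S t then 2 * r t else 0)"
      using r by (intro sum_nonneg) (auto intro: less_imp_le)
    with True show ?thesis by linarith
  next
    case False
    \<comment> \<open>The first scale below the edge length. It is not 0, because no edge is longer
      than \<open>M\<^sub>0\<close>, and so the previous scale bounds the length by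
      \<open>2 * r t\<close>.\<close>
    define t where "t = (LEAST t. r t < w x y)"
    have rL: "r L < w x y" using False by simp
    have t: "r t < w x y" "t \<le> L" unfolding t_def by (rule LeastI[of _ L], rule rL) (rule Least_le, rule rL)
    have "w x y \<le> r 0" using M\<^sub>0(2) e T by (auto simp: r_def)
    then have "t \<noteq> 0" using t(1) by (metis not_le)
    then obtain j where j: "t = Suc j" by (cases t) auto
    have "\<not> r j < w x y" using not_less_Least[of j "\<lambda>t. r t < w x y"] j by (simp add: t_def)
    moreover have "r j = 2 * r t" by (simp add: r_def j)
    ultimately have "(x, y) \<in> S t" using e t by (auto simp: S_def)
    then have "w x y \<le> (if (x, y) \<in> S t then 2 * r t else 0)" by (auto simp: S_def)
    also have "\<dots> \<le> (\<Sum>t\<in>{1..L}. if (x, y) \<in> S t then 2 * r t else 0)"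
      by (rule member_le_sum[where f = "\<lambda>t. if (x, y) \<in> S t then 2 * r t else 0"]) (use t(2) j r in \<open>auto intro: less_imp_le\<close>)
    finally show ?thesis using r[of L] by linarith
  qed
  have "(\<Sum>(x, y)\<in>?B. w x y) \<le> (\<Sum>e\<in>?B. r L + (\<Sum>t\<in>{1..L}. if e \<in> S t then 2 * r t else 0))"
    using edge by (intro sum_mono) auto
  also have "\<dots> = card ?B * r L + (\<Sum>t\<in>{1..L}. \<Sum>e\<in>?B. if e \<in> S t then 2 * r t else 0)"
    by (simp add: sum.distrib sum.swap[of _ ?B])
  also have "(\<Sum>t\<in>{1..L}. \<Sum>e\<in>?B. if e \<in> S t then 2 * r t else 0) = (\<Sum>t\<in>{1..L}. 2 * r t * card (S t))"
  proof (rule sum.cong)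
    fix t
    have "?B \<inter> S t = S t" by (auto simp: S_def)
    then show "(\<Sum>e\<in>?B. if e \<in> S t then 2 * r t else 0) = 2 * r t * card (S t)"
      using fin by (simp add: sum.inter_restrict[symmetric])
  qed simp
  also have "card ?B * r L \<le> (real (card X))\<^sup>2 * r L"
  proof (rule mult_right_mono)
    have "card ?B \<le> card (X \<times> X)" using T finX by (intro card_mono) auto
    then show "real (card ?B) \<le> (real (card X))\<^sup>2"
      unfolding card_cartesian_product power2_eq_square of_nat_mult[symmetric] by (rule of_nat_mono)
  qed (use r[of L] in simp)
  finally show ?thesis by (simp add: r_def S_def)
qed

text \<open>One event serves both claims: the deviations on the original tree and the majorants for
  the bad edges are small together. Outside the bad edges the projected tree is almost as long as in
  the original space.\<close>

lemma good_event:
  assumes T\<^sub>0: "min_tree X w T\<^sub>0" and X2: "2 \<le> card X" and \<epsilon>: "0 < \<epsilon>" "\<epsilon> \<le> 1"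
    and l2: "2 \<le> l" and ld: "real l ^ 3 * (3 / 4) ^ d \<le> 1 / 2"
    and d: "16 / sqrt d \<le> \<epsilon> / 320" and h: "8 / 2 ^ h \<le> \<epsilon> / 32768"
    and L: "(real (card X))\<^sup>2 / 2 ^ L \<le> \<epsilon> / 16"
    and rare: "14 * real L * real l ^ (3 * h + 3) * exp (- (\<epsilon>\<^sup>2 * d / 256)) \<le> \<epsilon> / 320"
  defines "M\<^sub>0 \<equiv> edge_cost w T\<^sub>0"
  shows "\<exists>G\<in>events. 9 / 10 \<le> prob G \<and> (\<forall>\<omega>\<in>G. \<forall>T. min_tree X (v \<omega>) T \<longrightarrow>
     edge_cost (v \<omega>) T \<in> {(1 - \<epsilon>) * M\<^sub>0..(1 + \<epsilon>) * M\<^sub>0} \<and> edge_cost w T \<in> {M\<^sub>0..(1 + \<epsilon>) * M\<^sub>0})"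
proof -
  have st: "is_spanning_tree X T\<^sub>0" using T\<^sub>0 by (simp add: min_tree_def)
  then have T0X: "T\<^sub>0 \<subseteq> X \<times> X" and T0c: "\<And>x y. x \<in> X \<Longrightarrow> y \<in> X \<Longrightarrow> (x, y) \<in> reach T\<^sub>0"
    by (auto simp: is_spanning_tree_def)
  have finT0: "finite T\<^sub>0" using T0X finX by (meson finite_SigmaI finite_subset)
  have diam: "w x y \<le> M\<^sub>0" if "x \<in> X" "y \<in> X" for x y
    unfolding M\<^sub>0_def using that T0X T0c finT0 by (intro orig.connected_cost_ge_dist) auto
  obtain x\<^sub>0 y\<^sub>0 where "x\<^sub>0 \<in> X" "y\<^sub>0 \<in> X" "x\<^sub>0 \<noteq> y\<^sub>0"
    using X2 card_le_Suc0_iff_eq[OF finX] by (metis not_less_eq_eq numeral_2_eq_2)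
  then have M0: "0 < M\<^sub>0" using w_pos diam by (meson less_le_trans)
  define r where "r t = M\<^sub>0 / 2 ^ t" for t :: nat
  have r: "0 < r t" "r t \<le> M\<^sub>0" for t
  proof -
    show "0 < r t" using M0 by (simp add: r_def)
    have "M\<^sub>0 * 1 \<le> M\<^sub>0 * 2 ^ t" using M0 by (intro mult_left_mono) auto
    then show "r t \<le> M\<^sub>0" by (simp add: r_def field_simps)
  qed
  let ?e = "exp (- (\<epsilon>\<^sup>2 * d / 256))"
  let ?b = "7 * real l ^ (3 * h + 3) * ?e"
  let ?bad = "\<lambda>t \<omega> T. {(x, y) \<in> T. r t < w x y \<and> w x y \<le> 2 * r t \<and> v \<omega> x y < (1 - \<epsilon> / 4) * w x y}"
  have "\<forall>t. \<exists>Y. integrable M Y \<and> (\<forall>\<omega>. 0 \<le> Y \<omega>) \<and> expectation Y \<le> M\<^sub>0 / r t * ?b \<and>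
     (\<forall>\<omega> T. min_tree X (v \<omega>) T \<longrightarrow> real (card (?bad t \<omega> T)) \<le> Y \<omega>)"
  proof
    fix t
    \<comment> \<open>Contraction is tested at \<open>\<epsilon> / 4\<close>; hence 32768 instead of
      8192 and 256 instead of 16.\<close>
    have "8 / 2 ^ h \<le> \<epsilon> / 4 / 8192" using h by simp
    from scale_bound[OF st r(1) r(2)[unfolded M\<^sub>0_def] _ _ this l2 ld, of t] \<epsilon>
    show "\<exists>Y. integrable M Y \<and> (\<forall>\<omega>. 0 \<le> Y \<omega>) \<and> expectation Y \<le> M\<^sub>0 / r t * ?b \<and>
     (\<forall>\<omega> T. min_tree X (v \<omega>) T \<longrightarrow> real (card (?bad t \<omega> T)) \<le> Y \<omega>)"
      by (simp add: M\<^sub>0_def power_divide)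
  qed
  from choice[OF this] obtain Y where Y: "\<And>t. integrable M (Y t)" "\<And>t \<omega>. 0 \<le> Y t \<omega>"
    "\<And>t. expectation (Y t) \<le> M\<^sub>0 / r t * ?b"
    "\<And>t \<omega> T. min_tree X (v \<omega>) T \<Longrightarrow> real (card (?bad t \<omega> T)) \<le> Y t \<omega>" by blast
  define U where "U \<omega> = (\<Sum>(x, y)\<in>T\<^sub>0. \<bar>v \<omega> x y - w x y\<bar>)" for \<omega>
  define B where "B \<omega> = (\<Sum>t\<in>{1..L}. 2 * r t * Y t \<omega>)" for \<omega>
  have dev: "integrable M (\<lambda>\<omega>. \<bar>v \<omega> x y - w x y\<bar>)" "expectation (\<lambda>\<omega>. \<bar>v \<omega> x y - w x y\<bar>) \<le> 16 / sqrt d * w x y"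
    if xy: "x \<in> X" "y \<in> X" for x y
  proof -
    have [measurable]: "(\<lambda>\<omega>. v \<omega> x y) \<in> borel_measurable M" by (rule v_measurable[OF xy])
    show i: "integrable M (\<lambda>\<omega>. \<bar>v \<omega> x y - w x y\<bar>)"
      using deviation[OF xy] by (intro integrableI_bounded) (auto simp: le_less_trans)
    have "ennreal (expectation (\<lambda>\<omega>. \<bar>v \<omega> x y - w x y\<bar>)) \<le> ennreal (16 / sqrt d * w x y)"
      using deviation[OF xy] by (subst nn_integral_eq_integral[OF i, symmetric]) auto
    then show "expectation (\<lambda>\<omega>. \<bar>v \<omega> x y - w x y\<bar>) \<le> 16 / sqrt d * w x y"
      using orig.nonneg[OF xy] by (subst (asm) ennreal_le_iff) auto
  qed
  have Uint: "integrable M U" unfolding U_def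
    using dev(1) T0X by (intro Bochner_Integration.integrable_sum) auto
  have Ule: "expectation U \<le> \<epsilon> / 320 * M\<^sub>0"
  proof -
    have "expectation U = (\<Sum>(x, y)\<in>T\<^sub>0. expectation (\<lambda>\<omega>. \<bar>v \<omega> x y - w x y\<bar>))"
      unfolding U_def using dev(1) T0X by (subst Bochner_Integration.integral_sum) (auto intro!: sum.cong)
    also have "\<dots> \<le> (\<Sum>(x, y)\<in>T\<^sub>0. 16 / sqrt d * w x y)"
      using dev(2) T0X by (intro sum_mono) auto
    also have "\<dots> = 16 / sqrt d * M\<^sub>0"
      unfolding M\<^sub>0_def edge_cost_def by (simp add: sum_distrib_left case_prod_unfold)
    also have "\<dots> \<le> \<epsilon> / 320 * M\<^sub>0" using d M0 by (intro mult_right_mono) auto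
    finally show ?thesis .
  qed
  have Bint: "integrable M B" unfolding B_def
    using Y(1) by (intro Bochner_Integration.integrable_sum integrable_mult_right)
  have Ble: "expectation B \<le> \<epsilon> / 320 * M\<^sub>0"
  proof -
    have "expectation B = (\<Sum>t\<in>{1..L}. 2 * r t * expectation (Y t))"
      unfolding B_def using Y(1) by (subst Bochner_Integration.integral_sum) auto
    also have "\<dots> \<le> (\<Sum>t\<in>{1..L}. 2 * r t * (M\<^sub>0 / r t * ?b))"
      using Y(3) r by (intro sum_mono mult_left_mono) (auto intro: less_imp_le)
    \<comment> \<open>The scale cancels, so every scale contributes equally and the total is
      proportional to \<open>L\<close>.\<close>
    also have "\<dots> = (\<Sum>t\<in>{1..L}. M\<^sub>0 * (2 * ?b))"
      using r by (intro sum.cong) (auto simp: less_imp_neq[THEN not_sym])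
    also have "\<dots> = (14 * real L * real l ^ (3 * h + 3) * ?e) * M\<^sub>0" by simp
    also have "\<dots> \<le> \<epsilon> / 320 * M\<^sub>0" using rare M0 by (intro mult_right_mono) auto
    finally show ?thesis .
  qed
  \<comment> \<open>Ten times the bound for the sum of the two expectations, so that Markov's
    inequality fails with probability at most 1/10.\<close>
  let ?a = "\<epsilon> / 16 * M\<^sub>0"
  have a: "0 < ?a" using \<epsilon> M0 by simp
  have UB: "0 \<le> U \<omega>" "0 \<le> B \<omega>" for \<omega>
    unfolding U_def B_def using Y(2) r(1)[THEN less_imp_le] by (auto intro!: sum_nonneg mult_nonneg_nonneg)
  have meas[measurable]: "U \<in> borel_measurable M" "B \<in> borel_measurable M" using Uint Bint by auto
  define G where "G = {\<omega> \<in> space M. U \<omega> + B \<omega> < ?a}"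
  have GM: "G \<in> events" unfolding G_def by measurable
  have "prob {\<omega> \<in> space M. ?a \<le> U \<omega> + B \<omega>} \<le> expectation (\<lambda>\<omega>. U \<omega> + B \<omega>) / ?a"
    using integral_Markov_inequality_measure[of M "\<lambda>\<omega>. U \<omega> + B \<omega>" "space M" ?a] Uint Bint UB a
    by (simp add: conj_commute)
  also have "\<dots> \<le> (\<epsilon> / 160 * M\<^sub>0) / ?a"
    using Uint Bint Ule Ble a by (intro divide_right_mono) auto
  also have "\<dots> = 1 / 10" using \<epsilon> M0 by simp
  finally have "prob {\<omega> \<in> space M. ?a \<le> U \<omega> + B \<omega>} \<le> 1 / 10" .
  moreover have "prob {\<omega> \<in> space M. ?a \<le> U \<omega> + B \<omega>} = 1 - prob G"
  proof -
    have "{\<omega> \<in> space M. ?a \<le> U \<omega> + B \<omega>} = space M - G" by (auto simp: G_def)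
    then show ?thesis using prob_compl[OF GM] by simp
  qed
  ultimately have "9 / 10 \<le> prob G" by simp
  moreover have "edge_cost (v \<omega>) T \<in> {(1 - \<epsilon>) * M\<^sub>0..(1 + \<epsilon>) * M\<^sub>0} \<and> edge_cost w T \<in> {M\<^sub>0..(1 + \<epsilon>) * M\<^sub>0}"
    if \<omega>: "\<omega> \<in> G" and T: "min_tree X (v \<omega>) T" for \<omega> T
  proof -
    interpret img: pseudometric_on X "v \<omega>" by (rule v_pseudometric)
    have sT: "is_spanning_tree X T" using T by (simp add: min_tree_def)
    then have TX: "T \<subseteq> X \<times> X" by (auto simp: is_spanning_tree_def)
    have finT: "finite T" using TX finX by (meson finite_SigmaI finite_subset)
    have small: "U \<omega> < ?a" "B \<omega> < ?a" using \<omega> UB[of \<omega>] unfolding G_def by auto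
    have "edge_cost (v \<omega>) T \<le> edge_cost (v \<omega>) T\<^sub>0" using T st by (auto simp: min_tree_def)
    also have "\<dots> \<le> M\<^sub>0 + U \<omega>"
      unfolding M\<^sub>0_def U_def edge_cost_def sum.distrib[symmetric] by (intro sum_mono) auto
    finally have up: "edge_cost (v \<omega>) T \<le> M\<^sub>0 + ?a" using small by linarith
    have low: "M\<^sub>0 \<le> edge_cost w T" using T\<^sub>0 sT by (auto simp: min_tree_def M\<^sub>0_def)
    let ?bd = "{(x, y) \<in> T. v \<omega> x y < (1 - \<epsilon> / 4) * w x y}"
    have "(\<Sum>(x, y)\<in>?bd. w x y) \<le> (real (card X))\<^sup>2 * (M\<^sub>0 / 2 ^ L) + (\<Sum>t\<in>{1..L}. 2 * r t * card (?bad t \<omega> T))"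
      using bad_cost_le[OF TX M0 diam, of "v \<omega>" "\<epsilon> / 4" L] by (simp add: r_def)
    also have "(\<Sum>t\<in>{1..L}. 2 * r t * card (?bad t \<omega> T)) \<le> B \<omega>"
      unfolding B_def using Y(4)[OF T] r by (intro sum_mono mult_left_mono) (auto intro: less_imp_le)
    also have "(real (card X))\<^sup>2 * (M\<^sub>0 / 2 ^ L) \<le> ?a"
      using mult_right_mono[OF L, of M\<^sub>0] M0 by (simp add: mult.commute)
    \<comment> \<open>One \<open>?a\<close> covers the edges below the last scale, the other the sum
      over the dyadic scales.\<close>
    finally have bd: "(\<Sum>(x, y)\<in>?bd. w x y) \<le> 2 * ?a" using small by linarith
    have "(1 - \<epsilon> / 4) * edge_cost w T = (\<Sum>(x, y)\<in>T. (1 - \<epsilon> / 4) * w x y)"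
      unfolding edge_cost_def by (simp add: sum_distrib_left case_prod_unfold)
    also have "\<dots> \<le> (\<Sum>e\<in>T. v \<omega> (fst e) (snd e) + (if e \<in> ?bd then w (fst e) (snd e) else 0))"
    proof (rule sum_mono, clarify)
      fix x y assume "(x, y) \<in> T"
      then have "x \<in> X" "y \<in> X" using TX by auto
      then have "0 \<le> v \<omega> x y" "0 \<le> \<epsilon> * w x y" using img.nonneg orig.nonneg \<epsilon> by auto
      then show "(1 - \<epsilon> / 4) * w x y \<le> v \<omega> (fst (x, y)) (snd (x, y)) + (if (x, y) \<in> ?bd then w (fst (x, y)) (snd (x, y)) else 0)"
        using \<open>(x, y) \<in> T\<close> by (auto simp: algebra_simps)
    qed
    also have "\<dots> = edge_cost (v \<omega>) T + (\<Sum>(x, y)\<in>?bd. w x y)"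
    proof -
      have "T \<inter> ?bd = ?bd" by auto
      then have "(\<Sum>e\<in>T. if e \<in> ?bd then w (fst e) (snd e) else 0) = (\<Sum>e\<in>?bd. w (fst e) (snd e))"
        using sum.inter_restrict[OF finT, of "\<lambda>e. w (fst e) (snd e)" ?bd] by simp
      then show ?thesis by (simp add: sum.distrib edge_cost_def case_prod_unfold)
    qed
    finally have key: "(1 - \<epsilon> / 4) * edge_cost w T \<le> edge_cost (v \<omega>) T + 2 * ?a" using bd by linarith
    have "(1 - \<epsilon> / 4) * M\<^sub>0 \<le> (1 - \<epsilon> / 4) * edge_cost w T" using low \<epsilon> by (intro mult_left_mono) auto
    with key have "(1 - \<epsilon> / 4) * M\<^sub>0 - 2 * ?a \<le> edge_cost (v \<omega>) T" by linarith
    moreover have "(1 - \<epsilon>) * M\<^sub>0 \<le> (1 - \<epsilon> / 4) * M\<^sub>0 - 2 * ?a"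
      using a by (simp add: algebra_simps)
    moreover have "M\<^sub>0 + ?a \<le> (1 + \<epsilon>) * M\<^sub>0" using a by (simp add: algebra_simps)
    moreover have "edge_cost w T \<le> (1 + \<epsilon>) * M\<^sub>0"
    proof -
      \<comment> \<open>Of the three sixteenths, one comes from the upper bound for the projected
        tree and two from its bad edges.\<close>
      have "(1 - \<epsilon> / 4) * edge_cost w T \<le> (1 + 3 * \<epsilon> / 16) * M\<^sub>0"
        using key up by (simp add: algebra_simps)
      also have "\<dots> \<le> ((1 - \<epsilon> / 4) * (1 + \<epsilon>)) * M\<^sub>0"
      proof (rule mult_right_mono)
        have "\<epsilon> * \<epsilon> \<le> 1 * \<epsilon>" using \<epsilon> by (intro mult_right_mono) auto
        moreover have "(1 - \<epsilon> / 4) * (1 + \<epsilon>) = 1 + \<epsilon> - \<epsilon> / 4 - \<epsilon> * \<epsilon> / 4" by (simp add: field_simps)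
        ultimately show "1 + 3 * \<epsilon> / 16 \<le> (1 - \<epsilon> / 4) * (1 + \<epsilon>)" using \<epsilon> by linarith
      qed (use M0 in simp)
      finally have "(1 - \<epsilon> / 4) * edge_cost w T \<le> (1 - \<epsilon> / 4) * ((1 + \<epsilon>) * M\<^sub>0)" by (simp only: mult.assoc)
      then show ?thesis by (rule mult_left_le_imp_le) (use \<epsilon> in simp)
    qed
    ultimately show ?thesis using up low by auto
  qed
  ultimately show ?thesis using GM by blast
qed

end

section \<open>Random projections of point sets\<close>

text \<open>A finite set has finitely many spanning trees, so quantifying over the random minimizers
  is harmless. Measurability matters: a nonmeasurable set has measure 0 by convention, and
  containing the good event would prove nothing.\<close>

lemma (in random_pseudometric) min_tree_event:
  assumes P: "\<And>T. is_spanning_tree X T \<Longrightarrow> {\<omega> \<in> space M. P \<omega> T} \<in> events"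
  shows "{\<omega> \<in> space M. \<forall>T. min_tree X (v \<omega>) T \<longrightarrow> P \<omega> T} \<in> events"
proof -
  define S where "S = {T. is_spanning_tree X T}"
  have "S \<subseteq> Pow (X \<times> X)" by (auto simp: S_def is_spanning_tree_def)
  then have fin: "finite S" using finX by (meson finite_Pow_iff finite_SigmaI finite_subset)
  have cost: "(\<lambda>\<omega>. edge_cost (v \<omega>) T) \<in> borel_measurable M" if "T \<in> S" for T
    unfolding edge_cost_def using that v_measurable
    by (intro borel_measurable_sum) (auto simp: S_def is_spanning_tree_def)
  have "{\<omega> \<in> space M. \<forall>T\<in>S. (\<forall>T'\<in>S. edge_cost (v \<omega>) T \<le> edge_cost (v \<omega>) T') \<longrightarrow> P \<omega> T} \<in> events"
    using P cost by (intro sets.sets_Collect_finite_All sets.sets_Collect_imp borel_measurable_le fin)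
      (auto simp: S_def)
  also have "{\<omega> \<in> space M. \<forall>T\<in>S. (\<forall>T'\<in>S. edge_cost (v \<omega>) T \<le> edge_cost (v \<omega>) T') \<longrightarrow> P \<omega> T}
    = {\<omega> \<in> space M. \<forall>T. min_tree X (v \<omega>) T \<longrightarrow> P \<omega> T}"
    by (auto simp: S_def min_tree_def)
  finally show ?thesis .
qed

section \<open>Euclidean distances and the projection as an instance\<close>

lemma is_mst_iff_min_tree: "is_mst X f T \<longleftrightarrow> min_tree X (\<lambda>x y. enorm (f x - f y)) T"
  by (simp add: is_mst_def min_tree_def tree_cost_def edge_cost_def)

lemma tree_cost_eq_edge_cost: "tree_cost f T = edge_cost (\<lambda>x y. enorm (f x - f y)) T"
  by (simp add: tree_cost_def edge_cost_def)

lemma enorm_nonneg: "0 \<le> enorm u"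
  by (simp add: enorm_def)

lemma enorm_power2: "(enorm u)\<^sup>2 = (\<Sum>j<dim_vec u. (u $ j)\<^sup>2)"
  by (simp add: enorm_def L2_set_def sum_nonneg)

lemma pseudometric_enorm:
  assumes f: "\<And>x. x \<in> X \<Longrightarrow> f x \<in> carrier_vec k"
  shows "pseudometric_on X (\<lambda>x y. enorm (f x - f y))"
proof -
  have eq: "enorm (f x - f y) = L2_set (\<lambda>i. f x $ i - f y $ i) {..<k}" if "x \<in> X" "y \<in> X" for x y
    using f[OF that(1)] f[OF that(2)] unfolding enorm_def by (intro L2_set_cong) auto
  show ?thesis
  proof
    fix x y z assume X: "x \<in> X" "y \<in> X" "z \<in> X"
    have "L2_set (\<lambda>i. (f x $ i - f y $ i) + (f y $ i - f z $ i)) {..<k} \<le>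
      L2_set (\<lambda>i. f x $ i - f y $ i) {..<k} + L2_set (\<lambda>i. f y $ i - f z $ i) {..<k}"
      by (rule L2_set_triangle_ineq)
    then show "enorm (f x - f z) \<le> enorm (f x - f y) + enorm (f y - f z)" using X by (simp add: eq)
  next
    fix x y assume X: "x \<in> X" "y \<in> X"
    show "enorm (f x - f y) = enorm (f y - f x)"
      using X by (simp add: eq L2_set_def power2_commute)
    show "0 \<le> enorm (f x - f y)" by (rule enorm_nonneg)
  next
    fix x assume "x \<in> X"
    then show "enorm (f x - f x) = 0" by (simp add: eq L2_set_def)
  qed
qed

lemma enorm_diff_pos:
  assumes "x \<in> carrier_vec m" "y \<in> carrier_vec m" "x \<noteq> y"
  shows "0 < enorm (x - y)"
proof -
  obtain j where j: "j < m" "x $ j \<noteq> y $ j" using assms by (metis carrier_vecD eq_vecI)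
  have "0 < ((x - y) $ j)\<^sup>2" using j assms by simp
  also have "\<dots> \<le> (enorm (x - y))\<^sup>2"
    unfolding enorm_power2 using j assms by (intro member_le_sum) auto
  finally show ?thesis using enorm_nonneg[of "x - y"] by (simp add: zero_less_power2 less_le)
qed

lemma proj_carrier: "proj d m \<omega> x \<in> carrier_vec d"
  by (rule carrier_vecI) (simp add: proj_def)

lemma proj_dist_power2:
  assumes "x \<in> carrier_vec m" "y \<in> carrier_vec m"
  shows "(enorm (proj d m \<omega> x - proj d m \<omega> y))\<^sup>2 = gaussian_form d m (\<lambda>j. (x - y) $ j) \<omega>"
proof -
  have p: "proj d m \<omega> z $ i = (\<Sum>j<m. \<omega> (i, j) * z $ j)" if "z \<in> carrier_vec m" "i < d" for z i
    using that by (simp add: proj_def scalar_prod_def atLeast0LessThan)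
  have dm: "dim_vec (proj d m \<omega> z) = d" for z by (simp add: proj_def)
  have "(proj d m \<omega> x - proj d m \<omega> y) $ i = (\<Sum>j<m. \<omega> (i, j) * (x - y) $ j)" if "i < d" for i
    using that assms by (simp add: p dm sum_subtractf[symmetric] right_diff_distrib)
  then show ?thesis
    unfolding enorm_power2 gaussian_form_def by (simp add: dm)
qed

text \<open>The least number is attained because a finite set covers each of its balls by taking all
  points as centres.\<close>

lemma doubling_bound_doubling_constant:
  assumes "finite X"
  shows "doubling_bound X (\<lambda>x y. enorm (x - y)) (doubling_constant X)"
proof -
  have self: "y \<in> ball_in X y (r / 2)" if "y \<in> X" "0 < r" for y and r :: real
  proof -
    have "enorm (y - y) = 0" by (simp add: enorm_def L2_set_def)
    with that show ?thesis by (simp add: ball_in_def)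
  qed
  have "\<forall>x\<in>X. \<forall>r>0. \<exists>S\<subseteq>X. finite S \<and> card S \<le> card X \<and> ball_in X x r \<subseteq> (\<Union>s\<in>S. ball_in X s (r / 2))"
  proof (intro ballI allI impI exI conjI)
    fix x and r :: real assume "0 < r"
    then show "ball_in X x r \<subseteq> (\<Union>s\<in>X. ball_in X s (r / 2))"
      using self by (fastforce simp: ball_in_def)
  qed (use assms in auto)
  from LeastI[of "\<lambda>l. \<forall>x\<in>X. \<forall>r>0. \<exists>S\<subseteq>X. finite S \<and> card S \<le> l \<and> ball_in X x r \<subseteq> (\<Union>s\<in>S. ball_in X s (r / 2))", OF this]
  show ?thesis unfolding doubling_bound_def doubling_constant_def ball_in_def .
qed

lemma random_pseudometric_proj:
  assumes X: "finite X" "X \<subseteq> carrier_vec m" and d: "0 < d"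
  shows "random_pseudometric (gaussian_entries d m) X (\<lambda>x y. enorm (x - y))
    (\<lambda>\<omega> x y. enorm (proj d m \<omega> x - proj d m \<omega> y)) d (doubling_constant X)"
proof -
  let ?M = "gaussian_entries d m"
  let ?v = "\<lambda>\<omega> x y. enorm (proj d m \<omega> x - proj d m \<omega> y)"
  interpret prob_space ?M by (rule prob_space_gaussian_entries[OF d])
  define Q where "Q x y \<omega> = gaussian_form d m (\<lambda>j. (x - y) $ j) \<omega> / (\<Sum>j<m. ((x - y) $ j)\<^sup>2)" for x y \<omega>
  have car: "x \<in> carrier_vec m" if "x \<in> X" for x using that X(2) by auto
  have pos: "0 < enorm (x - y)" if "x \<in> X" "y \<in> X" "x \<noteq> y" for x y
    using enorm_diff_pos car that by blast
  have sq: "(enorm (x - y))\<^sup>2 = (\<Sum>j<m. ((x - y) $ j)\<^sup>2)" if "x \<in> X" "y \<in> X" for x y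
    using that car[of y] by (simp add: enorm_power2)
  have vQ: "(?v \<omega> x y)\<^sup>2 = Q x y \<omega> * (enorm (x - y))\<^sup>2" if "x \<in> X" "y \<in> X" "x \<noteq> y" for x y \<omega>
  proof -
    have "0 < (\<Sum>j<m. ((x - y) $ j)\<^sup>2)" using pos[OF that] sq[OF that(1,2)] by (metis zero_less_power)
    then show ?thesis
      using proj_dist_power2[OF car car, of x y d \<omega>] that by (simp add: Q_def sq)
  qed
  have chi: "normalized_chi_square ?M (Q x y) d" if "x \<in> X" "y \<in> X" "x \<noteq> y" for x y
    unfolding Q_def using pos[OF that] sq[OF that(1,2)]
    by (intro gaussian_form_normalized[OF d]) (metis zero_less_power)
  have le_iff: "?v \<omega> x y \<le> \<tau> * enorm (x - y) \<longleftrightarrow> Q x y \<omega> \<le> \<tau>\<^sup>2"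
    and ge_iff: "\<tau> * enorm (x - y) \<le> ?v \<omega> x y \<longleftrightarrow> \<tau>\<^sup>2 \<le> Q x y \<omega>"
    if xy: "x \<in> X" "y \<in> X" "x \<noteq> y" and \<tau>: "0 \<le> \<tau>" for x y \<tau> \<omega>
  proof -
    let ?w = "enorm (x - y)"
    have w: "0 < ?w" using pos xy by blast
    have "?v \<omega> x y \<le> \<tau> * ?w \<longleftrightarrow> (?v \<omega> x y)\<^sup>2 \<le> (\<tau> * ?w)\<^sup>2"
      using w \<tau> enorm_nonneg by (intro power_mono_iff[symmetric]) auto
    also have "\<dots> \<longleftrightarrow> Q x y \<omega> \<le> \<tau>\<^sup>2" using w by (simp add: vQ[OF xy] power_mult_distrib)
    finally show "?v \<omega> x y \<le> \<tau> * ?w \<longleftrightarrow> Q x y \<omega> \<le> \<tau>\<^sup>2" .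
    have "\<tau> * ?w \<le> ?v \<omega> x y \<longleftrightarrow> (\<tau> * ?w)\<^sup>2 \<le> (?v \<omega> x y)\<^sup>2"
      using w \<tau> enorm_nonneg by (intro power_mono_iff[symmetric]) auto
    also have "\<dots> \<longleftrightarrow> \<tau>\<^sup>2 \<le> Q x y \<omega>" using w by (simp add: vQ[OF xy] power_mult_distrib)
    finally show "\<tau> * ?w \<le> ?v \<omega> x y \<longleftrightarrow> \<tau>\<^sup>2 \<le> Q x y \<omega>" .
  qed
  interpret w: pseudometric_on X "\<lambda>x y. enorm (x - y)"
    using pseudometric_enorm[of X "\<lambda>x. x" m] car by simp
  show ?thesis
  proof (intro random_pseudometric.intro random_pseudometric_axioms.intro)
    show "prob_space ?M" by unfold_locales
    show "pseudometric_on X (\<lambda>x y. enorm (x - y))" by unfold_locales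
    show "finite X" by fact
    show "0 < enorm (x - y)" if "x \<in> X" "y \<in> X" "x \<noteq> y" for x y using pos that by blast
    show "pseudometric_on X (?v \<omega>)" for \<omega> by (rule pseudometric_enorm[OF proj_carrier])
    show "(\<lambda>\<omega>. ?v \<omega> x y) \<in> borel_measurable ?M" if "x \<in> X" "y \<in> X" for x y
    proof -
      have "?v \<omega> x y = sqrt (gaussian_form d m (\<lambda>j. (x - y) $ j) \<omega>)" for \<omega>
        using proj_dist_power2[OF car car, OF that, of d \<omega>] enorm_nonneg by (metis real_sqrt_unique)
      then show ?thesis by simp
    qed
    show "prob {\<omega> \<in> space ?M. ?v \<omega> x y \<le> \<tau> * enorm (x - y)} \<le> (2 * \<tau>) ^ d"
      if "x \<in> X" "y \<in> X" "x \<noteq> y" "0 \<le> \<tau>" for x y \<tau>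
      using normalized_chi_square.prob_le_small[OF chi[OF that(1-3)] that(4)] le_iff[OF that] by simp
    show "prob {\<omega> \<in> space ?M. ?v \<omega> x y \<le> (1 - e) * enorm (x - y)} \<le> exp (- (e\<^sup>2 * d / 4))"
      if "x \<in> X" "y \<in> X" "x \<noteq> y" "0 < e" "e < 1" for x y e
      using normalized_chi_square.prob_le_contracted[OF chi[OF that(1-3)] that(4,5)]
        le_iff[OF that(1-3), of "1 - e"] that(5) by simp
    show "prob {\<omega> \<in> space ?M. s * enorm (x - y) \<le> ?v \<omega> x y} \<le> (1 / s) ^ d"
      if "x \<in> X" "y \<in> X" "x \<noteq> y" "2 \<le> s" for x y s
      using normalized_chi_square.prob_ge_large[OF chi[OF that(1-3)] that(4)]
        ge_iff[OF that(1-3), of s] that(4) by simp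
    show "(\<integral>\<^sup>+\<omega>. ennreal \<bar>?v \<omega> x y - enorm (x - y)\<bar> \<partial>?M) \<le> ennreal (16 / sqrt d * enorm (x - y))"
      if xy: "x \<in> X" "y \<in> X" for x y
    proof (cases "x = y")
      case True
      have "?v \<omega> x y = 0" for \<omega>
        using pseudometric_on.refl[OF pseudometric_enorm[OF proj_carrier], of x X] xy True by simp
      then show ?thesis using True xy w.refl by simp
    next
      case False
      let ?w = "enorm (x - y)"
      interpret Q: normalized_chi_square ?M "Q x y" d by (rule chi[OF xy False])
      have w: "0 < ?w" using pos xy False by blast
      have "\<bar>?v \<omega> x y - ?w\<bar> \<le> ?w * \<bar>Q x y \<omega> - 1\<bar>" for \<omega>
      proof -
        \<comment> \<open>Passing from squared lengths to lengths: |z - 1| <= |z^2 - 1| for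
          nonnegative z.\<close>
        define z where "z = ?v \<omega> x y / ?w"
        have z: "0 \<le> z" "?v \<omega> x y = z * ?w" using w enorm_nonneg by (simp_all add: z_def)
        have "Q x y \<omega> = z\<^sup>2" using vQ[OF xy False, of \<omega>] w by (simp add: z_def power_divide)
        then have "Q x y \<omega> - 1 = (z - 1) * (z + 1)" by (simp add: power2_eq_square algebra_simps)
        then have "\<bar>Q x y \<omega> - 1\<bar> = \<bar>z - 1\<bar> * (z + 1)" using z(1) by (simp add: abs_mult)
        moreover have "\<bar>z - 1\<bar> * 1 \<le> \<bar>z - 1\<bar> * (z + 1)" using z(1) by (intro mult_left_mono) auto
        ultimately have "?w * \<bar>z - 1\<bar> \<le> ?w * \<bar>Q x y \<omega> - 1\<bar>" using w by (intro mult_left_mono) auto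
        moreover have "\<bar>?v \<omega> x y - ?w\<bar> = ?w * \<bar>z - 1\<bar>"
        proof -
          have "?v \<omega> x y - ?w = ?w * (z - 1)" by (simp add: z(2) algebra_simps)
          then show ?thesis using w by (simp add: abs_mult)
        qed
        ultimately show ?thesis by simp
      qed
      then have "(\<integral>\<^sup>+\<omega>. ennreal \<bar>?v \<omega> x y - ?w\<bar> \<partial>?M) \<le> (\<integral>\<^sup>+\<omega>. ennreal ?w * ennreal \<bar>Q x y \<omega> - 1\<bar> \<partial>?M)"
        using w by (intro nn_integral_mono) (simp add: ennreal_mult[symmetric])
      also have "\<dots> = ennreal ?w * (\<integral>\<^sup>+\<omega>. ennreal \<bar>Q x y \<omega> - 1\<bar> \<partial>?M)"
        using Q.Q_measurable by (intro nn_integral_cmult) simp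
      also have "\<dots> \<le> ennreal ?w * ennreal (16 / sqrt d)"
        using Q.mean_abs_deviation by (intro mult_left_mono) auto
      also have "\<dots> = ennreal (16 / sqrt d * ?w)" using w by (simp add: ennreal_mult[symmetric] mult.commute)
      finally show ?thesis .
    qed
    show "0 < d" by fact
    show "doubling_bound X (\<lambda>x y. enorm (x - y)) (doubling_constant X)"
      by (rule doubling_bound_doubling_constant[OF X(1)])
  qed
qed

section \<open>Arithmetic of the target dimension\<close>

lemma two_powr_le_exp: "0 \<le> y \<Longrightarrow> 2 powr y \<le> exp y" for y :: real
  using ln_le_minus_one[of "2 :: real"] by (simp add: powr_def mult_left_le)

text \<open>The logarithm of 1/\<epsilon> tends to 0 as \<epsilon> approaches 1, whereas the
  argument has additive constants to absorb. The factor \<open>\<beta>\<close> restores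
  \<open>\<beta> * log 2 (1 / \<epsilon>) \<ge> 1\<close> on the whole range up to
  \<open>\<epsilon>\<^sub>0\<close>.\<close>

lemma target_dimension_suffices:
  fixes \<epsilon> \<epsilon>\<^sub>0 :: real and l n d :: nat
  assumes \<epsilon>: "0 < \<epsilon>" "\<epsilon> \<le> \<epsilon>\<^sub>0" "\<epsilon>\<^sub>0 < 1" and l: "2 \<le> l" and n: "2 \<le> n"
  defines "\<beta> \<equiv> max 1 (1 / log 2 (1 / \<epsilon>\<^sub>0))"
  assumes d: "30000000 * \<beta> * (1 / \<epsilon>\<^sup>2) * (log 2 (1 / \<epsilon>) * log 2 l + log 2 (log 2 n)) \<le> d"
  shows "16 / sqrt d \<le> \<epsilon> / 320"
    and "real l ^ 3 * (3 / 4) ^ d \<le> 1 / 2"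
    and "\<exists>h L. 8 / 2 ^ h \<le> \<epsilon> / 32768 \<and> (real n)\<^sup>2 / 2 ^ L \<le> \<epsilon> / 16 \<and>
      14 * real L * real l ^ (3 * h + 3) * exp (- (\<epsilon>\<^sup>2 * d / 256)) \<le> \<epsilon> / 320"
proof -
  define b where "b = log 2 (1 / \<epsilon>)"
  define D where "D = log 2 (real l)"
  define \<nu> where "\<nu> = log 2 (real n)"
  define g where "g = log 2 \<nu>"
  have b0: "0 < log 2 (1 / \<epsilon>\<^sub>0)" "log 2 (1 / \<epsilon>\<^sub>0) \<le> b"
    using \<epsilon> by (auto simp: b_def log_divide)
  have bpos: "0 < b" using b0 by linarith
  have \<beta>: "1 \<le> \<beta>" by (simp add: \<beta>_def)
  have \<beta>b: "1 \<le> \<beta> * b"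
  proof -
    have "1 = 1 / log 2 (1 / \<epsilon>\<^sub>0) * log 2 (1 / \<epsilon>\<^sub>0)" using b0(1) by simp
    also have "\<dots> \<le> \<beta> * b" using b0 \<beta> by (intro mult_mono) (auto simp: \<beta>_def)
    finally show ?thesis .
  qed
  have D: "1 \<le> D" using l by (simp add: D_def le_log_iff)
  have \<nu>: "1 \<le> \<nu>" using n by (simp add: \<nu>_def le_log_iff)
  have g: "0 \<le> g" using \<nu> by (simp add: g_def)
  have lD: "real l = 2 powr D" and n\<nu>: "real n = 2 powr \<nu>" and \<epsilon>b: "1 / \<epsilon> = 2 powr b" and \<nu>g: "\<nu> = 2 powr g"
    using l n \<epsilon> \<nu> by (auto simp: D_def \<nu>_def b_def g_def)
  \<comment> \<open>One quantity above 1, \<open>b\<close>, \<open>\<beta> * b\<close> and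
    \<open>D\<close>; every term except the number of scales is bounded by a multiple of it.\<close>
  define z where "z = \<beta> * b * D"
  have z: "1 \<le> z" "\<beta> * b \<le> z" "D \<le> z" "b \<le> z"
  proof -
    have "\<beta> * b * 1 \<le> \<beta> * b * D" using D \<beta>b by (intro mult_left_mono) auto
    then show "\<beta> * b \<le> z" by (simp add: z_def)
    then show "1 \<le> z" using \<beta>b by linarith
    have "1 * D \<le> \<beta> * b * D" using D \<beta>b by (intro mult_right_mono) auto
    then show "D \<le> z" by (simp add: z_def)
    have "1 * b \<le> \<beta> * b" using \<beta> bpos by (intro mult_right_mono) auto
    then show "b \<le> z" using \<open>\<beta> * b \<le> z\<close> by linarith
  qed
  have main: "30000000 * (z + g) \<le> \<epsilon>\<^sup>2 * d"
  proof -
    have "30000000 * \<beta> * (b * D + g) \<le> \<epsilon>\<^sup>2 * d"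
      using d \<epsilon>(1) by (simp add: b_def D_def g_def \<nu>_def field_simps)
    moreover have "1 * g \<le> \<beta> * g" using \<beta> g by (intro mult_right_mono) auto
    ultimately show ?thesis by (simp add: z_def algebra_simps)
  qed
  have "\<epsilon> \<le> 1" using \<epsilon> by linarith
  then have "\<epsilon>\<^sup>2 * d \<le> 1 * real d" using \<epsilon>(1) by (intro mult_right_mono) (auto simp: power_le_one)
  then have dz: "30000000 * z \<le> real d" using main g by argo

  show "16 / sqrt d \<le> \<epsilon> / 320"
  proof -
    \<comment> \<open>5120 is 16 * 320, and its square 26214400 accounts for the size of the
      constant 30000000.\<close>
    have "5120\<^sup>2 \<le> (\<epsilon> * sqrt d)\<^sup>2" using main z g by (simp add: power_mult_distrib)
    then have "5120 \<le> \<epsilon> * sqrt d" by (rule power2_le_imp_le) (use \<epsilon> in auto)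
    moreover have "0 < sqrt d" using dz z by simp
    ultimately show ?thesis by (simp add: field_simps)
  qed

  show "real l ^ 3 * (3 / 4) ^ d \<le> 1 / 2"
  proof -
    have "(3 / 4 :: real) \<le> 2 powr (- 1 / 3)"
    proof (rule power_le_imp_le_base[of _ 2])
      have "((2 :: real) powr (- 1 / 3)) ^ 3 = 2 powr (- 1 / 3 * real 3)" by (subst powr_power) auto
      also have "\<dots> = 1 / 2" by (simp add: powr_minus_divide)
      finally have "((2 :: real) powr (- 1 / 3)) ^ 3 = 1 / 2" .
      then show "(3 / 4 :: real) ^ Suc 2 \<le> (2 powr (- 1 / 3)) ^ Suc 2" by (simp add: numeral_3_eq_3[symmetric] power_numeral_reduce)
    qed simp
    then have "(3 / 4 :: real) ^ d \<le> (2 powr (- 1 / 3)) ^ d" by (intro power_mono) auto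
    also have "\<dots> = 2 powr (- real d / 3)" by (simp add: powr_realpow[symmetric] powr_powr)
    finally have "real l ^ 3 * (3 / 4) ^ d \<le> 2 powr (3 * D) * 2 powr (- real d / 3)"
      by (intro mult_mono) (simp_all add: lD powr_realpow[symmetric] powr_powr mult.commute)
    also have "\<dots> = 2 powr (3 * D - d / 3)" by (simp add: powr_add[symmetric])
    also have "\<dots> \<le> 2 powr (- 1)" using dz z by (intro powr_mono) auto
    finally show ?thesis by (simp add: powr_minus_divide)
  qed

  \<comment> \<open>\<open>8 * 32768\<close> is 2^18; in the same way the next line takes the
    logarithm of 16 n^2 / \<epsilon>.\<close>
  define h where "h = nat \<lceil>18 + b\<rceil>"
  define L where "L = nat \<lceil>4 + 2 * \<nu> + b\<rceil>"
  have h: "18 + b \<le> real h" "real h \<le> 19 + b" using bpos unfolding h_def by linarith+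
  have L: "4 + 2 * \<nu> + b \<le> real L" "real L \<le> 5 + 2 * \<nu> + b" using bpos \<nu> unfolding L_def by linarith+
  have "8 / 2 ^ h \<le> \<epsilon> / 32768"
  proof -
    have "2 powr (18 + b) \<le> 2 powr real h" using h by (intro powr_mono) auto
    then have "262144 * (1 / \<epsilon>) \<le> 2 ^ h" by (simp add: powr_add \<epsilon>b powr_realpow)
    then show ?thesis using \<epsilon> by (simp add: field_simps)
  qed
  moreover have "(real n)\<^sup>2 / 2 ^ L \<le> \<epsilon> / 16"
  proof -
    have "2 powr (4 + 2 * \<nu> + b) \<le> 2 powr real L" using L by (intro powr_mono) auto
    moreover have "2 powr (4 + 2 * \<nu> + b) = 16 * (real n)\<^sup>2 * (1 / \<epsilon>)"
      by (simp add: powr_add \<epsilon>b n\<nu> powr_realpow[symmetric] powr_powr mult.commute)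
    ultimately have "16 * (real n)\<^sup>2 * (1 / \<epsilon>) \<le> 2 ^ L" by (simp add: powr_realpow)
    then show ?thesis using \<epsilon> by (simp add: field_simps)
  qed
  moreover have "14 * real L * real l ^ (3 * h + 3) * exp (- (\<epsilon>\<^sup>2 * d / 256)) \<le> \<epsilon> / 320"
  proof -
    \<comment> \<open>The number of scales is about log n, that is \<open>2 powr g\<close> up to the
      factor \<open>\<beta> * b\<close>; in the exponent it costs only \<open>g\<close>, the
      iterated logarithm.\<close>
    have L': "real L \<le> exp (3 + z + g)"
    proof -
      have a: "1 * \<nu> \<le> \<beta> * b * \<nu>" using \<nu> \<beta>b by (intro mult_right_mono) auto
      have "b * 1 \<le> \<beta> * b * \<nu>" using \<nu> \<beta> bpos by (intro mult_mono) auto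
      then have "real L \<le> 8 * (\<beta> * b) * \<nu>" using L(2) a \<nu> by linarith
      also have "\<dots> \<le> exp 3 * exp z * exp g"
      proof (intro mult_mono)
        show "8 \<le> exp (3 :: real)" using two_powr_le_exp[of 3] by simp
        show "\<beta> * b \<le> exp z" using exp_ge_add_one_self[of z] z(2) by linarith
        show "\<nu> \<le> exp g" using two_powr_le_exp[OF g] \<nu>g by simp
      qed (use \<nu> \<beta>b in auto)
      finally show ?thesis by (simp add: exp_add)
    qed
    have l': "real l ^ (3 * h + 3) \<le> exp (63 * z)"
    proof -
      have "real l ^ (3 * h + 3) = 2 powr (D * (3 * h + 3))"
        using l by (simp add: lD powr_realpow[symmetric] powr_powr)
      also have "\<dots> \<le> exp (D * (3 * h + 3))" using D by (intro two_powr_le_exp) auto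
      also have "\<dots> \<le> exp (63 * z)"
      proof -
        have "1 * b \<le> \<beta> * b" using \<beta> bpos by (intro mult_right_mono) auto
        then have "3 * real h + 3 \<le> 63 * (\<beta> * b)" using h \<beta>b by linarith
        then have "D * (3 * real h + 3) \<le> D * (63 * (\<beta> * b))" using D by (intro mult_left_mono) auto
        then show ?thesis by (simp add: z_def mult_ac)
      qed
      finally show ?thesis .
    qed
    have e': "1 / \<epsilon> \<le> exp z"
      unfolding \<epsilon>b using two_powr_le_exp[of b] bpos z(4) by (meson exp_le_cancel_iff less_imp_le order_trans)
    have c': "4480 \<le> exp (13 :: real)" using two_powr_le_exp[of 13] by simp
    \<comment> \<open>4480 is 14 * 320, from moving both constants of the goal to one side.\<close>
    have "4480 * real L * real l ^ (3 * h + 3) * (1 / \<epsilon>) \<le> exp 13 * exp (3 + z + g) * exp (63 * z) * exp z"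
      using \<epsilon>(1) by (intro mult_mono L' l' e' c') auto
    also have "\<dots> = exp (16 + 65 * z + g)" by (simp add: exp_add[symmetric])
    also have "\<dots> \<le> exp (\<epsilon>\<^sup>2 * d / 256)" using main z g by simp
    finally have "4480 * real L * real l ^ (3 * h + 3) * (1 / \<epsilon>) \<le> exp (\<epsilon>\<^sup>2 * d / 256)" .
    then show ?thesis using \<epsilon>(1) by (simp add: exp_minus field_simps)
  qed
  ultimately show "\<exists>h L. 8 / 2 ^ h \<le> \<epsilon> / 32768 \<and> (real n)\<^sup>2 / 2 ^ L \<le> \<epsilon> / 16 \<and>
      14 * real L * real l ^ (3 * h + 3) * exp (- (\<epsilon>\<^sup>2 * d / 256)) \<le> \<epsilon> / 320" by blast
qed

text \<open>The constant is uniform for \<epsilon> up to a fixed bound below 1, and depends on this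
  bound through the factor that compensates a small log(1/\<epsilon>). Quantifying over all minimum
  spanning trees inside the events covers ties.\<close>

theorem theorem5p1:
  fixes \<epsilon>\<^sub>0 :: real
  assumes "\<epsilon>\<^sub>0 < 1"
  shows "\<exists>C\<^sub>6>0. \<forall>(\<epsilon>::real) (m::nat) (d::nat) (n::nat) (X :: real vec set) Mst M.
    0 < \<epsilon> \<longrightarrow> \<epsilon> \<le> \<epsilon>\<^sub>0 \<longrightarrow> 0 < m \<longrightarrow> 0 < d \<longrightarrow>
    X \<subseteq> carrier_vec m \<longrightarrow> finite X \<longrightarrow> card X = n \<longrightarrow>
    is_mst X (\<lambda>x. x) Mst \<longrightarrow> M = tree_cost (\<lambda>x. x) Mst \<longrightarrow>
    real d \<ge> C\<^sub>6 * (1 / \<epsilon>\<^sup>2) * (log 2 (1 / \<epsilon>) * doubling_dim X + log 2 (log 2 (real n))) \<longrightarrow>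
    \<P>(\<omega> in gaussian_entries d m. \<forall>T. is_mst X (proj d m \<omega>) T \<longrightarrow>
        tree_cost (proj d m \<omega>) T \<in> {(1 - \<epsilon>) * M .. (1 + \<epsilon>) * M}) \<ge> 9 / 10 \<and>
    \<P>(\<omega> in gaussian_entries d m. \<forall>T. is_mst X (proj d m \<omega>) T \<longrightarrow>
        tree_cost (\<lambda>x. x) T \<in> {M .. (1 + \<epsilon>) * M}) \<ge> 9 / 10"
proof (intro exI conjI allI impI)
  let ?C = "30000000 * max 1 (1 / log 2 (1 / \<epsilon>\<^sub>0))"
  show "0 < ?C" by simp
  fix \<epsilon> :: real and m d n :: nat and X :: "real vec set" and Mst M
  assume \<epsilon>: "0 < \<epsilon>" "\<epsilon> \<le> \<epsilon>\<^sub>0" and d: "0 < d" and X: "X \<subseteq> carrier_vec m" "finite X" "card X = n"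
    and mst: "is_mst X (\<lambda>x. x) Mst" and M: "M = tree_cost (\<lambda>x. x) Mst"
    and large: "?C * (1 / \<epsilon>\<^sup>2) * (log 2 (1 / \<epsilon>) * doubling_dim X + log 2 (log 2 (real n))) \<le> real d"
  let ?M = "gaussian_entries d m"
  let ?v = "\<lambda>\<omega> x y. enorm (proj d m \<omega> x - proj d m \<omega> y)"
  let ?w = "\<lambda>x y. enorm (x - y) :: real"
  interpret R: random_pseudometric ?M X ?w ?v d "doubling_constant X"
    by (rule random_pseudometric_proj[OF X(2,1) d])
  let ?P = "\<lambda>\<omega> T. edge_cost (?v \<omega>) T \<in> {(1 - \<epsilon>) * M..(1 + \<epsilon>) * M}"
  let ?Q = "\<lambda>T. edge_cost ?w T \<in> {M..(1 + \<epsilon>) * M}"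
  have M': "M = edge_cost ?w Mst" using M by (simp add: tree_cost_eq_edge_cost)
  have mst': "min_tree X ?w Mst" using mst by (simp add: is_mst_iff_min_tree)
  have "\<exists>G\<in>R.events. 9 / 10 \<le> R.prob G \<and> (\<forall>\<omega>\<in>G. \<forall>T. min_tree X (?v \<omega>) T \<longrightarrow> ?P \<omega> T \<and> ?Q T)"
  proof (cases "2 \<le> n")
    case True
    have "\<exists>x\<in>X. \<exists>y\<in>X. x \<noteq> y"
      using True X card_le_Suc0_iff_eq[OF X(2)] by (metis not_less_eq_eq numeral_2_eq_2)
    then obtain x y where "x \<in> X" "y \<in> X" "0 < ?w x y" using R.w_pos by blast
    then have l2: "2 \<le> doubling_constant X" by (rule R.orig.doubling_bound_ge_2[OF R.doubling X(2)])
    note N = target_dimension_suffices[OF \<epsilon> assms l2 True large[unfolded doubling_dim_def]]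
    from N(3) obtain h L where hL: "8 / 2 ^ h \<le> \<epsilon> / 32768" "(real n)\<^sup>2 / 2 ^ L \<le> \<epsilon> / 16"
      "14 * real L * real (doubling_constant X) ^ (3 * h + 3) * exp (- (\<epsilon>\<^sup>2 * d / 256)) \<le> \<epsilon> / 320" by blast
    have "\<epsilon> \<le> 1" using \<epsilon> assms by linarith
    from R.good_event[OF mst' _ \<epsilon>(1) this l2 N(2) N(1) hL(1) _ hL(3)] show ?thesis
      using True hL(2) X(3) by (simp add: M')
  next
    case False
    \<comment> \<open>With at most one point the iterated logarithm of \<open>n\<close> is just a
      default value; the only tree is empty and all costs are 0.\<close>
    have tree: "T = {}" if "is_spanning_tree X T" for T
    proof (rule ccontr)
      assume "T \<noteq> {}"
      then obtain x y where xy: "(x, y) \<in> T" by auto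
      then have "x \<in> X" "y \<in> X" using that by (auto simp: is_spanning_tree_def)
      moreover have "card X \<le> Suc 0" using False X(3) by simp
      ultimately have "x = y" using card_le_Suc0_iff_eq[OF X(2)] by blast
      then show False using xy that by (auto simp: is_spanning_tree_def)
    qed
    have "Mst = {}" using mst' tree by (simp add: min_tree_def)
    then have "M = 0" by (simp add: M' edge_cost_def)
    have "?P \<omega> T \<and> ?Q T" if "min_tree X (?v \<omega>) T" for \<omega> T
    proof -
      have "T = {}" using that tree by (simp add: min_tree_def)
      then show ?thesis using \<open>M = 0\<close> by (simp add: edge_cost_def)
    qed
    then show ?thesis by (intro bexI[of _ "space ?M"]) (auto simp: R.prob_space)
  qed
  then obtain G where G: "G \<in> R.events" "9 / 10 \<le> R.prob G"
    "\<And>\<omega> T. \<omega> \<in> G \<Longrightarrow> min_tree X (?v \<omega>) T \<Longrightarrow> ?P \<omega> T \<and> ?Q T" by blast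
  have GM: "G \<subseteq> space ?M" using G(1) by (rule sets.sets_into_space)
  have conclude: "9 / 10 \<le> R.prob {\<omega> \<in> space ?M. \<forall>T. min_tree X (?v \<omega>) T \<longrightarrow> S \<omega> T}"
    if "\<And>T. is_spanning_tree X T \<Longrightarrow> {\<omega> \<in> space ?M. S \<omega> T} \<in> R.events"
      and "\<And>\<omega> T. \<omega> \<in> G \<Longrightarrow> min_tree X (?v \<omega>) T \<Longrightarrow> S \<omega> T" for S
  proof -
    have "R.prob G \<le> R.prob {\<omega> \<in> space ?M. \<forall>T. min_tree X (?v \<omega>) T \<longrightarrow> S \<omega> T}"
      using that(2) GM by (intro R.finite_measure_mono R.min_tree_event that(1)) auto
    with G(2) show ?thesis by linarith
  qed
  have cost: "(\<lambda>\<omega>. edge_cost (?v \<omega>) T) \<in> borel_measurable ?M" if "is_spanning_tree X T" for T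
    unfolding edge_cost_def using that R.v_measurable
    by (intro borel_measurable_sum) (auto simp: is_spanning_tree_def)
  show "\<P>(\<omega> in ?M. \<forall>T. is_mst X (proj d m \<omega>) T \<longrightarrow>
        tree_cost (proj d m \<omega>) T \<in> {(1 - \<epsilon>) * M .. (1 + \<epsilon>) * M}) \<ge> 9 / 10"
    unfolding is_mst_iff_min_tree tree_cost_eq_edge_cost
  proof (rule conclude)
    show "{\<omega> \<in> space ?M. ?P \<omega> T} \<in> R.events" if "is_spanning_tree X T" for T
      using cost[OF that] by measurable
  qed (use G(3) in blast)
  show "\<P>(\<omega> in ?M. \<forall>T. is_mst X (proj d m \<omega>) T \<longrightarrow>
        tree_cost (\<lambda>x. x) T \<in> {M .. (1 + \<epsilon>) * M}) \<ge> 9 / 10"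
    unfolding is_mst_iff_min_tree tree_cost_eq_edge_cost
  proof (rule conclude)
    show "{\<omega> \<in> space ?M. ?Q T} \<in> R.events" for T by simp
  qed (use G(3) in blast)
qed

end
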